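(* Suppose $X_1,\dots,X_n$ are i.i.d. $\mathrm{Pareto}(\theta)$ with shape $\theta>1$ and scale $x_0>0$. For any $\delta\in(0,1)$, let the exploration length satisfy $m=o(n)$ and $m=\omega(\log(1/\delta)\log^2n)$. Then the stopping policy $\tau$ of the algorithm CDP-OL with horizon $n$, exploration length $m$ and confidence parameter $\delta$ satisfies $$\mathrm{CR}_n(\tau;\theta)\ge(1-\delta)\,\rho(1,\theta)\left(1-O\!\left(\frac mn+\frac{\log(1/\delta)\log^2n}{m}\right)\right),\qquad \rho(1,\theta):=\frac{\left(\frac{\theta}{\theta-1}\right)^{1/\theta}}{\Gamma(1-1/\theta)}.$$
   Context: $\mathrm{Pareto}(\theta)$ with known scale $x_0>0$: $F_\theta(x)=1-(x_0/x)^\theta$ for $x\ge x_0$ and $0$ otherwise. Stopping problem: the rewards $X_1,\dots,X_n$ are observed sequentially, with $\theta$ unknown to the policy. A policy is a stopping time $\tau$ adapted to $(X_t)$, with reward $X_\tau$. $\mathrm{OPT}(\theta):=\mathbb E_\theta[\max_{t\in[n]}X_t]$ and $\mathrm{CR}_n(\tau;\theta):=\mathbb E_\theta[X_\tau]/\mathrm{OPT}(\theta)$. Algorithm CDP-OL for Pareto rewards (horizon $n$, exploration length $m<n$, confidence parameter $\delta$): reject $X_1,\dots,X_m$. Put $\widehat\theta_m=m/\sum_{i=1}^m\log(X_i/x_0)$, $\varepsilon_m=\sqrt{4\log(2/\delta)/m}$, $\theta^{(\mathrm U)}=(1+\varepsilon_m)\widehat\theta_m$, $N=n-m$. Compute $\widehat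 V_N=\mathbb E_{\theta^{(\mathrm U)}}[X_1]=\frac{\theta^{(\mathrm U)}x_0}{\theta^{(\mathrm U)}-1}$ and $\widehat V_i=\widehat V_{i+1}+\frac{x_0^{\theta^{(\mathrm U)}}}{\theta^{(\mathrm U)}-1}\widehat V_{i+1}^{\,1-\theta^{(\mathrm U)}}$ for $i=N-1,\dots,1$ (if $\theta^{(\mathrm U)}\le1$, the mean $\mathbb E_{\theta^{(\mathrm U)}}[X_1]$ is infinite and all thresholds are $+\infty$). Then $\tau=m+t$ for the smallest $t\in\{1,\dots,N-1\}$ with $X_{m+t}\ge\widehat V_{t+1}$, and $\tau=n$ if no such $t$ exists. Asymptotic notation is as $n\to\infty$. *)

theory Defs
  imports "HOL-Probability.Probability" "HOL-Library.Landau_Symbols"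
begin

definition pareto_cdf :: "real \<Rightarrow> real \<Rightarrow> real \<Rightarrow> real" where
  "pareto_cdf \<theta> x0 x = (if x \<ge> x0 then 1 - (x0 / x) powr \<theta> else 0)"

text \<open>Rewards are indexed from 1: the sample of horizon \<open>n\<close> is \<open>X 1, \<dots>, X n\<close>.\<close>

definition iid_pareto ::
  "'a measure \<Rightarrow> nat \<Rightarrow> (nat \<Rightarrow> 'a \<Rightarrow> real) \<Rightarrow> real \<Rightarrow> real \<Rightarrow> bool" where
  "iid_pareto M n X \<theta> x0 \<longleftrightarrow>
     prob_space M \<and>
     prob_space.indep_vars M (\<lambda>_. borel) X {1..n} \<and>
     (\<forall>t\<in>{1..n}. \<forall>x. cdf (distr M borel (X t)) x = pareto_cdf \<theta> x0 x)"

definition opt :: "'a measure \<Rightarrow> nat \<Rightarrow> (nat \<Rightarrow> 'a \<Rightarrow> real) \<Rightarrow> real" where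
  "opt M n X = (\<integral>\<omega>. (MAX t\<in>{1..n}. X t \<omega>) \<partial>M)"

definition competitive_ratio ::
  "'a measure \<Rightarrow> nat \<Rightarrow> (nat \<Rightarrow> 'a \<Rightarrow> real) \<Rightarrow> ('a \<Rightarrow> nat) \<Rightarrow> real" where
  "competitive_ratio M n X \<tau> = (\<integral>\<omega>. X (\<tau> \<omega>) \<omega> \<partial>M) / opt M n X"

definition theta_hat :: "nat \<Rightarrow> real \<Rightarrow> (nat \<Rightarrow> real) \<Rightarrow> real" where
  "theta_hat m x0 x = real m / (\<Sum>i=1..m. ln (x i / x0))"

definition eps :: "nat \<Rightarrow> real \<Rightarrow> real" where
  "eps m \<delta> = sqrt (4 * ln (2 / \<delta>) / real m)"

definition theta_U :: "nat \<Rightarrow> real \<Rightarrow> real \<Rightarrow> (nat \<Rightarrow> real) \<Rightarrow> real" where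
  "theta_U m \<delta> x0 x = (1 + eps m \<delta>) * theta_hat m x0 x"

text \<open>The backward recursion, indexed by the number \<open>k\<close> of steps back from the last stage \<open>N\<close>:
  for a shape \<open>\<theta> > 1\<close>, \<open>dp_value \<theta> x0 k\<close> is the value at stage \<open>N - k\<close>.\<close>

primrec dp_value :: "real \<Rightarrow> real \<Rightarrow> nat \<Rightarrow> real" where
  "dp_value \<theta> x0 0 = \<theta> * x0 / (\<theta> - 1)"
| "dp_value \<theta> x0 (Suc k) =
     dp_value \<theta> x0 k + x0 powr \<theta> / (\<theta> - 1) * dp_value \<theta> x0 k powr (1 - \<theta>)"

definition V_hat :: "real \<Rightarrow> real \<Rightarrow> nat \<Rightarrow> nat \<Rightarrow> ereal" where
  "V_hat \<theta> x0 N i = (if \<theta> \<le> 1 then \<infinity> else ereal (dp_value \<theta> x0 (N - i)))"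

text \<open>The stopping time of CDP-OL as a function of the observed reward sequence \<open>x\<close>.\<close>

definition cdp_ol :: "nat \<Rightarrow> nat \<Rightarrow> real \<Rightarrow> real \<Rightarrow> (nat \<Rightarrow> real) \<Rightarrow> nat" where
  "cdp_ol n m \<delta> x0 x =
     (let N = n - m;
          A = {t \<in> {1..N - 1}. ereal (x (m + t)) \<ge> V_hat (theta_U m \<delta> x0 x) x0 N (t + 1)}
      in if A = {} then n else m + Min A)"

text \<open>The policy does not anticipate: whether it stops at \<open>s\<close> depends on \<open>x 1, \<dots>, x s\<close> only.\<close>

lemma cdp_ol_nonanticipating:
  assumes "m < n" and eq: "\<And>i. i \<in> {1..s} \<Longrightarrow> x i = y i" and stop: "cdp_ol n m \<delta> x0 x = s"
  shows "cdp_ol n m \<delta> x0 y = s"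
proof -
  define A where "A z = {t \<in> {1..n - m - 1}.
    ereal (z (m + t)) \<ge> V_hat (theta_U m \<delta> x0 z) x0 (n - m) (t + 1)}" for z
  have cdp: "cdp_ol n m \<delta> x0 z = (if A z = {} then n else m + Min (A z))" for z
    by (simp only: cdp_ol_def A_def Let_def)
  have fin: "finite (A z)" for z by (simp add: A_def)
  have ms: "m \<le> s"
    using stop \<open>m < n\<close> by (auto simp: cdp split: if_splits)
  have "(\<Sum>i=1..m. ln (x i / x0)) = (\<Sum>i=1..m. ln (y i / x0))"
    using eq ms by (intro sum.cong) auto
  hence theta: "theta_U m \<delta> x0 x = theta_U m \<delta> x0 y"
    by (simp add: theta_U_def theta_hat_def)
  have mem: "t \<in> A x \<longleftrightarrow> t \<in> A y" if "m + t \<le> s" for t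
    using eq[of "m + t"] that by (auto simp: A_def theta)
  show ?thesis
  proof (cases "A x = {}")
    case True
    hence "s = n" using stop by (simp add: cdp)
    have "m + t \<le> s" if "t \<in> A y" for t
      using that \<open>s = n\<close> \<open>m < n\<close> by (auto simp: A_def)
    hence "A y = {}" using mem True by blast
    thus ?thesis using \<open>s = n\<close> by (simp add: cdp)
  next
    case False
    hence s: "s = m + Min (A x)" using stop by (simp add: cdp)
    have in_y: "Min (A x) \<in> A y" using mem[of "Min (A x)"] s Min_in[OF fin False] by simp
    have "Min (A x) \<le> t" if "t \<in> A y" for t
      using mem[of t] that s Min_le[OF fin, of t x] by (cases "m + t \<le> s") auto
    hence "Min (A y) = Min (A x)" using in_y fin by (intro Min_eqI) auto
    thus ?thesis using s in_y by (auto simp: cdp)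
  qed
qed

definition rho1 :: "real \<Rightarrow> real" where
  "rho1 \<theta> = (\<theta> / (\<theta> - 1)) powr (1 / \<theta>) / Gamma (1 - 1 / \<theta>)"

end

theory Submission
  imports Defs
begin

text \<open>The expected reward of a fixed threshold policy obeys an affine recursion in the number of
  remaining observations, and the dynamic programming thresholds maximise each step of it. A relative
  error \<open>l\<close> in a threshold therefore costs only \<open>O(l\<^sup>2)\<close>. Thresholds computed for a
  shape \<open>\<theta>'\<close> have \<open>\<bar>l\<bar> = O(\<bar>\<theta>' - \<theta>\<bar> (1 + ln n) + 1 / sqrt k)\<close> with
  \<open>k\<close> observations left, so the policy earns
  \<open>x0 (\<theta> / (\<theta> - 1) N)\<^sup>1\<^sup>/\<^sup>\<theta>\<close> up to the relative error
  \<open>O((\<bar>\<theta>' - \<theta>\<bar> (1 + ln n))\<^sup>2 + 1 / sqrt N)\<close>, whereas the expected maximum is at most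
  \<open>x0 \<Gamma>(1 - 1 / \<theta>) (n + 1)\<^sup>1\<^sup>/\<^sup>\<theta>\<close>.

  The confidence level \<open>\<delta>\<close> may depend on \<open>n\<close>, which leads to two regimes. If \<open>\<delta>\<close> stays away from
  \<open>1\<close>, a Chernoff bound for the Erlang distributed sum of logarithms puts \<open>\<theta>\<^sup>U\<close> into
  \<open>[\<theta>, \<theta> (1 + 4 \<epsilon>)]\<close> with probability at least \<open>1 - \<delta>\<close>, and \<open>\<epsilon> ln n\<close> is small.
  If \<open>\<delta>\<close> is close to \<open>1\<close>, then \<open>\<epsilon> ln n\<close> need not be small, but only the factor \<open>1 - \<delta>\<close> has to
  be beaten: by a lower bound on the Erlang density, \<open>\<theta>\<^sup>U\<close> is within \<open>O(1 / ln n)\<close> of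
  \<open>\<theta>\<close> with probability at least a constant times \<open>min 1 (sqrt m / ln n)\<close>, which
  exceeds a given multiple of \<open>1 - \<delta>\<close> for \<open>\<delta>\<close> close to \<open>1\<close> and large \<open>n\<close>, because \<open>1 - \<delta> \<le> ln (1 / \<delta>)\<close> and
  \<open>m\<close> dominates \<open>ln (1 / \<delta>) ln\<^sup>2 n\<close>.\<close>

section \<open>Thresholds for a misspecified shape\<close>

text \<open>Bernoulli's inequality for real exponents: with
  \<open>x powr p = x * exp ((p - 1) * ln x)\<close> it follows from
  \<open>exp y \<ge> 1 + y\<close> and \<open>x * ln x \<ge> x - 1\<close>.\<close>

lemma powr_ge_tangent:
  fixes x p :: real
  assumes "x > 0" "p \<ge> 1"
  shows "x powr p \<ge> 1 + p * (x - 1)"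
proof -
  have a: "exp ((p - 1) * ln x) \<ge> 1 + (p - 1) * ln x" by simp
  have "ln (1 / x) \<le> 1 / x - 1" using assms by (intro ln_le_minus_one) auto
  hence "x * ln x \<ge> x - 1" using assms by (simp add: ln_div field_simps)
  hence b: "(p - 1) * (x * ln x) \<ge> (p - 1) * (x - 1)" using assms by (intro mult_left_mono) auto
  have "x powr p = x * x powr (p - 1)" using assms by (simp add: powr_diff)
  also have "\<dots> \<ge> x * (1 + (p - 1) * ln x)"
    using a assms by (intro mult_left_mono) (auto simp: powr_def mult.commute)
  finally show ?thesis using b by (simp add: algebra_simps)
qed

text \<open>The concave counterpart: the convex inequality with exponent \<open>1 / s\<close> at the
  base \<open>1 + s * x\<close>, raised to the power \<open>s\<close>.\<close>

lemma powr_le_tangent: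
  fixes x s :: real
  assumes "x \<ge> 0" "0 < s" "s \<le> 1"
  shows "(1 + x) powr s \<le> 1 + s * x"
proof -
  have "0 < 1 + s * x" using assms by (simp add: add_pos_nonneg)
  have "1 + (1 / s) * ((1 + s * x) - 1) \<le> (1 + s * x) powr (1 / s)"
    using assms by (intro powr_ge_tangent) (auto intro: add_pos_nonneg)
  hence "1 + x \<le> (1 + s * x) powr (1 / s)" using assms by simp
  hence "(1 + x) powr s \<le> ((1 + s * x) powr (1 / s)) powr s"
    using assms by (intro powr_mono2) auto
  also have "\<dots> = 1 + s * x" using assms \<open>0 < 1 + s * x\<close> by (simp add: powr_powr)
  finally show ?thesis .
qed

text \<open>A second order bound for both signs, needed because threshold errors are to enter
  quadratically. For \<open>x \<ge> 0\<close> the estimate \<open>exp x - 1 \<le> x * exp x\<close>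
  is used twice; for \<open>x < 0\<close> it comes from
  \<open>1 / (1 + y) \<le> 1 - y + y * y\<close>.\<close>

lemma exp_le_quadratic:
  fixes x :: real
  shows "exp x \<le> 1 + x + x\<^sup>2 * exp \<bar>x\<bar>"
proof (cases "x \<ge> 0")
  case True
  have "exp (- x) \<ge> 1 - x" using exp_ge_add_one_self[of "-x"] by simp
  hence "exp x * (1 - x) \<le> exp x * exp (- x)" by (intro mult_left_mono) auto
  hence "exp x - 1 \<le> x * exp x" by (simp add: algebra_simps flip: exp_add)
  hence "x * (exp x - 1) \<le> x * (x * exp x)" using True by (intro mult_left_mono) auto
  thus ?thesis using True \<open>exp x - 1 \<le> x * exp x\<close> by (simp add: algebra_simps power2_eq_square)
next
  case False
  define y where "y = - x"
  have y: "y > 0" using False by (simp add: y_def)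
  have "1 + y \<le> exp y" by simp
  hence "exp (- y) \<le> 1 / (1 + y)" using y by (simp add: exp_minus field_simps)
  also have "\<dots> \<le> 1 - y + y\<^sup>2" using y by (simp add: field_simps power2_eq_square)
  also have "\<dots> \<le> 1 - y + y\<^sup>2 * exp y" using y by simp
  finally show ?thesis using False by (simp add: y_def)
qed

section \<open>Growth of the dynamic programming thresholds\<close>

text \<open>The recursion is homogeneous in the scale because
  \<open>x0 powr \<theta> * x0 powr (1 - \<theta>) = x0\<close>, so the threshold estimates can be
  made with scale \<open>1\<close>.\<close>

lemma dp_value_scale:
  assumes "x0 > 0"
  shows "dp_value \<theta> x0 k = x0 * dp_value \<theta> 1 k"
proof (induction k)
  case (Suc k)
  have "x0 powr \<theta> * x0 powr (1 - \<theta>) = x0" using assms by (simp flip: powr_add)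
  moreover have "(x0 * dp_value \<theta> 1 k) powr (1 - \<theta>) =
      x0 powr (1 - \<theta>) * dp_value \<theta> 1 k powr (1 - \<theta>)"
    using assms by (simp add: powr_def ln_mult algebra_simps exp_add[symmetric])
  ultimately show ?case unfolding dp_value.simps Suc
    by (simp add: field_simps)
qed simp

lemma dp_value_ge_1:
  assumes "\<theta> > 1"
  shows "dp_value \<theta> 1 k \<ge> 1"
proof (induction k)
  case (Suc k)
  have "1 / (\<theta> - 1) * dp_value \<theta> 1 k powr (1 - \<theta>) \<ge> 0" using assms by auto
  thus ?case using Suc by simp
qed (use assms in simp)

lemma dp_value_Suc_mult:
  assumes "\<theta> > 1"
  shows "dp_value \<theta> 1 (Suc k) =
    dp_value \<theta> 1 k * (1 + dp_value \<theta> 1 k powr (- \<theta>) / (\<theta> - 1))"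
  using dp_value_ge_1[OF assms, of k]
  by (simp add: powr_diff powr_minus field_simps)

text \<open>By Bernoulli's inequality each step raises the \<open>\<theta>\<close>-th power by at
  least \<open>\<theta> / (\<theta> - 1)\<close>: the factor \<open>V powr (- \<theta>)\<close> in
  the relative increment cancels against \<open>V powr \<theta>\<close>.\<close>

lemma dp_value_powr_lower:
  assumes "\<theta> > 1"
  shows "\<theta> / (\<theta> - 1) * real (Suc k) \<le> dp_value \<theta> 1 k powr \<theta>"
proof (induction k)
  case 0
  have "(\<theta> / (\<theta> - 1)) powr 1 \<le> (\<theta> / (\<theta> - 1)) powr \<theta>"
    using assms by (intro powr_mono) auto
  thus ?case using assms by simp
next
  case (Suc k)
  define V where "V = dp_value \<theta> 1 k"
  define z where "z = V powr (- \<theta>) / (\<theta> - 1)"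
  have V: "V \<ge> 1" using dp_value_ge_1[OF assms] by (simp add: V_def)
  have z: "z > 0" using V assms by (simp add: z_def)
  have "dp_value \<theta> 1 (Suc k) powr \<theta> = V powr \<theta> * (1 + z) powr \<theta>"
    unfolding dp_value_Suc_mult[OF assms] using V z by (simp add: powr_mult V_def z_def)
  also have "\<dots> \<ge> V powr \<theta> * (1 + \<theta> * z)"
    using powr_ge_tangent[of "1 + z" \<theta>] z assms by (intro mult_left_mono) auto
  also have "V powr \<theta> * (1 + \<theta> * z) = V powr \<theta> + \<theta> / (\<theta> - 1)"
    using V assms by (simp add: z_def powr_minus field_simps)
  finally have "V powr \<theta> + \<theta> / (\<theta> - 1) \<le> dp_value \<theta> 1 (Suc k) powr \<theta>" .
  moreover have dist: "c * real (Suc (Suc k)) = c * real (Suc k) + c" for c :: real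
    by (simp add: algebra_simps)
  ultimately show ?case using Suc dist[of "\<theta> / (\<theta> - 1)"] unfolding V_def by linarith
qed

text \<open>The excess over linear growth comes from the second order term of
  \<open>(1 + z) powr \<theta>\<close>, which is \<open>O(1 / k)\<close> per step by the lower
  bound; the square root absorbs the sum of these errors. \<open>K\<close> and \<open>b\<close> make
  the constant uniform over a range of shapes, as an estimated shape requires.\<close>

lemma dp_value_powr_upper:
  assumes "\<theta> > 1" "\<theta> / (\<theta> - 1) \<le> K" "\<theta> \<le> b"
  shows "dp_value \<theta> 1 k powr \<theta> \<le>
    \<theta> / (\<theta> - 1) * real (Suc k) + (4 * K\<^sup>2 * exp K + K powr b) * sqrt (real (Suc k))"
proof (induction k)
  case 0
  have "1 \<le> \<theta> / (\<theta> - 1)" using assms by simp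
  hence K: "K \<ge> 1" using assms by linarith
  have "(\<theta> / (\<theta> - 1)) powr \<theta> \<le> K powr \<theta>" using assms by (intro powr_mono2) auto
  also have "\<dots> \<le> K powr b" using K assms by (intro powr_mono) auto
  finally have "(\<theta> / (\<theta> - 1)) powr \<theta> \<le> K powr b" .
  moreover have "0 \<le> \<theta> / (\<theta> - 1)" using assms by simp
  moreover have "0 \<le> 4 * K\<^sup>2 * exp K" by simp
  ultimately have "(\<theta> / (\<theta> - 1)) powr \<theta> \<le> \<theta> / (\<theta> - 1) + (4 * K\<^sup>2 * exp K + K powr b)"
    by linarith
  thus ?case by simp
next
  case (Suc k)
  define V where "V = dp_value \<theta> 1 k"
  define z where "z = V powr (- \<theta>) / (\<theta> - 1)"
  define c where "c = \<theta> / (\<theta> - 1)"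
  define C where "C = 4 * K\<^sup>2 * exp K + K powr b"
  define r where "r = sqrt (real (Suc k))"
  define r' where "r' = sqrt (real (Suc (Suc k)))"
  have c1: "c \<ge> 1" using assms by (simp add: c_def)
  have cK: "c \<le> K" using assms by (simp add: c_def)
  have V: "V \<ge> 1" using dp_value_ge_1[OF assms(1)] by (simp add: V_def)
  have z: "z > 0" using V assms by (simp add: z_def)
  have Vk: "real (Suc k) \<le> V powr \<theta>"
    using dp_value_powr_lower[OF assms(1), of k] c1
      mult_right_mono[of 1 c "real (Suc k)"] by (simp add: V_def c_def)
  have V0: "V powr \<theta> > 0" using V by simp
  have tz: "\<theta> * z = c / V powr \<theta>" using assms by (simp add: z_def c_def powr_minus field_simps)
  have "c / V powr \<theta> \<le> K / 1"
    using Vk cK c1 by (intro frac_le) auto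
  hence tzK: "\<theta> * z \<le> K" unfolding tz by simp
  have tz0: "\<theta> * z \<ge> 0" using z assms by simp
  have "(1 + z) powr \<theta> \<le> exp (\<theta> * z)"
    using z assms by (auto simp: powr_def intro!: ln_add_one_self_le_self)
  also have "\<dots> \<le> 1 + \<theta> * z + (\<theta> * z)\<^sup>2 * exp \<bar>\<theta> * z\<bar>" by (rule exp_le_quadratic)
  also have "\<dots> \<le> 1 + \<theta> * z + (\<theta> * z)\<^sup>2 * exp K" using tzK tz0 by (simp add: mult_left_mono)
  finally have p: "(1 + z) powr \<theta> \<le> 1 + \<theta> * z + (\<theta> * z)\<^sup>2 * exp K" .
  have "dp_value \<theta> 1 (Suc k) powr \<theta> = V powr \<theta> * (1 + z) powr \<theta>"
    unfolding dp_value_Suc_mult[OF assms(1)] using V z by (simp add: powr_mult V_def z_def)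
  also have "\<dots> \<le> V powr \<theta> * (1 + \<theta> * z + (\<theta> * z)\<^sup>2 * exp K)"
    using p by (intro mult_left_mono) auto
  also have "\<dots> = V powr \<theta> + c + c\<^sup>2 * exp K / V powr \<theta>"
    unfolding tz using V0 by (simp add: field_simps power2_eq_square)
  also have "c\<^sup>2 * exp K / V powr \<theta> \<le> K\<^sup>2 * exp K / real (Suc k)"
    using Vk cK c1 by (intro frac_le mult_right_mono power_mono) auto
  \<comment> \<open>The increment \<open>r' - r = 1 / (r' + r)\<close> is at least
    \<open>1 / (4 * real (Suc k))\<close>, so the growth of the square root in the claim pays for
    the error of this step.\<close>
  also have "K\<^sup>2 * exp K / real (Suc k) \<le> C * (r' - r)"
  proof -
    have rr: "r' * r' = real k + 2" "r * r = real k + 1" "r > 0" "r' > 0" "r \<le> r'"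
      by (auto simp: r_def r'_def)
    have "r' \<le> 2 * (r * r)" unfolding rr(2) r'_def
      by (rule real_le_lsqrt) (auto simp: power2_eq_square algebra_simps)
    have "(r' - r) * (r' + r) = 1" using rr by (simp add: algebra_simps)
    hence eq: "r' - r = 1 / (r' + r)" using rr by (simp add: field_simps)
    have "1 / real (Suc k) = 1 / (r * r)" using rr by simp
    also have "\<dots> \<le> 4 * (1 / (r' + r))"
      using rr \<open>r' \<le> 2 * (r * r)\<close> by (simp add: field_simps)
    finally have "K\<^sup>2 * exp K * (1 / real (Suc k)) \<le> K\<^sup>2 * exp K * (4 * (r' - r))"
      unfolding eq by (intro mult_left_mono) auto
    also have "\<dots> \<le> C * (r' - r)" unfolding C_def using rr by (simp add: algebra_simps mult_right_mono)
    finally show ?thesis by simp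
  qed
  finally have "dp_value \<theta> 1 (Suc k) powr \<theta> \<le> V powr \<theta> + c + C * (r' - r)" by simp
  with Suc show ?case
    unfolding C_def[symmetric] r_def[symmetric] r'_def[symmetric] c_def[symmetric] V_def[symmetric]
    by (simp add: algebra_simps)
qed


text \<open>In units of \<open>x0\<close>: the expected reward under the shape \<open>\<theta>\<close> of the thresholds computed for
  \<open>\<theta>'\<close>, when \<open>k + 1\<close> observations remain.\<close>

primrec policy_value :: "real \<Rightarrow> real \<Rightarrow> nat \<Rightarrow> real" where
  "policy_value \<theta> \<theta>' 0 = \<theta> / (\<theta> - 1)"
| "policy_value \<theta> \<theta>' (Suc k) = policy_value \<theta> \<theta>' k +
     dp_value \<theta>' 1 k powr (- \<theta>) * (\<theta> / (\<theta> - 1) * dp_value \<theta>' 1 k - policy_value \<theta> \<theta>' k)"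

lemma policy_value_nonneg:
  assumes "\<theta> > 1" "\<theta>' > 1"
  shows "policy_value \<theta> \<theta>' k \<ge> 0"
proof (induction k)
  case (Suc k)
  define a where "a = dp_value \<theta>' 1 k"
  define w where "w = policy_value \<theta> \<theta>' k"
  have a: "a \<ge> 1" using dp_value_ge_1[OF assms(2)] by (simp add: a_def)
  have "a powr \<theta> \<ge> 1" using a assms by (intro ge_one_powr_ge_zero) auto
  hence p: "a powr (- \<theta>) \<le> 1" by (simp add: powr_minus inverse_le_1_iff)
  have "0 \<le> w * (1 - a powr (- \<theta>)) + a powr (- \<theta>) * (\<theta> / (\<theta> - 1) * a)"
    using Suc p a assms unfolding w_def by (intro add_nonneg_nonneg mult_nonneg_nonneg) auto
  thus ?case by (simp add: a_def w_def algebra_simps)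
qed (use assms in simp)

text \<open>The logarithm has Lipschitz constant \<open>1\<close> above \<open>1\<close> and
  \<open>1 / (c - 1)\<close> above \<open>c - 1\<close>; these bounds control the two terms of
  \<open>ln \<theta> - ln (\<theta> - 1)\<close>.\<close>

lemma abs_ln_mean_diff_le:
  fixes \<theta> \<theta>' c :: real
  assumes "1 < c" "c \<le> \<theta>" "c \<le> \<theta>'"
  shows "\<bar>ln (\<theta>' / (\<theta>' - 1)) - ln (\<theta> / (\<theta> - 1))\<bar> \<le> (1 + 1 / (c - 1)) * \<bar>\<theta>' - \<theta>\<bar>"
proof -
  have lip: "\<bar>ln x - ln y\<bar> \<le> \<bar>x - y\<bar> / d" if "d \<le> x" "d \<le> y" "d > 0" for x y d :: real
  proof -
    have "ln x - ln y \<le> (x - y) / y" "ln y - ln x \<le> (y - x) / x"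
      using that by (auto intro!: ln_diff_le)
    moreover have "(x - y) / y \<le> \<bar>x - y\<bar> / d" "(y - x) / x \<le> \<bar>x - y\<bar> / d"
      using that by (auto intro!: frac_le)
    ultimately show ?thesis by linarith
  qed
  have "\<bar>ln \<theta>' - ln \<theta>\<bar> \<le> \<bar>\<theta>' - \<theta>\<bar> / 1" using assms by (intro lip) auto
  moreover have "\<bar>ln (\<theta>' - 1) - ln (\<theta> - 1)\<bar> \<le> \<bar>(\<theta>' - 1) - (\<theta> - 1)\<bar> / (c - 1)"
    using assms by (intro lip) auto
  ultimately show ?thesis using assms by (simp add: ln_div algebra_simps)
qed

text \<open>Compares the threshold for the wrong shape with the leading order of the threshold for
  the true one. The two growth bounds cost \<open>O(1 / sqrt k)\<close>, and exchanging the shapes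
  in the leading term costs the other summand. \<open>C\<close> does not depend on
  \<open>\<theta>'\<close>, which will be random.\<close>

lemma dp_value_log_bound:
  fixes \<theta> c b :: real
  assumes "1 < c" "c \<le> \<theta>"
  obtains C where "C > 0" and "\<And>\<theta>' k. c \<le> \<theta>' \<Longrightarrow> \<theta>' \<le> b \<Longrightarrow>
    \<bar>ln (dp_value \<theta>' 1 k) - ln (\<theta> / (\<theta> - 1) * real (Suc k)) / \<theta>\<bar> \<le>
      C * (\<bar>\<theta>' - \<theta>\<bar> * (1 + ln (real (Suc k)))) + C / sqrt (real (Suc k))"
proof -
  define K where "K = c / (c - 1)"
  define C0 where "C0 = 4 * K\<^sup>2 * exp K + K powr b"
  define C1 where "C1 = 1 + (1 + 1 / (c - 1)) + ln (\<theta> / (\<theta> - 1))"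
  define C where "C = C0 + C1"
  have "C0 \<ge> 0" by (simp add: C0_def)
  have ln0: "ln (\<theta> / (\<theta> - 1)) \<ge> 0" using assms by simp
  have "1 / (c - 1) > 0" using assms by simp
  hence C1: "C1 \<ge> 1" "C1 \<ge> (1 + 1 / (c - 1)) + ln (\<theta> / (\<theta> - 1))" unfolding C1_def using ln0
    by linarith+
  hence "C1 > 0" by linarith
  show thesis
  proof
    show "C > 0" using \<open>C0 \<ge> 0\<close> \<open>C1 > 0\<close> by (simp add: C_def)
    fix \<theta>' k assume th: "c \<le> \<theta>'" "\<theta>' \<le> b"
    define V where "V = dp_value \<theta>' 1 k"
    define j where "j = real (Suc k)"
    define \<kappa> where "\<kappa> = \<theta> / (\<theta> - 1)"
    define \<kappa>' where "\<kappa>' = \<theta>' / (\<theta>' - 1)"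
    define \<Delta> where "\<Delta> = \<bar>\<theta>' - \<theta>\<bar>"
    have th1: "\<theta>' > 1" "\<theta> > 1" using th assms by auto
    have j: "j \<ge> 1" by (simp add: j_def)
    have \<kappa>: "\<kappa> \<ge> 1" "\<kappa>' \<ge> 1" using th1 by (auto simp: \<kappa>_def \<kappa>'_def)
    have V: "V \<ge> 1" using dp_value_ge_1[OF th1(1)] by (simp add: V_def)
    have "\<kappa>' \<le> K" using th assms by (simp add: \<kappa>'_def K_def field_simps)
    hence up: "V powr \<theta>' \<le> \<kappa>' * j + C0 * sqrt j"
      using dp_value_powr_upper[OF th1(1), of K b k] th by (simp add: V_def \<kappa>'_def j_def C0_def)
    have low: "\<kappa>' * j \<le> V powr \<theta>'"
      using dp_value_powr_lower[OF th1(1), of k] by (simp add: V_def \<kappa>'_def j_def)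
    have kj: "\<kappa>' * j \<ge> 1" using mult_mono[of 1 \<kappa>' 1 j] \<kappa> j by simp
    have "ln (\<kappa>' * j) \<le> ln (V powr \<theta>')" using low kj by (subst ln_le_cancel_iff) auto
    hence l1: "ln (\<kappa>' * j) \<le> \<theta>' * ln V" using V by (simp add: ln_powr)
    have "\<theta>' * ln V = ln (V powr \<theta>')" using V by (simp add: ln_powr)
    also have "\<dots> \<le> ln (\<kappa>' * j + C0 * sqrt j)" using up V low kj by (subst ln_le_cancel_iff) auto
    also have "\<dots> - ln (\<kappa>' * j) \<le> (C0 * sqrt j) / (\<kappa>' * j)"
      using ln_diff_le[of "\<kappa>' * j + C0 * sqrt j" "\<kappa>' * j"] kj \<open>C0 \<ge> 0\<close> j by (simp add: add_pos_nonneg)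
    also have "\<dots> \<le> (C0 * sqrt j) / j"
      using \<open>C0 \<ge> 0\<close> j \<kappa> by (intro divide_left_mono) auto
    also have "\<dots> = C0 / sqrt j" using j by (simp add: field_simps)
    finally have l2: "\<theta>' * ln V \<le> ln (\<kappa>' * j) + C0 / sqrt j" by simp
    have e: "\<bar>ln V - ln (\<kappa>' * j) / \<theta>'\<bar> \<le> C0 / sqrt j"
    proof -
      have "\<bar>\<theta>' * (ln V - ln (\<kappa>' * j) / \<theta>')\<bar> \<le> C0 / sqrt j"
        using l1 l2 th1 by (simp add: right_diff_distrib)
      hence "\<theta>' * \<bar>ln V - ln (\<kappa>' * j) / \<theta>'\<bar> \<le> C0 / sqrt j" using th1 by (simp add: abs_mult)
      moreover have "\<bar>ln V - ln (\<kappa>' * j) / \<theta>'\<bar> \<le> \<theta>' * \<bar>ln V - ln (\<kappa>' * j) / \<theta>'\<bar>"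
        using mult_right_mono[of 1 \<theta>' "\<bar>ln V - ln (\<kappa>' * j) / \<theta>'\<bar>"] th1 by simp
      ultimately show ?thesis by (rule order_trans[rotated])
    qed
    have inv: "\<bar>1 / \<theta>' - 1 / \<theta>\<bar> \<le> \<Delta>"
    proof -
      have "\<bar>1 / \<theta>' - 1 / \<theta>\<bar> = \<Delta> / (\<theta>' * \<theta>)" using th1 unfolding \<Delta>_def
        by (subst abs_minus_commute) (simp add: diff_frac_eq abs_mult abs_divide)
      also have "\<dots> \<le> \<Delta> / 1" using th1 less_1_mult[of \<theta>' \<theta>]
        by (intro divide_left_mono) (auto simp: \<Delta>_def)
      finally show ?thesis by simp
    qed
    \<comment> \<open>Three effects of the wrong shape: the exponent acting on \<open>j\<close>, the
      change of \<open>ln \<kappa>\<close>, and the exponent acting on \<open>\<kappa>\<close>. Only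
      the first carries a factor \<open>ln j\<close>.\<close>
    have "ln (\<kappa>' * j) / \<theta>' - ln (\<kappa> * j) / \<theta> =
        ln j * (1 / \<theta>' - 1 / \<theta>) + (ln \<kappa>' - ln \<kappa>) / \<theta>' + ln \<kappa> * (1 / \<theta>' - 1 / \<theta>)"
      using \<kappa> j by (simp add: ln_mult diff_divide_distrib add_divide_distrib algebra_simps)
    also have "\<bar>\<dots>\<bar> \<le> ln j * \<bar>1 / \<theta>' - 1 / \<theta>\<bar> + \<bar>ln \<kappa>' - ln \<kappa>\<bar> / \<theta>' + ln \<kappa> * \<bar>1 / \<theta>' - 1 / \<theta>\<bar>"
      using j \<kappa> th1 by (intro order_trans[OF abs_triangle_ineq] add_mono) (auto simp: abs_mult)
    also have "\<dots> \<le> ln j * \<Delta> + (1 + 1 / (c - 1)) * \<Delta> + ln \<kappa> * \<Delta>"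
    proof (intro add_mono mult_left_mono inv)
      have "\<bar>ln \<kappa>' - ln \<kappa>\<bar> / \<theta>' \<le> \<bar>ln \<kappa>' - ln \<kappa>\<bar> / 1" using th1 by (intro divide_left_mono) auto
      also have "\<dots> \<le> (1 + 1 / (c - 1)) * \<Delta>"
        using abs_ln_mean_diff_le[of c \<theta> \<theta>'] th assms by (simp add: \<kappa>'_def \<kappa>_def \<Delta>_def)
      finally show "\<bar>ln \<kappa>' - ln \<kappa>\<bar> / \<theta>' \<le> (1 + 1 / (c - 1)) * \<Delta>" .
    qed (use \<kappa> j in auto)
    also have "\<dots> = ln j * \<Delta> + ((1 + 1 / (c - 1)) + ln \<kappa>) * \<Delta>" by (simp add: algebra_simps)
    also have "\<dots> \<le> C1 * ln j * \<Delta> + C1 * \<Delta>"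
      using C1 j mult_right_mono[of 1 C1 "ln j"] by (intro add_mono mult_right_mono) (auto simp: \<Delta>_def \<kappa>_def)
    also have "\<dots> = C1 * (\<Delta> * (1 + ln j))" by (simp add: algebra_simps)
    also have "\<dots> \<le> C * (\<Delta> * (1 + ln j))"
      using \<open>C0 \<ge> 0\<close> j by (intro mult_right_mono) (auto simp: C_def \<Delta>_def)
    finally have 1: "\<bar>ln (\<kappa>' * j) / \<theta>' - ln (\<kappa> * j) / \<theta>\<bar> \<le> C * (\<Delta> * (1 + ln j))" .
    have "C0 / sqrt j \<le> C / sqrt j" using \<open>C1 > 0\<close> j by (intro divide_right_mono) (auto simp: C_def)
    with 1 e show "\<bar>ln (dp_value \<theta>' 1 k) - ln (\<theta> / (\<theta> - 1) * real (Suc k)) / \<theta>\<bar> \<le>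
      C * (\<bar>\<theta>' - \<theta>\<bar> * (1 + ln (real (Suc k)))) + C / sqrt (real (Suc k))"
      unfolding V_def[symmetric] j_def[symmetric] \<kappa>_def[symmetric] \<Delta>_def[symmetric]
      by (smt (verit) abs_triangle_ineq)
  qed
qed

text \<open>Without threshold error the shortfall \<open>1 - q\<close> would decay like \<open>1 / j\<close>; the rate
  \<open>3 / 4\<close> shown here still beats the decay of \<open>E / sqrt j\<close> in the induction below.\<close>

lemma policy_step_lower:
  fixes \<theta> j l q w :: real
  defines "\<kappa> \<equiv> \<theta> / (\<theta> - 1)"
  defines "v \<equiv> (\<kappa> * j) powr (1 / \<theta>)"
  assumes th: "\<theta> > 1" and j: "j \<ge> 1" and a1: "v * exp l \<ge> 1"
    and w: "w \<ge> v * q" and q: "q \<le> 1" and l: "\<bar>l\<bar> \<le> 1 / (4 * (\<theta> - 1))"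
  shows "w + (v * exp l) powr (- \<theta>) * (\<kappa> * (v * exp l) - w) \<ge>
    v * (q + 1 / (\<theta> * j) + (3 / 4 - 1 / \<theta>) * (1 - q) / j
          - \<theta>\<^sup>2 * exp (\<theta> / (4 * (\<theta> - 1))) * l\<^sup>2 / j)"
proof -
  define p where "p = (v * exp l) powr (- \<theta>)"
  define C where "C = \<theta>\<^sup>2 * exp (\<theta> / (4 * (\<theta> - 1)))"
  have \<kappa>: "\<kappa> \<ge> 1" using th by (simp add: \<kappa>_def)
  have v: "v > 0" using \<kappa> j by (simp add: v_def)
  have vth: "v powr \<theta> = \<kappa> * j" using \<kappa> j th by (simp add: v_def powr_powr)
  have p_eq: "p = exp (- \<theta> * l) / (\<kappa> * j)"
  proof -
    have "p = v powr (- \<theta>) * exp l powr (- \<theta>)" using v by (simp add: p_def powr_mult)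
    also have "exp l powr (- \<theta>) = exp (- \<theta> * l)" by (simp add: powr_def)
    also have "v powr (- \<theta>) = 1 / (\<kappa> * j)" by (simp add: powr_minus vth divide_simps)
    finally show ?thesis by simp
  qed
  have "(v * exp l) powr \<theta> \<ge> 1" using a1 th by (intro ge_one_powr_ge_zero) auto
  hence p1: "p \<le> 1" "p \<ge> 0" by (auto simp: p_def powr_minus inverse_le_1_iff)
  have \<kappa>inv: "1 / \<kappa> = 1 - 1 / \<theta>" using th by (simp add: \<kappa>_def field_simps)
  \<comment> \<open>At \<open>l = 0\<close> the product is
    \<open>1 / \<kappa> = 1 - 1 / \<theta>\<close>; the bound on \<open>l\<close> is chosen such
    that the error costs at most \<open>1 / 4\<close>.\<close>
  have pj: "p * j \<ge> 3 / 4 - 1 / \<theta>"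
  proof -
    have "(\<theta> - 1) * l \<le> (\<theta> - 1) * (1 / (4 * (\<theta> - 1)))" using l th by (intro mult_left_mono) auto
    also have "\<dots> = 1 / 4" using th by (simp add: field_simps)
    finally have a: "(\<theta> - 1) * l \<le> 1 / 4" .
    have "p * j = exp (- \<theta> * l) * (1 / \<kappa>)" using j by (simp add: p_eq)
    also have "\<dots> \<ge> (1 - \<theta> * l) * (1 / \<kappa>)"
      using exp_ge_add_one_self[of "- \<theta> * l"] \<kappa> by (intro mult_right_mono) auto
    also have "(1 - \<theta> * l) * (1 / \<kappa>) = 1 - 1 / \<theta> - (\<theta> - 1) * l"
      unfolding \<kappa>inv using th by (simp add: field_simps)
    finally show ?thesis using a by linarith
  qed
  \<comment> \<open>This is where the error becomes quadratic:
    \<open>\<kappa> * exp (l - \<theta> * l)\<close> and \<open>exp (- \<theta> * l)\<close> have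
    the same linear term \<open>- \<theta> * l\<close>, so it cancels. The exact cancellation
    reflects that the threshold \<open>v\<close> is stationary.\<close>
  have gain: "p * (\<kappa> * exp l - 1) \<ge> 1 / (\<theta> * j) - C * l\<^sup>2 / j"
  proof -
    have "\<theta> * \<bar>l\<bar> \<le> \<theta> * (1 / (4 * (\<theta> - 1)))" using l th by (intro mult_left_mono) auto
    hence tl: "\<bar>- \<theta> * l\<bar> \<le> \<theta> / (4 * (\<theta> - 1))" using th by (simp add: abs_mult)
    have "\<kappa> * exp (l - \<theta> * l) \<ge> \<kappa> * (1 + (l - \<theta> * l))"
      using \<kappa> exp_ge_add_one_self[of "l - \<theta> * l"] by (intro mult_left_mono) auto
    moreover have "\<kappa> * (1 + (l - \<theta> * l)) = \<kappa> - \<theta> * l"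
      using th by (simp add: \<kappa>_def field_simps)
    moreover have "exp (- \<theta> * l) \<le> 1 - \<theta> * l + C * l\<^sup>2"
    proof -
      have "exp (- \<theta> * l) \<le> 1 + (- \<theta> * l) + (- \<theta> * l)\<^sup>2 * exp \<bar>- \<theta> * l\<bar>" by (rule exp_le_quadratic)
      also have "\<dots> \<le> 1 + (- \<theta> * l) + (- \<theta> * l)\<^sup>2 * exp (\<theta> / (4 * (\<theta> - 1)))"
        using tl by (intro add_left_mono mult_left_mono) auto
      finally show ?thesis by (simp add: C_def power2_eq_square algebra_simps)
    qed
    ultimately have b: "\<kappa> * exp (l - \<theta> * l) - exp (- \<theta> * l) \<ge> \<kappa> - 1 - C * l\<^sup>2" by linarith
    have "p * (\<kappa> * exp l - 1) = (\<kappa> * exp (l - \<theta> * l) - exp (- \<theta> * l)) / (\<kappa> * j)"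
      by (simp add: p_eq exp_diff exp_minus field_simps)
    also have "\<dots> \<ge> (\<kappa> - 1 - C * l\<^sup>2) / (\<kappa> * j)"
      using b \<kappa> j by (intro divide_right_mono) auto
    also have "(\<kappa> - 1 - C * l\<^sup>2) / (\<kappa> * j) = (1 - 1 / \<kappa>) / j - C * l\<^sup>2 / j / \<kappa>"
      using \<kappa> j by (simp add: field_simps)
    also have "(1 - 1 / \<kappa>) / j = 1 / (\<theta> * j)" by (simp add: \<kappa>inv)
    finally have "1 / (\<theta> * j) - C * l\<^sup>2 / j / \<kappa> \<le> p * (\<kappa> * exp l - 1)" .
    moreover have "C * l\<^sup>2 / j / \<kappa> \<le> C * l\<^sup>2 / j / 1"
      using \<kappa> j by (intro divide_left_mono) (auto simp: C_def)
    ultimately show ?thesis by simp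
  qed
  have pq: "p * (1 - q) \<ge> (3 / 4 - 1 / \<theta>) * (1 - q) / j"
  proof -
    have "(3 / 4 - 1 / \<theta>) * (1 - q) \<le> p * j * (1 - q)" using pj q by (intro mult_right_mono) auto
    thus ?thesis using j by (simp add: field_simps)
  qed
  \<comment> \<open>Since \<open>p \<le> 1\<close>, the expression is increasing in
    \<open>w\<close>, which may thus be replaced by its lower bound.\<close>
  have "w + p * (\<kappa> * (v * exp l) - w) = (1 - p) * w + p * \<kappa> * v * exp l" by (simp add: algebra_simps)
  also have "\<dots> \<ge> (1 - p) * (v * q) + p * \<kappa> * v * exp l"
    using w p1 by (intro add_right_mono mult_left_mono) auto
  also have "(1 - p) * (v * q) + p * \<kappa> * v * exp l = v * (q + p * (\<kappa> * exp l - 1) + p * (1 - q))"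
    by (simp add: algebra_simps)
  also have "\<dots> \<ge> v * (q + (1 / (\<theta> * j) - C * l\<^sup>2 / j) + (3 / 4 - 1 / \<theta>) * (1 - q) / j)"
    using gain pq v by (intro mult_left_mono add_mono) auto
  finally show ?thesis by (simp add: p_def C_def algebra_simps)
qed

text \<open>Induction on the number of remaining observations. The term
  \<open>1 / (\<theta> * j)\<close> of the one-step bound matches the growth of \<open>v\<close>,
  and the surplus \<open>3 / 4 * (1 - q) / j\<close> pays for the slow rise of \<open>q\<close> and
  for the squared threshold error. Fixing \<open>n\<close> in the deviation keeps that part of the
  shortfall constant along the induction.\<close>

lemma policy_value_lower:
  fixes \<theta> :: real
  assumes th: "\<theta> > 1"
  obtains B E r where "B \<ge> 0" "E \<ge> 0" "r > 0"
    and "\<And>\<theta>' n k. n > 0 \<Longrightarrow> \<bar>\<theta>' - \<theta>\<bar> * (1 + ln (real n)) \<le> r \<Longrightarrow> \<theta>' > 1"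
    and "\<And>\<theta>' n k. k < n \<Longrightarrow> \<bar>\<theta>' - \<theta>\<bar> * (1 + ln (real n)) \<le> r \<Longrightarrow>
      policy_value \<theta> \<theta>' k \<ge> (\<theta> / (\<theta> - 1) * real (Suc k)) powr (1 / \<theta>) *
        (1 - B * (\<bar>\<theta>' - \<theta>\<bar> * (1 + ln (real n)))\<^sup>2 - E / sqrt (real (Suc k)))"
proof -
  \<comment> \<open>Shapes in the interval from \<open>c\<close> to \<open>b\<close> stay away from
    \<open>1\<close> and are bounded, so the logarithmic threshold bound holds with one
    constant.\<close>
  define c where "c = (1 + \<theta>) / 2"
  have c: "1 < c" "c \<le> \<theta>" using th by (auto simp: c_def)
  define b where "b = 2 * \<theta>"
  define \<kappa> where "\<kappa> = \<theta> / (\<theta> - 1)"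
  obtain C2 where C2: "C2 > 0" and logb: "\<And>\<theta>' k. c \<le> \<theta>' \<Longrightarrow> \<theta>' \<le> b \<Longrightarrow>
    \<bar>ln (dp_value \<theta>' 1 k) - ln (\<kappa> * real (Suc k)) / \<theta>\<bar> \<le>
      C2 * (\<bar>\<theta>' - \<theta>\<bar> * (1 + ln (real (Suc k)))) + C2 / sqrt (real (Suc k))"
    using dp_value_log_bound[OF c, of b] unfolding \<kappa>_def by blast
  define C where "C = \<theta>\<^sup>2 * exp (\<theta> / (4 * (\<theta> - 1)))"
  have C: "C \<ge> 0" by (simp add: C_def)
  \<comment> \<open>\<open>B\<close> is twice the coefficient of the squared deviation in the bound
    for \<open>C * l * l\<close>. The summands of \<open>E\<close> cover the rest of that bound,
    force \<open>s \<ge> 2\<close> in the nontrivial case, and keep \<open>C2 / s\<close> small.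
    \<open>r\<close> keeps the shape in range and \<open>C2 * \<rho>\<close> small.\<close>
  define B where "B = 4 * C * C2\<^sup>2"
  define E where "E = 16 * C * C2\<^sup>2 + 4 + 16 * C2 * (\<theta> - 1)"
  define r where "r = min ((\<theta> - 1) / 2) (1 / (8 * (\<theta> - 1) * C2))"
  have E: "E \<ge> 4" "E \<ge> 16 * C * C2\<^sup>2" "E \<ge> 16 * C2 * (\<theta> - 1)" using C C2 th by (auto simp: E_def)
  have r: "r > 0" "r \<le> (\<theta> - 1) / 2" "r \<le> 1 / (8 * (\<theta> - 1) * C2)" using C2 th by (auto simp: r_def min_def)
  have B: "B \<ge> 0" using C by (simp add: B_def)
  have range: "c \<le> \<theta>'" "\<theta>' \<le> b" if "n > 0" "\<bar>\<theta>' - \<theta>\<bar> * (1 + ln (real n)) \<le> r" for \<theta>' n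
  proof -
    have "\<bar>\<theta>' - \<theta>\<bar> * 1 \<le> \<bar>\<theta>' - \<theta>\<bar> * (1 + ln (real n))" using that by (intro mult_left_mono) auto
    also note that(2)
    also note r(2)
    finally have "\<bar>\<theta>' - \<theta>\<bar> \<le> (\<theta> - 1) / 2" by simp
    hence "\<theta>' - \<theta> \<le> (\<theta> - 1) / 2" "- (\<theta>' - \<theta>) \<le> (\<theta> - 1) / 2" unfolding abs_le_iff by blast+
    thus "c \<le> \<theta>'" "\<theta>' \<le> b" using th unfolding c_def b_def by auto
  qed
  show thesis
  proof
    show "B \<ge> 0" "E \<ge> 0" "r > 0" using B E r by auto
    show "\<theta>' > 1" if "n > 0" "\<bar>\<theta>' - \<theta>\<bar> * (1 + ln (real n)) \<le> r" for \<theta>' n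
      using range[OF that] c by simp
    fix \<theta>' n k assume kn: "k < n" and dev: "\<bar>\<theta>' - \<theta>\<bar> * (1 + ln (real n)) \<le> r"
    define \<rho> where "\<rho> = \<bar>\<theta>' - \<theta>\<bar> * (1 + ln (real n))"
    have rng: "c \<le> \<theta>'" "\<theta>' \<le> b" using range[of n \<theta>'] kn dev by auto
    have th': "\<theta>' > 1" using rng c by simp
    have \<rho>: "\<rho> \<ge> 0" using kn by (auto simp: \<rho>_def intro!: mult_nonneg_nonneg)
    have \<kappa>: "\<kappa> \<ge> 1" using th by (simp add: \<kappa>_def)
    define q where "q = (\<lambda>j::real. 1 - B * \<rho>\<^sup>2 - E / sqrt j)"
    have "policy_value \<theta> \<theta>' k \<ge> (\<kappa> * real (Suc k)) powr (1 / \<theta>) * q (real (Suc k))"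
      using kn
    proof (induction k)
      case 0
      have "B * \<rho>\<^sup>2 \<ge> 0" using B by simp
      hence "q (real (Suc 0)) \<le> 0" using E by (simp add: q_def)
      hence "(\<kappa> * real (Suc 0)) powr (1 / \<theta>) * q (real (Suc 0)) \<le> 0" by (simp add: mult_nonneg_nonpos)
      thus ?case using policy_value_nonneg[OF th th', of 0] by linarith
    next
      case (Suc k)
      define j where "j = real (Suc k)"
      have j1: "real (Suc (Suc k)) = j + 1" by (simp add: j_def)
      show ?case
      \<comment> \<open>If the bound is not positive, nonnegativity of the value suffices. Otherwise
        \<open>E < sqrt (j + 1)\<close>, which supplies the largeness of \<open>j\<close> used
        below.\<close>
      proof (cases "q (j + 1) \<le> 0")
        case True
        hence "(\<kappa> * (j + 1)) powr (1 / \<theta>) * q (j + 1) \<le> 0" by (simp add: mult_nonneg_nonpos)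
        thus ?thesis using policy_value_nonneg[OF th th', of "Suc k"] unfolding j1 by linarith
      next
        case False
        define s where "s = sqrt j"
        define s' where "s' = sqrt (j + 1)"
        have j: "j \<ge> 1" by (simp add: j_def)
        have ss: "s * s = j" "s' * s' = j + 1" "s \<ge> 1" "s' \<ge> 1" using j by (auto simp: s_def s'_def)
        have "0 \<le> B * \<rho>\<^sup>2" using B by simp
        hence "E / s' < 1" using False by (simp add: q_def s'_def)
        hence "E < s'" using ss by simp
        moreover have "s' \<le> 2 * s"
          unfolding s'_def by (rule real_le_lsqrt) (use ss j in \<open>auto simp: power2_eq_square\<close>)
        ultimately have Es: "E \<le> 2 * s" by linarith
        have s2: "s \<ge> 2" using Es E by linarith
        have j4: "j \<ge> 4" using mult_mono[of 2 s 2 s] s2 ss by simp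
        define v where "v = (\<kappa> * j) powr (1 / \<theta>)"
        define a where "a = dp_value \<theta>' 1 k"
        define l where "l = ln a - ln v"
        have v: "v > 0" using \<kappa> j by (simp add: v_def)
        have a: "a \<ge> 1" using dp_value_ge_1[OF th'] by (simp add: a_def)
        have av: "a = v * exp l" using a v by (simp add: l_def exp_diff)
        have lnv: "ln v = ln (\<kappa> * j) / \<theta>" using \<kappa> j by (simp add: v_def ln_powr)
        have "\<bar>l\<bar> \<le> C2 * (\<bar>\<theta>' - \<theta>\<bar> * (1 + ln j)) + C2 / s"
          using logb[OF rng, of k] by (simp add: l_def lnv a_def j_def s_def)
        also have "\<dots> \<le> C2 * \<rho> + C2 / s"
          unfolding \<rho>_def using C2 Suc.prems by (intro add_right_mono mult_left_mono) (auto simp: j_def)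
        finally have l: "\<bar>l\<bar> \<le> C2 * \<rho> + C2 / s" .
        have "C2 * \<rho> \<le> C2 * (1 / (8 * (\<theta> - 1) * C2))" using dev r C2
          by (intro mult_left_mono) (auto simp: \<rho>_def)
        also have "\<dots> = 1 / (8 * (\<theta> - 1))" using C2 th by (simp add: field_simps)
        finally have l1: "C2 * \<rho> \<le> 1 / (8 * (\<theta> - 1))" .
        have "8 * (C2 * (\<theta> - 1)) \<le> s" using Es E by linarith
        hence l2: "C2 / s \<le> 1 / (8 * (\<theta> - 1))" using ss th by (simp add: field_simps)
        have "1 / (8 * (\<theta> - 1)) + 1 / (8 * (\<theta> - 1)) = 1 / (4 * (\<theta> - 1))"
          using th by (simp add: divide_simps)
        with order_trans[OF l add_mono[OF l1 l2]] have l3: "\<bar>l\<bar> \<le> 1 / (4 * (\<theta> - 1))" by simp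
        have lsq: "l\<^sup>2 \<le> 2 * C2\<^sup>2 * \<rho>\<^sup>2 + 2 * C2\<^sup>2 / j"
        proof -
          have "l\<^sup>2 \<le> (C2 * \<rho> + C2 / s)\<^sup>2" using l by (metis abs_ge_zero power2_abs power_mono)
          also have "\<dots> \<le> 2 * (C2 * \<rho>)\<^sup>2 + 2 * (C2 / s)\<^sup>2"
            using zero_le_power2[of "C2 * \<rho> - C2 / s"] by (simp add: power2_diff power2_sum)
          also have "(C2 / s)\<^sup>2 = C2\<^sup>2 / j" using ss by (simp add: power_divide power2_eq_square)
          finally show ?thesis by (simp add: power_mult_distrib)
        qed
        have q1: "q j \<le> 1"        proof -
          have "0 \<le> E / sqrt j" using E j by (intro divide_nonneg_nonneg) auto
          thus ?thesis using \<open>0 \<le> B * \<rho>\<^sup>2\<close> unfolding q_def by linarith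
        qed
        have IH: "policy_value \<theta> \<theta>' k \<ge> v * q j" using Suc by (simp add: v_def j_def)
        have "policy_value \<theta> \<theta>' (Suc k) \<ge> v * (q j + 1 / (\<theta> * j) + (3 / 4 - 1 / \<theta>) * (1 - q j) / j - C * l\<^sup>2 / j)"
          using policy_step_lower[OF th j, of l "q j" "policy_value \<theta> \<theta>' k"] a IH q1 l3
          by (simp add: av a_def[symmetric] C_def v_def[symmetric] \<kappa>_def[symmetric])
        moreover have "(\<kappa> * (j + 1)) powr (1 / \<theta>) * q (j + 1) \<le>
            v * (q j + 1 / (\<theta> * j) + (3 / 4 - 1 / \<theta>) * (1 - q j) / j - C * l\<^sup>2 / j)"
        proof -
          have "1 / s - 1 / s' \<le> 1 / (2 * j * s)"
          proof -
            have "(s' - s) * (s' + s) = 1" using ss by (simp add: algebra_simps)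
            hence d: "s' - s = 1 / (s' + s)" using ss by (simp add: field_simps)
            have "s \<le> s'" unfolding s_def s'_def by simp
            have "1 / s - 1 / s' = (s' - s) / (s * s')" using ss by (simp add: field_simps)
            also have "\<dots> = 1 / (s * s' * (s' + s))" by (simp add: d)
            also have "\<dots> \<le> 1 / (s * s * (s + s))"
              using \<open>s \<le> s'\<close> ss by (intro divide_left_mono mult_mono) auto
            also have "s * s * (s + s) = 2 * j * s" by (simp add: ss(1) algebra_simps)
            finally show ?thesis .
          qed
          hence "E * (1 / s - 1 / s') \<le> E * (1 / (2 * j * s))" using E by (intro mult_left_mono) auto
          hence qq: "q (j + 1) \<le> q j + E / (2 * j * s)"
            unfolding q_def s_def[symmetric] s'_def[symmetric] by (simp add: algebra_simps)
          have "(\<kappa> * (j + 1)) powr (1 / \<theta>) = v * (1 + 1 / j) powr (1 / \<theta>)"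
          proof -
            have "\<kappa> * (j + 1) = (\<kappa> * j) * (1 + 1 / j)" using j by (simp add: field_simps)
            thus ?thesis using \<kappa> j by (simp add: v_def powr_mult)
          qed
          also have "\<dots> \<le> v * (1 + 1 / \<theta> * (1 / j))"
            using powr_le_tangent[of "1 / j" "1 / \<theta>"] v j th by (intro mult_left_mono) auto
          finally have "(\<kappa> * (j + 1)) powr (1 / \<theta>) \<le> v * (1 + 1 / (\<theta> * j))" by simp
          hence "(\<kappa> * (j + 1)) powr (1 / \<theta>) * q (j + 1) \<le> v * (1 + 1 / (\<theta> * j)) * (q j + E / (2 * j * s))"
            using False qq v th j by (intro mult_mono) (auto intro!: mult_nonneg_nonneg add_nonneg_nonneg)
          also have "\<dots> = v * ((1 + 1 / (\<theta> * j)) * (q j + E / (2 * j * s)))" by simp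
          also have "\<dots> \<le> v * (q j + 1 / (\<theta> * j) + (3 / 4 - 1 / \<theta>) * (1 - q j) / j - C * l\<^sup>2 / j)"
          proof (rule mult_left_mono)
            have "1 / (\<theta> * j) \<le> 1 / 4"
              using mult_mono[of 1 \<theta> 4 j] th j4 by (intro divide_left_mono) auto
            hence "(1 + 1 / (\<theta> * j)) * (E / (2 * s)) \<le> (5 / 4) * (E / (2 * s))"
              using E ss by (intro mult_right_mono) auto
            moreover have "C * l\<^sup>2 \<le> 3 / 4 * (B * \<rho>\<^sup>2) + E / (8 * s)"
            proof -
              have "C * l\<^sup>2 \<le> C * (2 * C2\<^sup>2 * \<rho>\<^sup>2 + 2 * C2\<^sup>2 / j)" using lsq C by (intro mult_left_mono) auto
              also have "\<dots> = B / 2 * \<rho>\<^sup>2 + (16 * C * C2\<^sup>2) / (8 * j)" by (simp add: B_def algebra_simps)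
              also have "\<dots> \<le> 3 / 4 * (B * \<rho>\<^sup>2) + E / (8 * s)"
              proof (intro add_mono frac_le)
                show "8 * s \<le> 8 * j" using ss mult_mono[of 1 s s s] by simp
                show "B / 2 * \<rho>\<^sup>2 \<le> 3 / 4 * (B * \<rho>\<^sup>2)" using \<open>0 \<le> B * \<rho>\<^sup>2\<close> by linarith
              qed (use E ss in auto)
              finally show ?thesis .
            qed
            moreover have "(5 / 4) * (E / (2 * s)) + E / (8 * s) = 3 / 4 * (E / s)" by simp
            moreover have "1 - q j = B * \<rho>\<^sup>2 + E / s" by (simp add: q_def s_def)
            \<comment> \<open>The budget \<open>3 / 4\<close> of \<open>E / s\<close> splits into
              five eighths for the rise of \<open>q\<close>, inflated by \<open>5 / 4\<close>, and
              one eighth for the threshold error.\<close>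
            ultimately have "(1 + 1 / (\<theta> * j)) * (E / (2 * s)) + C * l\<^sup>2 \<le> 3 / 4 * (1 - q j)"
              by argo
            hence "((1 + 1 / (\<theta> * j)) * (E / (2 * s)) + C * l\<^sup>2) / j \<le> (3 / 4 * (1 - q j)) / j"
              using j by (intro divide_right_mono) auto
            moreover have "(1 + 1 / (\<theta> * j)) * (q j + E / (2 * j * s)) =
              q j + q j / (\<theta> * j) + (1 + 1 / (\<theta> * j)) * (E / (2 * s)) / j"
              using j ss th by (simp add: field_simps)
            moreover have "(3 / 4 - 1 / \<theta>) * (1 - q j) / j = 3 / 4 * (1 - q j) / j - 1 / (\<theta> * j) + q j / (\<theta> * j)"
              using j th by (simp add: field_simps)
            ultimately show "(1 + 1 / (\<theta> * j)) * (q j + E / (2 * j * s)) \<le>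
              q j + 1 / (\<theta> * j) + (3 / 4 - 1 / \<theta>) * (1 - q j) / j - C * l\<^sup>2 / j"
              by (simp add: add_divide_distrib)
          qed (use v in simp)
          finally show ?thesis .
        qed
        ultimately show ?thesis unfolding j1 by linarith
      qed
    qed
    thus "policy_value \<theta> \<theta>' k \<ge> (\<theta> / (\<theta> - 1) * real (Suc k)) powr (1 / \<theta>) *
        (1 - B * (\<bar>\<theta>' - \<theta>\<bar> * (1 + ln (real n)))\<^sup>2 - E / sqrt (real (Suc k)))"
      by (simp add: \<kappa>_def q_def \<rho>_def)
  qed
qed

section \<open>Erlang tails and density\<close>

text \<open>It suffices to evaluate \<open>exp y \<ge> 1 + y + y * y / 2\<close> at
  \<open>y = c - c * c / 4\<close>, where \<open>y \<ge> 3 / 4 * c\<close>. This gives the exponent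
  of the upper tail.\<close>

lemma ln_1_plus_le:
  fixes c :: real
  assumes "0 \<le> c" "c \<le> 1"
  shows "ln (1 + c) \<le> c - c\<^sup>2 / 4"
proof -
  define y where "y = c - c\<^sup>2 / 4"
  have y: "y \<ge> 3 / 4 * c" using assms mult_left_le[of c c] by (simp add: y_def power2_eq_square)
  hence "y\<^sup>2 \<ge> (3 / 4 * c)\<^sup>2" using assms by (intro power_mono) auto
  hence "y\<^sup>2 \<ge> 9 / 16 * c\<^sup>2" by (simp add: power_mult_distrib power2_eq_square)
  moreover have "c\<^sup>2 \<ge> 0" by simp
  ultimately have "y\<^sup>2 / 2 \<ge> c\<^sup>2 / 4" by linarith
  hence "1 + c \<le> 1 + y + y\<^sup>2 / 2" by (simp add: y_def)
  also have "\<dots> \<le> exp y" using y assms by (intro exp_lower_Taylor_quadratic) auto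
  finally have "ln (1 + c) \<le> ln (exp y)" using assms by (subst ln_le_cancel_iff) auto
  thus ?thesis by (simp add: y_def)
qed

lemma ln_1_minus_le:
  fixes c :: real
  assumes "0 \<le> c" "c < 1"
  shows "ln (1 - c) \<le> - c - c\<^sup>2 / 4"
proof -
  have "- 0 - 0\<^sup>2 / 4 - ln (1 - 0) \<le> - c - c\<^sup>2 / 4 - ln (1 - c)"
  proof (rule DERIV_nonneg_imp_nondecreasing[OF assms(1)])
    fix x :: real assume x: "0 \<le> x" "x \<le> c"
    have "((\<lambda>c. - c - c\<^sup>2 / 4 - ln (1 - c)) has_real_derivative (- 1 - x / 2 + 1 / (1 - x))) (at x)"
      using x assms by (auto intro!: derivative_eq_intros simp: field_simps)
    moreover have "- 1 - x / 2 + 1 / (1 - x) \<ge> 0" using x assms by (simp add: field_simps)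
    ultimately show "\<exists>y. ((\<lambda>c. - c - c\<^sup>2 / 4 - ln (1 - c)) has_real_derivative y) (at x) \<and> 0 \<le> y" by blast
  qed
  thus ?thesis by simp
qed

text \<open>The quadratic loss turns into a constant factor in the density bound, where
  \<open>real m * z * z\<close> stays bounded.\<close>

lemma ln_1_plus_ge_quadratic:
  fixes c :: real
  assumes "0 \<le> c"
  shows "ln (1 + c) \<ge> c - c\<^sup>2 / 2"
proof -
  have "ln (1 + 0) - 0 + 0\<^sup>2 / 2 \<le> ln (1 + c) - c + c\<^sup>2 / 2"
  proof (rule DERIV_nonneg_imp_nondecreasing[OF assms(1)])
    fix x :: real assume x: "0 \<le> x" "x \<le> c"
    have "((\<lambda>c. ln (1 + c) - c + c\<^sup>2 / 2) has_real_derivative (1 / (1 + x) - 1 + x)) (at x)"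
      using x by (auto intro!: derivative_eq_intros simp: field_simps)
    moreover have "1 / (1 + x) - 1 + x \<ge> 0" using x by (simp add: field_simps)
    ultimately show "\<exists>y. ((\<lambda>c. ln (1 + c) - c + c\<^sup>2 / 2) has_real_derivative y) (at x) \<and> 0 \<le> y" by blast
  qed
  thus ?thesis by simp
qed

text \<open>The Pade approximant is used since at \<open>c = 1 / n\<close> it gives exactly
  \<open>1 \<le> (n + 1 / 2) * ln (1 + 1 / n)\<close>, the increment needed for Stirling's
  bound.\<close>

lemma ln_1_plus_ge_pade:
  fixes c :: real
  assumes "0 \<le> c"
  shows "ln (1 + c) \<ge> 2 * c / (2 + c)"
proof -
  have "ln (1 + 0) - 2 * 0 / (2 + 0) \<le> ln (1 + c) - 2 * c / (2 + c)"
  proof (rule DERIV_nonneg_imp_nondecreasing[OF assms(1)])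
    fix x :: real assume x: "0 \<le> x" "x \<le> c"
    have "((\<lambda>c. ln (1 + c) - 2 * c / (2 + c)) has_real_derivative (1 / (1 + x) - 4 / (2 + x)\<^sup>2)) (at x)"
      using x by (auto intro!: derivative_eq_intros simp: power2_eq_square field_simps)
    moreover have "1 / (1 + x) - 4 / (2 + x)\<^sup>2 = x\<^sup>2 / ((1 + x) * (2 + x)\<^sup>2)"
      using x by (simp add: divide_simps) (simp add: power2_eq_square algebra_simps)
    ultimately show "\<exists>y. ((\<lambda>c. ln (1 + c) - 2 * c / (2 + c)) has_real_derivative y) (at x) \<and> 0 \<le> y"
      using x by (metis divide_nonneg_nonneg mult_nonneg_nonneg zero_le_power2 add_nonneg_nonneg zero_le_one)
  qed
  thus ?thesis by simp
qed

text \<open>Equality holds at \<open>m = 1\<close>, and passing from \<open>n\<close> to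
  \<open>n + 1\<close> multiplies the right side by at least \<open>n + 1\<close>, because
  \<open>exp 1 \<le> (1 + 1 / n) powr (n + 1 / 2)\<close>.\<close>

lemma fact_le_stirling:
  assumes "m \<ge> 1"
  shows "fact m \<le> exp 1 * sqrt (real m) * real m ^ m * exp (- real m)"
  using assms
proof (induction m rule: dec_induct)
  case base
  show ?case by (simp flip: exp_add)
next
  case (step n)
  have n: "real n > 0" using step by simp
  have "1 \<le> (real n + 1 / 2) * ln (1 + 1 / real n)"
  proof -
    have "(real n + 1 / 2) * (2 * (1 / real n) / (2 + 1 / real n)) \<le> (real n + 1 / 2) * ln (1 + 1 / real n)"
      using ln_1_plus_ge_pade[of "1 / real n"] by (intro mult_left_mono) auto
    also have "(real n + 1 / 2) * (2 * (1 / real n) / (2 + 1 / real n)) = 1" using n by (simp add: field_simps)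
    finally show ?thesis .
  qed
  hence "exp 1 \<le> (1 + 1 / real n) powr (real n + 1 / 2)"
    using n add_pos_pos[of 1 "1 / real n"] by (simp add: powr_def)
  also have "\<dots> = (1 + 1 / real n) ^ n * sqrt (1 + 1 / real n)"
    using n add_pos_pos[of 1 "1 / real n"] by (simp add: powr_add powr_realpow powr_half_sqrt)
  also have "1 + 1 / real n = (real n + 1) / real n" using n by (simp add: field_simps)
  also have "sqrt ((real n + 1) / real n) = sqrt (real n + 1) / sqrt (real n)" by (rule real_sqrt_divide)
  finally have "exp 1 * (sqrt (real n) * real n ^ n) \<le>
     ((real n + 1) / real n) ^ n * (sqrt (real n + 1) / sqrt (real n)) * (sqrt (real n) * real n ^ n)"
    using n by (intro mult_right_mono) auto
  also have "\<dots> = sqrt (real n + 1) * (real n + 1) ^ n"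
    using n by (simp add: power_divide)
  finally have key: "exp 1 * (sqrt (real n) * real n ^ n) \<le> sqrt (real n + 1) * (real n + 1) ^ n" .
  have "fact (Suc n) = (real n + 1) * fact n" by simp
  also have "\<dots> \<le> (real n + 1) * (exp 1 * sqrt (real n) * real n ^ n * exp (- real n))"
    using step by (intro mult_left_mono) auto
  also have "\<dots> = ((real n + 1) * exp (- real n)) * (exp 1 * (sqrt (real n) * real n ^ n))" by simp
  also have "\<dots> \<le> ((real n + 1) * exp (- real n)) * (sqrt (real n + 1) * (real n + 1) ^ n)"
    using key by (intro mult_left_mono) auto
  also have "\<dots> = exp 1 * sqrt (real (Suc n)) * real (Suc n) ^ Suc n * exp (- real (Suc n))"
    by (simp add: exp_diff exp_minus field_simps)
  finally show ?case by simp
qed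

text \<open>Up to two standard deviations above the mean the density is of its peak order. With
  \<open>y = \<theta> * x = m * (1 + z)\<close>, the quadratic bound on \<open>ln (1 + z)\<close>
  loses a factor \<open>exp 2\<close>, Stirling's bound loses \<open>exp 1\<close>, and
  \<open>y \<le> 3 * m\<close> loses \<open>3\<close>.\<close>

lemma erlang_density_lower:
  assumes m: "m \<ge> 1" and \<theta>: "\<theta> > 0" and x: "real m \<le> \<theta> * x" "\<theta> * x \<le> real m + 2 * sqrt (real m)"
  shows "erlang_density (m - 1) \<theta> x \<ge> \<theta> / (3 * exp 3 * sqrt (real m))"
proof -
  define y where "y = \<theta> * x"
  define r where "r = sqrt (real m)"
  define z where "z = y / real m - 1"
  have mr: "real m \<ge> 1" using m by simp
  have rr: "r * r = real m" "r \<ge> 1" using m by (auto simp: r_def)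
  have y: "y \<ge> real m" "y \<le> real m + 2 * r" using x by (auto simp: y_def r_def)
  have x0: "x > 0" using y mr \<theta> unfolding y_def by (metis less_le_trans zero_less_one zero_less_mult_pos)
  have z: "z \<ge> 0" using y mr by (simp add: z_def)
  have yz: "y = real m * (1 + z)" using mr by (simp add: z_def)
  have "real m * z \<le> 2 * r" using y yz by (simp add: algebra_simps)
  hence "r * (r * z) \<le> r * 2" unfolding rr(1)[symmetric] by (simp only: mult_ac)
  hence zr: "r * z \<le> 2" using rr(2) by simp
  have "real m * z\<^sup>2 = (r * z)\<^sup>2" unfolding rr(1)[symmetric] by (simp only: power2_eq_square mult_ac)
  also have "\<dots> \<le> 2\<^sup>2" using zr z rr by (intro power_mono) auto
  finally have mz: "real m * z\<^sup>2 \<le> 4" by simp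
  have "z \<le> r * z" using mult_right_mono[OF rr(2) z] by simp
  hence "z \<le> 2" using zr by simp
  hence y3: "y \<le> 3 * real m" using mr by (simp add: yz)
  have "real m * z - real m * z\<^sup>2 / 2 \<le> real m * ln (1 + z)"
    using mult_left_mono[OF ln_1_plus_ge_quadratic[OF z], of "real m"] by (simp add: algebra_simps)
  hence "exp (real m * z - 2) \<le> exp (real m * ln (1 + z))" using mz by simp
  also have "\<dots> = (1 + z) ^ m" using z by (simp add: exp_of_nat_mult)
  finally have e: "exp (real m * z - 2) \<le> (1 + z) ^ m" .
  have "exp (- 2) * (real m ^ m * exp (- real m)) = real m ^ m * exp (real m * z - 2) * exp (- y)"
    by (simp add: yz algebra_simps flip: exp_add)
  also have "\<dots> \<le> real m ^ m * (1 + z) ^ m * exp (- y)"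
    using e by (intro mult_right_mono mult_left_mono) auto
  also have "\<dots> = y ^ m * exp (- y)" by (simp add: yz power_mult_distrib)
  finally have num: "exp (- 2) * (real m ^ m * exp (- real m)) \<le> y ^ m * exp (- y)" .
  have fac: "fact m = real m * fact (m - 1)" using m by (simp add: fact_reduce)
  have ypow: "y ^ m = y * y ^ (m - 1)" using m by (cases m) auto
  have y0: "y > 0" using y mr by simp
  have e3: "exp 3 = exp 2 * exp (1::real)" by (simp flip: exp_add)
  have "1 / (3 * exp 3 * r) = exp (- 2) * (real m ^ m * exp (- real m)) /
      (3 * (exp 1 * r * real m ^ m * exp (- real m)))"
    using mr rr e3 by (simp add: exp_minus field_simps)
  also have "\<dots> \<le> (y ^ m * exp (- y)) / (3 * fact m)"
    using num fact_le_stirling[OF m] y0 by (intro frac_le mult_left_mono) (auto simp: r_def)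
  also have "\<dots> = (y / (3 * real m)) * (y ^ (m - 1) * exp (- y) / fact (m - 1))"
    unfolding fac ypow by simp
  also have "\<dots> \<le> 1 * (y ^ (m - 1) * exp (- y) / fact (m - 1))"
    using y3 mr y0 by (intro mult_right_mono) auto
  finally have "\<theta> * (1 / (3 * exp 3 * r)) \<le> \<theta> * (y ^ (m - 1) * exp (- y) / fact (m - 1))"
    using \<theta> by (intro mult_left_mono) auto
  also have "\<dots> = erlang_density (m - 1) \<theta> x"
    using x0 by (simp add: erlang_density_def y_def power_mult_distrib)
  finally show ?thesis by (simp add: r_def)
qed

lemma (in prob_space) erlang_window_lower:
  assumes D: "distributed M lborel S (erlang_density (m - 1) \<theta>)"
    and m: "m \<ge> 1" and \<theta>: "\<theta> > 0" and ab: "a \<le> b"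
    and win: "real m \<le> \<theta> * a" "\<theta> * b \<le> real m + 2 * sqrt (real m)"
  shows "prob {\<omega> \<in> space M. S \<omega> \<in> {a..b}} \<ge> \<theta> * (b - a) / (3 * exp 3 * sqrt (real m))"
proof -
  define c where "c = \<theta> / (3 * exp 3 * sqrt (real m))"
  have c: "c \<ge> 0" using \<theta> by (simp add: c_def)
  have [measurable]: "S \<in> borel_measurable M" using distributed_measurable[OF D] by simp
  have "ennreal (c * (b - a)) = ennreal c * emeasure lborel {a..b}"
    using c ab by (simp add: ennreal_mult)
  also have "\<dots> = (\<integral>\<^sup>+x. ennreal c * indicator {a..b} x \<partial>lborel)"
    by (simp add: nn_integral_cmult)
  also have "\<dots> \<le> (\<integral>\<^sup>+x. ennreal (erlang_density (m - 1) \<theta> x) * indicator {a..b} x \<partial>lborel)"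
  proof (intro nn_integral_mono)
    fix x :: real
    show "ennreal c * indicator {a..b} x \<le> ennreal (erlang_density (m - 1) \<theta> x) * indicator {a..b} x"
    proof (cases "x \<in> {a..b}")
      case True
      hence "\<theta> * a \<le> \<theta> * x" "\<theta> * x \<le> \<theta> * b" using \<theta> by auto
      hence "erlang_density (m - 1) \<theta> x \<ge> c" unfolding c_def using win
        by (intro erlang_density_lower[OF m \<theta>]) auto
      thus ?thesis using True by (simp add: ennreal_leI)
    qed auto
  qed
  also have "\<dots> = emeasure M (S -` {a..b} \<inter> space M)"
    by (rule distributed_emeasure[OF D, symmetric]) auto
  also have "S -` {a..b} \<inter> space M = {\<omega> \<in> space M. S \<omega> \<in> {a..b}}" by auto
  also have "emeasure M \<dots> = ennreal (prob \<dots>)" by (simp add: emeasure_eq_measure)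
  finally show ?thesis by (simp add: c_def)
qed

section \<open>Exponential moments and concentration\<close>

text \<open>Exponential tilting: multiplying the density by \<open>exp (s * x)\<close> gives a
  multiple of the Erlang density with rate \<open>l - s\<close>, whose total mass is
  \<open>1\<close>.\<close>

lemma (in prob_space) erlang_exp_moment:
  assumes D: "distributed M lborel S (erlang_density k l)" and l: "l > 0" "s < l"
  shows "(\<integral>\<^sup>+\<omega>. ennreal (exp (s * S \<omega>)) \<partial>M) = ennreal ((l / (l - s)) ^ Suc k)"
proof -
  have "(\<integral>\<^sup>+\<omega>. ennreal (exp (s * S \<omega>)) \<partial>M) =
      (\<integral>\<^sup>+x. ennreal (erlang_density k l x) * ennreal (exp (s * x)) \<partial>lborel)"
    by (rule distributed_nn_integral[OF D, symmetric]) auto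
  also have "\<dots> = (\<integral>\<^sup>+x. ennreal ((l / (l - s)) ^ Suc k) * ennreal (erlang_density k (l - s) x) \<partial>lborel)"
  proof (intro nn_integral_cong)
    fix x :: real
    have "erlang_density k l x * exp (s * x) = (l / (l - s)) ^ Suc k * erlang_density k (l - s) x"
    proof -
      have "exp (- l * x) * exp (s * x) = exp (- (l - s) * x)" by (simp add: algebra_simps flip: exp_add)
      hence "l ^ Suc k * x ^ k * exp (- l * x) / fact k * exp (s * x) =
          l ^ Suc k * x ^ k * exp (- (l - s) * x) / fact k" by simp
      also have "l ^ Suc k * x ^ k * exp (- (l - s) * x) / fact k = (l / (l - s)) ^ Suc k * ((l - s) ^ Suc k * x ^ k * exp (- (l - s) * x) / fact k)"
        using l by (simp add: power_divide)
      finally show ?thesis unfolding erlang_density_def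
        by (cases "x < 0") (simp_all only: if_True if_False mult_zero_left mult_zero_right)
    qed
    thus "ennreal (erlang_density k l x) * ennreal (exp (s * x)) =
        ennreal ((l / (l - s)) ^ Suc k) * ennreal (erlang_density k (l - s) x)"
      using l by (simp flip: ennreal_mult ennreal_mult')
  qed
  also have "\<dots> = ennreal ((l / (l - s)) ^ Suc k) * emeasure (density lborel (erlang_density k (l - s))) UNIV"
    by (simp add: nn_integral_cmult emeasure_density)
  also have "emeasure (density lborel (erlang_density k (l - s))) UNIV = 1"
    using prob_space.emeasure_space_1[OF prob_space_erlang_density[of "l - s" k]] l by simp
  finally show ?thesis by simp
qed

text \<open>Markov's inequality for \<open>exp (s * S \<omega>)\<close>. As \<open>s\<close> may be
  negative, the same statement serves both tails.\<close>

lemma (in prob_space) erlang_chernoff: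
  assumes D: "distributed M lborel S (erlang_density k l)" and l: "l > 0" "s < l"
  shows "prob {\<omega> \<in> space M. s * S \<omega> \<ge> a} \<le> exp (- a) * (l / (l - s)) ^ Suc k"
proof -
  have [measurable]: "S \<in> borel_measurable M" using distributed_measurable[OF D] by simp
  have "ennreal (prob {\<omega> \<in> space M. s * S \<omega> \<ge> a}) = (\<integral>\<^sup>+\<omega>. indicator {\<omega> \<in> space M. s * S \<omega> \<ge> a} \<omega> \<partial>M)"
    by (simp add: emeasure_eq_measure)
  also have "\<dots> \<le> (\<integral>\<^sup>+\<omega>. ennreal (exp (- a)) * ennreal (exp (s * S \<omega>)) \<partial>M)"
    by (intro nn_integral_mono) (auto simp: indicator_def simp flip: ennreal_mult exp_add)
  also have "\<dots> = ennreal (exp (- a)) * ennreal ((l / (l - s)) ^ Suc k)"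
    by (subst nn_integral_cmult) (auto simp: erlang_exp_moment[OF D l])
  also have "\<dots> = ennreal (exp (- a) * (l / (l - s)) ^ Suc k)" by (simp add: ennreal_mult' del: power_Suc)
  finally show ?thesis using l by (simp del: power_Suc)
qed

lemma (in prob_space) erlang_concentration:
  assumes D: "distributed M lborel S (erlang_density (m - 1) \<theta>)"
    and m: "m \<ge> 1" and \<theta>: "\<theta> > 0" and c: "0 < c" "c < 1"
  shows "prob {\<omega> \<in> space M. \<bar>\<theta> * S \<omega> / real m - 1\<bar> \<le> c} \<ge> 1 - 2 * exp (- real m * c\<^sup>2 / 4)"
proof -
  have [measurable]: "S \<in> borel_measurable M" using distributed_measurable[OF D] by simp
  have Sm: "Suc (m - 1) = m" using m by simp
  \<comment> \<open>The optimal Chernoff exponents for the levels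
    \<open>(1 + c) * m / \<theta>\<close> and \<open>(1 - c) * m / \<theta>\<close>: they turn the
    moment factors into powers of \<open>1 + c\<close> and \<open>1 - c\<close>.\<close>
  define s1 where "s1 = \<theta> * c / (1 + c)"
  define s2 where "s2 = - (\<theta> * c / (1 - c))"
  define A1 where "A1 = {\<omega> \<in> space M. s1 * S \<omega> \<ge> c * real m}"
  define A2 where "A2 = {\<omega> \<in> space M. s2 * S \<omega> \<ge> - c * real m}"
  have s1: "s1 < \<theta>" "\<theta> / (\<theta> - s1) = 1 + c" using \<theta> c by (auto simp: s1_def field_simps)
  have s2: "s2 < \<theta>" "\<theta> / (\<theta> - s2) = 1 - c" using \<theta> c
    by (auto simp: s2_def field_simps intro: le_less_trans[of _ 0])
  have "prob A1 \<le> exp (- (c * real m)) * (1 + c) ^ m"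
    using erlang_chernoff[OF D \<theta> s1(1), of "c * real m", unfolded s1(2) Sm] by (simp add: A1_def)
  also have "(1 + c) ^ m = exp (real m * ln (1 + c))" using c by (simp add: exp_of_nat_mult)
  also have "exp (- (c * real m)) * exp (real m * ln (1 + c)) = exp (real m * (ln (1 + c) - c))"
    by (simp add: algebra_simps flip: exp_add)
  also have "\<dots> \<le> exp (real m * (- (c\<^sup>2 / 4)))" using ln_1_plus_le[of c] c
    by (subst exp_le_cancel_iff, intro mult_left_mono) auto
  finally have A1: "prob A1 \<le> exp (- real m * c\<^sup>2 / 4)" by simp
  have "prob A2 \<le> exp (c * real m) * (1 - c) ^ m"
    using erlang_chernoff[OF D \<theta> s2(1), of "- c * real m", unfolded s2(2) Sm] by (simp add: A2_def)
  also have "(1 - c) ^ m = exp (real m * ln (1 - c))" using c by (simp add: exp_of_nat_mult)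
  also have "exp (c * real m) * exp (real m * ln (1 - c)) = exp (real m * (ln (1 - c) + c))"
    by (simp add: algebra_simps flip: exp_add)
  also have "\<dots> \<le> exp (real m * (- (c\<^sup>2 / 4)))" using ln_1_minus_le[of c] c
    by (subst exp_le_cancel_iff, intro mult_left_mono) auto
  finally have A2: "prob A2 \<le> exp (- real m * c\<^sup>2 / 4)" by simp
  have "prob (A1 \<union> A2) \<le> prob A1 + prob A2" by (intro measure_Un_le) (auto simp: A1_def A2_def)
  hence "1 - 2 * exp (- real m * c\<^sup>2 / 4) \<le> 1 - prob (A1 \<union> A2)" using A1 A2 by simp
  also have "\<dots> = prob (space M - (A1 \<union> A2))" by (subst prob_compl) (auto simp: A1_def A2_def)
  also have "\<dots> \<le> prob {\<omega> \<in> space M. \<bar>\<theta> * S \<omega> / real m - 1\<bar> \<le> c}"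
  proof (rule finite_measure_mono)
    show "space M - (A1 \<union> A2) \<subseteq> {\<omega> \<in> space M. \<bar>\<theta> * S \<omega> / real m - 1\<bar> \<le> c}"
    proof safe
      fix \<omega> assume \<omega>: "\<omega> \<in> space M" "\<omega> \<notin> A1" "\<omega> \<notin> A2"
      have "s1 * S \<omega> < c * real m" "s2 * S \<omega> < - c * real m" using \<omega> by (auto simp: A1_def A2_def)
      hence "c * (\<theta> * S \<omega>) < c * (real m * (1 + c))" "c * (real m * (1 - c)) < c * (\<theta> * S \<omega>)"
        using c by (auto simp: s1_def s2_def field_simps)
      hence "\<theta> * S \<omega> < real m * (1 + c)" "real m * (1 - c) < \<theta> * S \<omega>" using c by auto
      thus "\<bar>\<theta> * S \<omega> / real m - 1\<bar> \<le> c" using m by (auto simp: abs_le_iff field_simps)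
    qed
  qed measurable
  finally show ?thesis .
qed

section \<open>The Pareto distribution and the expected maximum\<close>

text \<open>The law is encoded by the quantile transform of a uniform variable, so that integrals
  against it become integrals over the unit interval and the needed expectations are power and Beta
  integrals.\<close>

definition pareto :: "real \<Rightarrow> real \<Rightarrow> real measure" where
  "pareto \<theta> x0 = distr (uniform_measure lborel {0..1}) borel (\<lambda>u. x0 * u powr (- 1 / \<theta>))"

lemma sets_pareto [simp, measurable_cong]: "sets (pareto \<theta> x0) = sets borel"
  by (simp add: pareto_def)

lemma space_pareto [simp]: "space (pareto \<theta> x0) = UNIV"
  by (simp add: pareto_def)

lemma prob_space_pareto: "prob_space (pareto \<theta> x0)"
  unfolding pareto_def by (intro prob_space.prob_space_distr prob_space_uniform_measure) auto

text \<open>The null point \<open>0\<close> is removed because \<open>0 powr p\<close> evaluates to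
  \<open>0\<close>, so the quantile formula does not describe a reward there.\<close>

lemma nn_integral_pareto:
  assumes [measurable]: "f \<in> borel_measurable borel"
  shows "(\<integral>\<^sup>+x. f x \<partial>pareto \<theta> x0) = (\<integral>\<^sup>+u. f (x0 * u powr (- 1 / \<theta>)) * indicator {0<..1} u \<partial>lborel)"
proof -
  have "(\<integral>\<^sup>+x. f x \<partial>pareto \<theta> x0) = (\<integral>\<^sup>+u. f (x0 * u powr (- 1 / \<theta>)) * indicator {0..1} u \<partial>lborel)"
    unfolding pareto_def by (subst nn_integral_distr) (auto simp: nn_integral_uniform_measure divide_ennreal_def)
  also have "\<dots> = (\<integral>\<^sup>+u. f (x0 * u powr (- 1 / \<theta>)) * indicator {0<..1} u \<partial>lborel)"
    using AE_lborel_singleton[of "0::real"]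
    by (intro nn_integral_cong_AE, eventually_elim) (auto simp: indicator_def)
  finally show ?thesis .
qed

lemma pareto_quantile_ge_iff:
  fixes x0 a u \<theta> :: real
  assumes "x0 > 0" "\<theta> > 0" "a > 0" "u > 0"
  shows "a \<le> x0 * u powr (- 1 / \<theta>) \<longleftrightarrow> u \<le> (x0 / a) powr \<theta>"
proof -
  have "a \<le> x0 * u powr (- 1 / \<theta>) \<longleftrightarrow> u powr (1 / \<theta>) \<le> x0 / a"
    using assms by (simp add: powr_minus field_simps)
  also have "\<dots> \<longleftrightarrow> (u powr (1 / \<theta>)) powr \<theta> \<le> (x0 / a) powr \<theta>"
    using assms powr_mono2[of \<theta> "u powr (1 / \<theta>)" "x0 / a"] powr_less_mono2[of \<theta> "x0 / a" "u powr (1 / \<theta>)"]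
    by (auto simp: not_le[symmetric])
  also have "(u powr (1 / \<theta>)) powr \<theta> = u" using assms by (simp add: powr_powr)
  finally show ?thesis .
qed

lemma emeasure_pareto_atLeast:
  assumes "x0 > 0" "\<theta> > 0" "a \<ge> x0"
  shows "emeasure (pareto \<theta> x0) {a..} = ennreal ((x0 / a) powr \<theta>)"
proof -
  have b: "(x0 / a) powr \<theta> \<le> 1" using assms by (intro powr_le1) auto
  have "emeasure (pareto \<theta> x0) {a..} = (\<integral>\<^sup>+x. indicator {a..} x \<partial>pareto \<theta> x0)" by simp
  also have "\<dots> = (\<integral>\<^sup>+u. indicator {a..} (x0 * u powr (- 1 / \<theta>)) * indicator {0<..1} u \<partial>lborel)"
    by (rule nn_integral_pareto) simp
  also have "\<dots> = (\<integral>\<^sup>+u. indicator {0<..(x0 / a) powr \<theta>} u \<partial>lborel)"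
    using assms b pareto_quantile_ge_iff[of x0 \<theta> a]
    by (intro nn_integral_cong) (auto simp: indicator_def)
  also have "\<dots> = ennreal ((x0 / a) powr \<theta>)" by simp
  finally show ?thesis .
qed

lemma emeasure_pareto_atMost:
  assumes "x0 > 0" "\<theta> > 0" "a \<ge> x0"
  shows "emeasure (pareto \<theta> x0) {..a} = ennreal (1 - (x0 / a) powr \<theta>)"
proof -
  have b: "(x0 / a) powr \<theta> \<le> 1" using assms by (intro powr_le1) auto
  have "emeasure (pareto \<theta> x0) {..a} = (\<integral>\<^sup>+x. indicator {..a} x \<partial>pareto \<theta> x0)" by simp
  also have "\<dots> = (\<integral>\<^sup>+u. indicator {..a} (x0 * u powr (- 1 / \<theta>)) * indicator {0<..1} u \<partial>lborel)"
    by (rule nn_integral_pareto) simp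
  also have "\<dots> = (\<integral>\<^sup>+u. indicator {(x0 / a) powr \<theta>..1} u \<partial>lborel)"
  proof (rule nn_integral_cong_AE)
    have *: "x0 * u powr (- 1 / \<theta>) \<le> a \<longleftrightarrow> (x0 / a) powr \<theta> \<le> u"
      if "u > 0" "u \<noteq> (x0 / a) powr \<theta>" for u
    proof -
      have "x0 * u powr (- 1 / \<theta>) = a \<longrightarrow> u = (x0 / a) powr \<theta>"
      proof
        assume "x0 * u powr (- 1 / \<theta>) = a"
        hence "x0 = a * u powr (1 / \<theta>)" using assms that by (simp add: powr_minus field_simps)
        hence "x0 / a = u powr (1 / \<theta>)" using assms by simp
        thus "u = (x0 / a) powr \<theta>" using assms that by (simp add: powr_powr)
      qed
      thus ?thesis using pareto_quantile_ge_iff[of x0 \<theta> a u] assms that by (metis le_less less_trans not_le)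
    qed
    show "AE u in lborel. indicator {..a} (x0 * u powr (- 1 / \<theta>)) * indicator {0<..1} u =
        (indicator {(x0 / a) powr \<theta>..1} u :: ennreal)"
      using AE_lborel_singleton[of "(x0 / a) powr \<theta>"]
    proof eventually_elim
      case (elim u)
      have "u > 0" if "(x0 / a) powr \<theta> \<le> u"
        using less_le_trans[OF _ that, of 0] assms by simp
      thus ?case using *[of u] elim by (auto simp: indicator_def)
    qed
  qed
  also have "\<dots> = ennreal (1 - (x0 / a) powr \<theta>)" using b by simp
  finally show ?thesis .
qed

lemma AE_pareto:
  assumes "x0 > 0" "\<theta> > 0"
  shows "AE x in pareto \<theta> x0. x0 \<le> x"
proof -
  interpret prob_space "pareto \<theta> x0" by (rule prob_space_pareto)
  have "emeasure (pareto \<theta> x0) {x0..} = 1" using emeasure_pareto_atLeast[of x0 \<theta> x0] assms by simp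
  thus ?thesis using AE_in_set_eq_1[of "{x0..}"] by (simp add: measure_def)
qed

lemma cdf_pareto:
  assumes "x0 > 0" "\<theta> > 0"
  shows "cdf (pareto \<theta> x0) x = pareto_cdf \<theta> x0 x"
proof (cases "x \<ge> x0")
  case True
  hence "(x0 / x) powr \<theta> \<le> 1" using assms by (intro powr_le1) auto
  thus ?thesis using emeasure_pareto_atMost[OF assms True] True
    by (simp add: cdf_def measure_def pareto_cdf_def)
next
  case False
  interpret prob_space "pareto \<theta> x0" by (rule prob_space_pareto)
  have "AE y in pareto \<theta> x0. y \<notin> {..x}" using AE_pareto[OF assms] by eventually_elim (use False in auto)
  hence "measure (pareto \<theta> x0) {..x} = 0" by (subst prob_eq_0) auto
  thus ?thesis using False by (simp add: cdf_def pareto_cdf_def)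
qed

lemma iid_pareto_measurable:
  assumes "iid_pareto M n X \<theta> x0" "t \<in> {1..n}"
  shows "X t \<in> borel_measurable M"
  using assms by (auto simp: iid_pareto_def prob_space.indep_vars_def)

lemma iid_pareto_distr:
  assumes "iid_pareto M n X \<theta> x0" "x0 > 0" "\<theta> > 0" "t \<in> {1..n}"
  shows "distr M borel (X t) = pareto \<theta> x0"
proof (rule cdf_unique)
  interpret prob_space M using assms by (simp add: iid_pareto_def)
  note [measurable] = iid_pareto_measurable[OF assms(1,4)]
  show "real_distribution (distr M borel (X t))" by (rule real_distribution_distr) simp
  interpret P: prob_space "pareto \<theta> x0" by (rule prob_space_pareto)
  show "real_distribution (pareto \<theta> x0)" by unfold_locales simp
  show "cdf (distr M borel (X t)) = cdf (pareto \<theta> x0)"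
    using assms by (auto simp: fun_eq_iff cdf_pareto iid_pareto_def)
qed

text \<open>Moves expectations from an arbitrary sample space to a product measure, where
  observations can be integrated one at a time.\<close>

lemma iid_pareto_joint_distr:
  assumes "iid_pareto M n X \<theta> x0" "x0 > 0" "\<theta> > 0" "n > 0"
  shows "distr M (\<Pi>\<^sub>M i\<in>{1..n}. borel) (\<lambda>\<omega>. \<lambda>i\<in>{1..n}. X i \<omega>) = (\<Pi>\<^sub>M i\<in>{1..n}. pareto \<theta> x0)"
proof -
  interpret prob_space M using assms by (simp add: iid_pareto_def)
  have "indep_vars (\<lambda>_. borel) X {1..n}" using assms by (simp add: iid_pareto_def)
  hence "distr M (\<Pi>\<^sub>M i\<in>{1..n}. borel) (\<lambda>\<omega>. \<lambda>i\<in>{1..n}. X i \<omega>) = (\<Pi>\<^sub>M i\<in>{1..n}. distr M borel (X i))"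
    using assms by (subst (asm) indep_vars_iff_distr_eq_PiM') (auto intro: iid_pareto_measurable)
  also have "\<dots> = (\<Pi>\<^sub>M i\<in>{1..n}. pareto \<theta> x0)"
    by (intro PiM_cong refl iid_pareto_distr[OF assms(1-3)])
  finally show ?thesis .
qed

lemma iid_pareto_AE_ge:
  assumes "iid_pareto M n X \<theta> x0" "x0 > 0" "\<theta> > 0" "t \<in> {1..n}"
  shows "AE \<omega> in M. x0 \<le> X t \<omega>"
proof -
  note [measurable] = iid_pareto_measurable[OF assms(1,4)]
  have "AE x in distr M borel (X t). x0 \<le> x"
    unfolding iid_pareto_distr[OF assms] by (rule AE_pareto) fact+
  thus ?thesis by (subst (asm) AE_distr_iff) auto
qed

lemma nn_integral_powr_from_0:
  fixes b s :: real
  assumes "b \<ge> 0" "s < 1"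
  shows "(\<integral>\<^sup>+u. ennreal (u powr (- s)) * indicator {0..b} u \<partial>lborel) = ennreal (b powr (1 - s) / (1 - s))"
proof -
  have "((\<lambda>u. u powr (- s)) has_integral (b powr (- s + 1) / (- s + 1))) {0..b}"
    using assms by (intro has_integral_powr_from_0) auto
  from nn_integral_has_integral_lebesgue[OF _ this]
  have "(\<integral>\<^sup>+u. ennreal (indicator {0..b} u * u powr (- s)) \<partial>lborel) = ennreal (b powr (1 - s) / (1 - s))"
    by simp
  thus ?thesis by (simp add: ennreal_mult' ennreal_indicator mult.commute)
qed

text \<open>In the uniform variable the tail event is \<open>u \<le> b\<close>, which leaves the
  power integral from \<open>0\<close> to \<open>b\<close>.\<close>

lemma pareto_tail_mean:
  assumes "x0 > 0" "\<theta> > 1" "a \<ge> x0"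
  shows "(\<integral>\<^sup>+x. ennreal x * indicator {a..} x \<partial>pareto \<theta> x0) =
    ennreal (\<theta> / (\<theta> - 1) * a * (x0 / a) powr \<theta>)"
proof -
  define b where "b = (x0 / a) powr \<theta>"
  have b: "b \<le> 1" using assms unfolding b_def by (intro powr_le1) auto
  have b0: "b > 0" using assms by (simp add: b_def)
  have "(\<integral>\<^sup>+x. ennreal x * indicator {a..} x \<partial>pareto \<theta> x0) =
    (\<integral>\<^sup>+u. ennreal (x0 * u powr (- 1 / \<theta>)) * indicator {a..} (x0 * u powr (- 1 / \<theta>)) * indicator {0<..1} u \<partial>lborel)"
    by (rule nn_integral_pareto) simp
  also have "\<dots> = (\<integral>\<^sup>+u. ennreal x0 * (ennreal (u powr (- (1 / \<theta>))) * indicator {0..b} u) \<partial>lborel)"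
  proof (rule nn_integral_cong_AE)
    show "AE u in lborel. ennreal (x0 * u powr (- 1 / \<theta>)) * indicator {a..} (x0 * u powr (- 1 / \<theta>)) * indicator {0<..1} u
      = ennreal x0 * (ennreal (u powr (- (1 / \<theta>))) * indicator {0..b} u)"
      using AE_lborel_singleton[of "0::real"]
    proof eventually_elim
      case (elim u)
      show ?case using pareto_quantile_ge_iff[of x0 \<theta> a u] b assms elim
        by (auto simp: indicator_def b_def ennreal_mult')
    qed
  qed
  also have "\<dots> = ennreal x0 * ennreal (b powr (1 - 1 / \<theta>) / (1 - 1 / \<theta>))"
    using assms b0 nn_integral_powr_from_0[of b "1 / \<theta>"] by (subst nn_integral_cmult) auto
  also have "\<dots> = ennreal (x0 * (b powr (1 - 1 / \<theta>) / (1 - 1 / \<theta>)))"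
    using assms by (intro ennreal_mult'[symmetric]) auto
  also have "b powr (1 - 1 / \<theta>) = b / (x0 / a)"
    using assms b0 by (simp add: powr_diff) (simp add: b_def powr_powr)
  also have "x0 * (b / (x0 / a) / (1 - 1 / \<theta>)) = \<theta> / (\<theta> - 1) * a * b"
    using assms by (simp add: field_simps)
  finally show ?thesis by (simp add: b_def)
qed

lemma pareto_mean:
  assumes "x0 > 0" "\<theta> > 1"
  shows "(\<integral>\<^sup>+x. ennreal x \<partial>pareto \<theta> x0) = ennreal (\<theta> / (\<theta> - 1) * x0)"
proof -
  have "(\<integral>\<^sup>+x. ennreal x \<partial>pareto \<theta> x0) = (\<integral>\<^sup>+x. ennreal x * indicator {x0..} x \<partial>pareto \<theta> x0)"
  proof (rule nn_integral_cong_AE)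
    have "AE x in pareto \<theta> x0. x0 \<le> x" using assms by (intro AE_pareto) auto
    thus "AE x in pareto \<theta> x0. ennreal x = ennreal x * indicator {x0..} x"
      by eventually_elim (auto simp: indicator_def)
  qed
  thus ?thesis using pareto_tail_mean[of x0 \<theta> x0] assms by simp
qed

text \<open>One stage of the optimal stopping recursion in units of \<open>x0\<close>:
  \<open>a powr (- \<theta>)\<close> is the acceptance probability,
  \<open>\<theta> / (\<theta> - 1) * a\<close> the conditional mean of an accepted reward, and
  \<open>r\<close> the value of continuing.\<close>

lemma pareto_threshold_step:
  assumes "x0 > 0" "\<theta> > 1" "a \<ge> 1" "r \<ge> 0"
  shows "(\<integral>\<^sup>+x. (if x0 * a \<le> x then ennreal x else ennreal (x0 * r)) \<partial>pareto \<theta> x0) =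
    ennreal (x0 * (r + a powr (- \<theta>) * (\<theta> / (\<theta> - 1) * a - r)))"
proof -
  interpret prob_space "pareto \<theta> x0" by (rule prob_space_pareto)
  define p where "p = a powr (- \<theta>)"
  have "a powr \<theta> \<ge> 1" using assms by (intro ge_one_powr_ge_zero) auto
  hence p: "0 \<le> p" "p \<le> 1" by (auto simp: p_def powr_minus inverse_le_1_iff)
  have xa: "x0 * a \<ge> x0" using assms by simp
  have quot: "(x0 / (x0 * a)) powr \<theta> = p"
    using assms by (simp add: p_def powr_divide powr_minus inverse_eq_divide)
  have "(\<integral>\<^sup>+x. (if x0 * a \<le> x then ennreal x else ennreal (x0 * r)) \<partial>pareto \<theta> x0) =
    (\<integral>\<^sup>+x. ennreal x * indicator {x0 * a..} x + ennreal (x0 * r) * indicator (UNIV - {x0 * a..}) x \<partial>pareto \<theta> x0)"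
    by (intro nn_integral_cong) (auto simp: indicator_def)
  also have "\<dots> = (\<integral>\<^sup>+x. ennreal x * indicator {x0 * a..} x \<partial>pareto \<theta> x0) +
      ennreal (x0 * r) * emeasure (pareto \<theta> x0) (UNIV - {x0 * a..})"
    by (subst nn_integral_add) (auto simp: nn_integral_cmult)
  also have "emeasure (pareto \<theta> x0) (UNIV - {x0 * a..}) = 1 - ennreal p"
    using emeasure_compl[of "{x0 * a..}" "pareto \<theta> x0"] emeasure_space_1
      emeasure_pareto_atLeast[of x0 \<theta> "x0 * a"] assms xa quot by simp
  also have "1 - ennreal p = ennreal (1 - p)" using p by (simp add: ennreal_minus flip: ennreal_1)
  also have "(\<integral>\<^sup>+x. ennreal x * indicator {x0 * a..} x \<partial>pareto \<theta> x0) = ennreal (\<theta> / (\<theta> - 1) * (x0 * a) * p)"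
    using pareto_tail_mean[of x0 \<theta> "x0 * a"] assms xa quot by simp
  also have "ennreal (\<theta> / (\<theta> - 1) * (x0 * a) * p) + ennreal (x0 * r) * ennreal (1 - p) =
      ennreal (\<theta> / (\<theta> - 1) * (x0 * a) * p + x0 * r * (1 - p))"
    using assms p by (simp flip: ennreal_mult' ennreal_plus)
  also have "\<theta> / (\<theta> - 1) * (x0 * a) * p + x0 * r * (1 - p) = x0 * (r + p * (\<theta> / (\<theta> - 1) * a - r))"
    by (simp add: algebra_simps)
  finally show ?thesis by (simp add: p_def)
qed

lemma iid_pareto_integrable:
  assumes "iid_pareto M n X \<theta> x0" "x0 > 0" "\<theta> > 1" "t \<in> {1..n}"
  shows "integrable M (X t)"
proof -
  note [measurable] = iid_pareto_measurable[OF assms(1,4)]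
  have th: "\<theta> > 0" using assms by simp
  have "(\<integral>\<^sup>+\<omega>. ennreal (X t \<omega>) \<partial>M) = (\<integral>\<^sup>+x. ennreal x \<partial>distr M borel (X t))"
    by (subst nn_integral_distr) auto
  also have "\<dots> = ennreal (\<theta> / (\<theta> - 1) * x0)"
    unfolding iid_pareto_distr[OF assms(1,2) th assms(4)] by (rule pareto_mean) fact+
  finally have fin: "(\<integral>\<^sup>+\<omega>. ennreal (X t \<omega>) \<partial>M) < \<infinity>" by simp
  have "AE \<omega> in M. 0 \<le> X t \<omega>"
    using iid_pareto_AE_ge[OF assms(1,2) th assms(4)] by eventually_elim (use assms in auto)
  thus ?thesis using fin by (intro integrableI_nonneg) auto
qed

text \<open>The logarithm of a reward over the scale is exponential with rate
  \<open>\<theta>\<close>, so the sum of independent copies is Erlang.\<close>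

lemma iid_pareto_log_sum:
  assumes "iid_pareto M n X \<theta> x0" "x0 > 0" "\<theta> > 0" "1 \<le> m" "m \<le> n"
  shows "distributed M lborel (\<lambda>\<omega>. \<Sum>i=1..m. ln (X i \<omega> / x0)) (erlang_density (m - 1) \<theta>)"
proof -
  interpret prob_space M using assms by (simp add: iid_pareto_def)
  have "distributed M lborel (\<lambda>\<omega>. \<Sum>i\<in>{1..m}. ln (X i \<omega> / x0)) (erlang_density (card {1..m} - 1) \<theta>)"
  proof (rule exponential_distributed_sum)
    show "indep_vars (\<lambda>i. borel) (\<lambda>i \<omega>. ln (X i \<omega> / x0)) {1..m}"
    proof (rule indep_vars_compose2[where M' = "\<lambda>_. borel" and X = X and Y = "\<lambda>_ x. ln (x / x0)"])
      have "indep_vars (\<lambda>_. borel) X {1..n}" using assms by (simp add: iid_pareto_def)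
      thus "indep_vars (\<lambda>_. borel) X {1..m}" using assms by (elim indep_vars_subset) auto
    qed auto
    fix i assume i: "i \<in> {1..m}"
    hence i': "i \<in> {1..n}" using assms by auto
    note [measurable] = iid_pareto_measurable[OF assms(1) i']
    have "prob {\<omega> \<in> space M. ln (X i \<omega> / x0) \<le> a} = 1 - exp (- a * \<theta>)" if "a \<ge> 0" for a
    proof -
      \<comment> \<open>The events agree only almost surely: inverting \<open>ln\<close> needs a
        positive argument, which holds off a null set.\<close>
      have "prob {\<omega> \<in> space M. ln (X i \<omega> / x0) \<le> a} = prob (X i -` {..x0 * exp a} \<inter> space M)"
      proof (rule finite_measure_eq_AE)
        show "AE \<omega> in M. (\<omega> \<in> {\<omega> \<in> space M. ln (X i \<omega> / x0) \<le> a}) = (\<omega> \<in> X i -` {..x0 * exp a} \<inter> space M)"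
          using iid_pareto_AE_ge[OF assms(1-3) i']
        proof eventually_elim
          case (elim \<omega>)
          hence pos: "X i \<omega> / x0 > 0" using assms by auto
          have "ln (X i \<omega> / x0) \<le> a \<longleftrightarrow> X i \<omega> / x0 \<le> exp a"
            using pos by (metis exp_le_cancel_iff exp_ln)
          thus ?case using assms by (auto simp: field_simps)
        qed
      qed auto
      also have "\<dots> = cdf (distr M borel (X i)) (x0 * exp a)" by (simp add: cdf_def measure_distr)
      also have "\<dots> = pareto_cdf \<theta> x0 (x0 * exp a)" using assms i' by (simp add: iid_pareto_def)
      also have "\<dots> = 1 - exp (- a * \<theta>)"
        using assms that by (simp add: pareto_cdf_def powr_def ln_div algebra_simps)
      finally show ?thesis .
    qed
    thus "distributed M lborel (\<lambda>\<omega>. ln (X i \<omega> / x0)) (exponential_density \<theta>)"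
      unfolding exponential_distributed_iff[OF assms(3)] by auto
  qed (use assms in auto)
  thus ?thesis by simp
qed

section \<open>The expected maximum through Beta integrals\<close>

text \<open>Log-convexity of \<open>Gamma\<close> between \<open>x = n + 1 - s\<close> and
  \<open>x + 1\<close>, with weight \<open>s\<close> on the latter; the functional equation at
  \<open>x\<close> produces the factor \<open>x powr s\<close>.\<close>

lemma Gamma_ratio_le:
  fixes s :: real
  assumes "0 < s" "s < 1"
  shows "Gamma (real n + 1) / Gamma (real n + 1 - s) \<le> (real n + 1) powr s"
proof -
  define x where "x = real n + 1 - s"
  have x: "x > 0" using assms by (simp add: x_def)
  have "(ln \<circ> Gamma) ((1 - s) *\<^sub>R x + s *\<^sub>R (x + 1)) \<le> (1 - s) * (ln \<circ> Gamma) x + s * (ln \<circ> Gamma) (x + 1)"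
    using assms x by (intro convex_onD[OF log_convex_Gamma_real]) auto
  also have "(1 - s) *\<^sub>R x + s *\<^sub>R (x + 1) = real n + 1" by (simp add: x_def algebra_simps)
  also have "(ln \<circ> Gamma) (x + 1) = ln x + ln (Gamma x)"
    using x Gamma_plus1[of x] by (simp add: ln_mult nonpos_Ints_def Gamma_real_pos less_imp_neq[symmetric])
  finally have "ln (Gamma (real n + 1)) \<le> ln (Gamma x) + s * ln x" by (simp add: algebra_simps)
  also have "\<dots> = ln (Gamma x * x powr s)" using x by (simp add: ln_mult ln_powr Gamma_real_pos less_imp_neq[symmetric])
  finally have "Gamma (real n + 1) \<le> Gamma x * x powr s"
    using x by (subst (asm) ln_le_cancel_iff) (auto intro!: mult_pos_pos Gamma_real_pos)
  also have "\<dots> \<le> Gamma x * (real n + 1) powr s"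
    using x assms by (intro mult_left_mono powr_mono2) (auto simp: x_def intro: less_imp_le)
  finally show ?thesis using x Gamma_real_pos[OF x] by (simp add: x_def field_simps)
qed

lemma nn_integral_beta:
  fixes s :: real
  assumes "s < 1" "n > 0"
  shows "(\<integral>\<^sup>+u. ennreal (u powr (- s) * (1 - u) ^ (n - 1)) * indicator {0<..1} u \<partial>lborel) = ennreal (Beta (1 - s) (real n))"
proof -
  have "((\<lambda>u. u powr (1 - s - 1) * (1 - u) powr (real n - 1)) has_integral Beta (1 - s) (real n)) {0..1}"
    using assms by (intro has_integral_Beta_real) auto
  from nn_integral_has_integral_lebesgue[OF _ this]
  have "(\<integral>\<^sup>+u. ennreal (indicator {0..1} u * (u powr (- s) * (1 - u) powr (real n - 1))) \<partial>lborel) =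
      ennreal (Beta (1 - s) (real n))"
    by simp
  also have "(\<integral>\<^sup>+u. ennreal (indicator {0..1} u * (u powr (- s) * (1 - u) powr (real n - 1))) \<partial>lborel) =
      (\<integral>\<^sup>+u. ennreal (u powr (- s) * (1 - u) ^ (n - 1)) * indicator {0<..1} u \<partial>lborel)"
  proof (rule nn_integral_cong_AE)
    show "AE u in lborel. ennreal (indicator {0..1} u * (u powr (- s) * (1 - u) powr (real n - 1))) =
       ennreal (u powr (- s) * (1 - u) ^ (n - 1)) * indicator {0<..1} u"
      using AE_lborel_singleton[of "0::real"] AE_lborel_singleton[of "1::real"]
    proof eventually_elim
      case (elim u)
      have "(1 - u) powr (real n - 1) = (1 - u) ^ (n - 1)" if "u < 1"
        using powr_realpow[of "1 - u" "n - 1"] that assms by (simp add: of_nat_diff)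
      thus ?case using elim by (auto simp: indicator_def)
    qed
  qed
  finally show ?thesis .
qed

text \<open>The contribution of one observation on the event that the other \<open>n - 1\<close> do
  not exceed it. At the quantile of \<open>u\<close> the distribution function is
  \<open>1 - u\<close>, which gives a Beta integral.\<close>

lemma pareto_max_term:
  assumes "x0 > 0" "\<theta> > 1" "n > 0"
  shows "(\<integral>\<^sup>+y. ennreal y * emeasure (pareto \<theta> x0) {..y} ^ (n - 1) \<partial>pareto \<theta> x0) =
    ennreal (x0 * Beta (1 - 1 / \<theta>) (real n))"
proof -
  have "(\<integral>\<^sup>+y. ennreal y * emeasure (pareto \<theta> x0) {..y} ^ (n - 1) \<partial>pareto \<theta> x0) =
      (\<integral>\<^sup>+y. ennreal y * ennreal (1 - (x0 / y) powr \<theta>) ^ (n - 1) \<partial>pareto \<theta> x0)"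
  proof (rule nn_integral_cong_AE)
    have "AE x in pareto \<theta> x0. x0 \<le> x" using assms by (intro AE_pareto) auto
    thus "AE y in pareto \<theta> x0. ennreal y * emeasure (pareto \<theta> x0) {..y} ^ (n - 1) =
        ennreal y * ennreal (1 - (x0 / y) powr \<theta>) ^ (n - 1)"
      by eventually_elim (use assms in \<open>simp add: emeasure_pareto_atMost\<close>)
  qed
  also have "\<dots> = (\<integral>\<^sup>+u. ennreal (x0 * u powr (- 1 / \<theta>)) *
      ennreal (1 - (x0 / (x0 * u powr (- 1 / \<theta>))) powr \<theta>) ^ (n - 1) * indicator {0<..1} u \<partial>lborel)"
    by (rule nn_integral_pareto) simp
  also have "\<dots> = (\<integral>\<^sup>+u. ennreal x0 * (ennreal (u powr (- (1 / \<theta>)) * (1 - u) ^ (n - 1)) * indicator {0<..1} u) \<partial>lborel)"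
  proof (rule nn_integral_cong)
    fix u :: real
    show "ennreal (x0 * u powr (- 1 / \<theta>)) *
        ennreal (1 - (x0 / (x0 * u powr (- 1 / \<theta>))) powr \<theta>) ^ (n - 1) * indicator {0<..1} u =
        ennreal x0 * (ennreal (u powr (- (1 / \<theta>)) * (1 - u) ^ (n - 1)) * indicator {0<..1} u)"
    proof (cases "u \<in> {0<..1}")
      case True
      have "x0 / (x0 * u powr (- 1 / \<theta>)) = u powr (1 / \<theta>)"
        using True assms by (simp add: powr_minus field_simps)
      hence "(x0 / (x0 * u powr (- 1 / \<theta>))) powr \<theta> = u" using True assms by (simp add: powr_powr)
      thus ?thesis using True assms by (simp add: ennreal_mult ennreal_power mult.assoc)
    qed auto
  qed
  also have "\<dots> = ennreal x0 * ennreal (Beta (1 - 1 / \<theta>) (real n))"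
    using assms nn_integral_beta[of "1 / \<theta>" n] by (subst nn_integral_cmult) auto
  finally show ?thesis using assms by (simp add: ennreal_mult')
qed

text \<open>Counting ties several times only increases the sum over candidates for the maximum. Its
  \<open>n\<close> equal terms add up to \<open>n * x0 * Beta (1 - 1 / \<theta>) n\<close>, a Gamma
  quotient bounded by log-convexity.\<close>

lemma iid_pareto_max_le:
  assumes iid: "iid_pareto M n X \<theta> x0" and x0: "x0 > 0" and th: "\<theta> > 1" and n: "n > 0"
  shows "(\<integral>\<^sup>+\<omega>. ennreal (MAX t\<in>{1..n}. X t \<omega>) \<partial>M) \<le>
    ennreal (x0 * Gamma (1 - 1 / \<theta>) * (real n + 1) powr (1 / \<theta>))"
proof -
  interpret P: product_prob_space "\<lambda>_::nat. pareto \<theta> x0" UNIV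
    by (rule product_prob_spaceI) (rule prob_space_pareto)
  define I where "I = {1..n}"
  have I: "finite I" "I \<noteq> {}" "card I = n" using n by (auto simp: I_def)
  define f where "f = (\<lambda>i (x :: nat \<Rightarrow> real). ennreal (x i) * (\<Prod>j\<in>I - {i}. if x j \<le> x i then 1 else 0))"
  note [measurable] = iid_pareto_measurable[OF iid, folded I_def]
  have fm: "f i \<in> borel_measurable (\<Pi>\<^sub>M i\<in>I. pareto \<theta> x0)" if "i \<in> I" for i
    unfolding f_def using that by measurable
  \<comment> \<open>The maximum is at most the sum of the observations that are not exceeded by another one.\<close>
  have "(\<integral>\<^sup>+\<omega>. ennreal (MAX t\<in>I. X t \<omega>) \<partial>M) \<le> (\<integral>\<^sup>+\<omega>. (\<Sum>i\<in>I. f i (\<lambda>i\<in>I. X i \<omega>)) \<partial>M)"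
  proof (rule nn_integral_mono)
    fix \<omega>
    have "(MAX t\<in>I. X t \<omega>) \<in> (\<lambda>t. X t \<omega>) ` I" using I by (intro Max_in) auto
    then obtain i where i: "i \<in> I" "(MAX t\<in>I. X t \<omega>) = X i \<omega>" by auto
    have "X j \<omega> \<le> X i \<omega>" if "j \<in> I" for j using that I by (simp flip: i(2))
    hence "f i (\<lambda>i\<in>I. X i \<omega>) = ennreal (X i \<omega>)" using i by (simp add: f_def)
    hence "ennreal (MAX t\<in>I. X t \<omega>) = f i (\<lambda>i\<in>I. X i \<omega>)" using i by simp
    also have "\<dots> \<le> (\<Sum>i\<in>I. f i (\<lambda>i\<in>I. X i \<omega>))" using i I by (intro member_le_sum) auto
    finally show "ennreal (MAX t\<in>I. X t \<omega>) \<le> (\<Sum>i\<in>I. f i (\<lambda>i\<in>I. X i \<omega>))" .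
  qed
  also have "\<dots> = (\<integral>\<^sup>+x. (\<Sum>i\<in>I. f i x) \<partial>distr M (\<Pi>\<^sub>M i\<in>I. borel) (\<lambda>\<omega>. \<lambda>i\<in>I. X i \<omega>))"
  proof (subst nn_integral_distr)
    have "(\<lambda>x. \<Sum>i\<in>I. f i x) \<in> borel_measurable (\<Pi>\<^sub>M i\<in>I. pareto \<theta> x0)"
      by (intro borel_measurable_sum fm)
    also have "borel_measurable (\<Pi>\<^sub>M i\<in>I. pareto \<theta> x0) = borel_measurable (\<Pi>\<^sub>M i\<in>I. borel :: real measure)"
      by (intro measurable_cong_sets sets_PiM_cong) auto
    finally show "(\<lambda>x. \<Sum>i\<in>I. f i x) \<in>
        borel_measurable (distr M (\<Pi>\<^sub>M i\<in>I. borel) (\<lambda>\<omega>. \<lambda>i\<in>I. X i \<omega>))"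
      by (simp only: measurable_distr_eq1)
  qed (intro measurable_restrict, measurable)
  also have "distr M (\<Pi>\<^sub>M i\<in>I. borel) (\<lambda>\<omega>. \<lambda>i\<in>I. X i \<omega>) = (\<Pi>\<^sub>M i\<in>I. pareto \<theta> x0)"
    unfolding I_def using th by (intro iid_pareto_joint_distr[OF iid x0 _ n]) auto
  also have "(\<integral>\<^sup>+x. (\<Sum>i\<in>I. f i x) \<partial>(\<Pi>\<^sub>M i\<in>I. pareto \<theta> x0)) = (\<Sum>i\<in>I. \<integral>\<^sup>+x. f i x \<partial>(\<Pi>\<^sub>M i\<in>I. pareto \<theta> x0))"
    by (intro nn_integral_sum fm)
  also have "\<dots> = (\<Sum>i\<in>I. ennreal (x0 * Beta (1 - 1 / \<theta>) (real n)))"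
  proof (rule sum.cong[OF refl])
    fix i assume i: "i \<in> I"
    define J where "J = I - {i}"
    have J: "finite J" "i \<notin> J" "insert i J = I" using i I by (auto simp: J_def)
    have cJ: "card J = n - 1" using i I by (simp add: J_def)
    \<comment> \<open>Freezing the value \<open>y\<close> of observation \<open>i\<close> leaves a
      product of independent events, each of probability given by the distribution function at
      \<open>y\<close>.\<close>
    have "(\<integral>\<^sup>+x. f i x \<partial>(\<Pi>\<^sub>M i\<in>insert i J. pareto \<theta> x0)) =
       (\<integral>\<^sup>+y. \<integral>\<^sup>+x. f i (x(i := y)) \<partial>(\<Pi>\<^sub>M i\<in>J. pareto \<theta> x0) \<partial>pareto \<theta> x0)"
      using J fm[OF i] by (intro P.product_nn_integral_insert_rev) auto
    also have "\<dots> = (\<integral>\<^sup>+y. ennreal y * emeasure (pareto \<theta> x0) {..y} ^ (n - 1) \<partial>pareto \<theta> x0)"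
    proof (rule nn_integral_cong)
      fix y :: real
      have "(\<integral>\<^sup>+x. f i (x(i := y)) \<partial>(\<Pi>\<^sub>M i\<in>J. pareto \<theta> x0)) =
         (\<integral>\<^sup>+x. ennreal y * (\<Prod>j\<in>J. indicator {..y} (x j)) \<partial>(\<Pi>\<^sub>M i\<in>J. pareto \<theta> x0))"
        unfolding f_def J_def[symmetric] using J(2)
        by (intro nn_integral_cong arg_cong2[of _ _ _ _ "(*)"] prod.cong) (auto simp: indicator_def)
      also have "\<dots> = ennreal y * (\<integral>\<^sup>+x. (\<Prod>j\<in>J. indicator {..y} (x j)) \<partial>(\<Pi>\<^sub>M i\<in>J. pareto \<theta> x0))"
        by (intro nn_integral_cmult) measurable
      also have "(\<integral>\<^sup>+x. (\<Prod>j\<in>J. indicator {..y} (x j)) \<partial>(\<Pi>\<^sub>M i\<in>J. pareto \<theta> x0)) =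
         (\<Prod>j\<in>J. \<integral>\<^sup>+x. indicator {..y} x \<partial>pareto \<theta> x0)"
        using J by (intro P.product_nn_integral_prod) auto
      also have "\<dots> = emeasure (pareto \<theta> x0) {..y} ^ (n - 1)" by (simp add: cJ)
      finally show "(\<integral>\<^sup>+x. f i (x(i := y)) \<partial>(\<Pi>\<^sub>M i\<in>J. pareto \<theta> x0)) =
        ennreal y * emeasure (pareto \<theta> x0) {..y} ^ (n - 1)" .
    qed
    also have "\<dots> = ennreal (x0 * Beta (1 - 1 / \<theta>) (real n))" by (rule pareto_max_term) fact+
    finally show "(\<integral>\<^sup>+x. f i x \<partial>(\<Pi>\<^sub>M i\<in>I. pareto \<theta> x0)) = ennreal (x0 * Beta (1 - 1 / \<theta>) (real n))"
      by (simp add: J)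
  qed
  also have "\<dots> = ennreal (real n * (x0 * Beta (1 - 1 / \<theta>) (real n)))"
    by (simp add: I ennreal_mult' ennreal_of_nat_eq_real_of_nat)
  also have "\<dots> \<le> ennreal (x0 * Gamma (1 - 1 / \<theta>) * (real n + 1) powr (1 / \<theta>))"
  proof (rule ennreal_leI)
    have s: "0 < 1 / \<theta>" "1 / \<theta> < 1" using th by auto
    have G: "real n * Gamma (real n) = Gamma (real n + 1)"
      using n Gamma_plus1[of "real n"] by (auto simp: nonpos_Ints_def)
    have "1 - 1 / \<theta> + real n = real n + 1 - 1 / \<theta>" by simp
    hence "real n * (x0 * Beta (1 - 1 / \<theta>) (real n)) =
        x0 * Gamma (1 - 1 / \<theta>) * ((real n * Gamma (real n)) / Gamma (real n + 1 - 1 / \<theta>))"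
      by (simp only: Beta_def) (simp add: mult_ac)
    also have "\<dots> \<le> x0 * Gamma (1 - 1 / \<theta>) * (real n + 1) powr (1 / \<theta>)"
      unfolding G using x0 s by (intro mult_left_mono Gamma_ratio_le) auto
    finally show "real n * (x0 * Beta (1 - 1 / \<theta>) (real n)) \<le> \<dots>" .
  qed
  finally show ?thesis by (simp add: I_def)
qed

text \<open>\<open>opt\<close> is a Bochner integral, so finiteness of the nonnegative integral is
  first turned into integrability. Positivity holds since the maximum is almost surely at least
  \<open>x0\<close>.\<close>

lemma iid_pareto_opt_bounds:
  assumes iid: "iid_pareto M n X \<theta> x0" and x0: "x0 > 0" and th: "\<theta> > 1" and n: "n > 0"
  shows "opt M n X > 0" "opt M n X \<le> x0 * Gamma (1 - 1 / \<theta>) * (real n + 1) powr (1 / \<theta>)"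
proof -
  interpret prob_space M using iid by (simp add: iid_pareto_def)
  note [measurable] = iid_pareto_measurable[OF iid]
  have th0: "\<theta> > 0" using th by simp
  define Z where "Z = (\<lambda>\<omega>. MAX t\<in>{1..n}. X t \<omega>)"
  have [measurable]: "Z \<in> borel_measurable M" unfolding Z_def by measurable
  have "AE \<omega> in M. x0 \<le> X 1 \<omega>" using n by (intro iid_pareto_AE_ge[OF iid x0 th0]) auto
  hence ge: "AE \<omega> in M. x0 \<le> Z \<omega>"
  proof eventually_elim
    case (elim \<omega>)
    have "X 1 \<omega> \<le> Z \<omega>" unfolding Z_def using n by (intro Max_ge) auto
    thus ?case using elim by simp
  qed
  hence nonneg: "AE \<omega> in M. 0 \<le> Z \<omega>" by eventually_elim (use x0 in auto)
  have bound: "(\<integral>\<^sup>+\<omega>. ennreal (Z \<omega>) \<partial>M) \<le> ennreal (x0 * Gamma (1 - 1 / \<theta>) * (real n + 1) powr (1 / \<theta>))"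
    unfolding Z_def by (rule iid_pareto_max_le) fact+
  hence int: "integrable M Z"
    using nonneg by (intro integrableI_nonneg) (auto intro: le_less_trans)
  have "x0 = (\<integral>\<omega>. x0 \<partial>M)" by (simp add: prob_space)
  also have "\<dots> \<le> (\<integral>\<omega>. Z \<omega> \<partial>M)" using ge int by (intro integral_mono_AE) auto
  finally show "opt M n X > 0" using x0 by (simp add: opt_def Z_def)
  have "ennreal (\<integral>\<omega>. Z \<omega> \<partial>M) \<le> ennreal (x0 * Gamma (1 - 1 / \<theta>) * (real n + 1) powr (1 / \<theta>))"
    using bound nn_integral_eq_integral[OF int nonneg] by simp
  moreover have "x0 * Gamma (1 - 1 / \<theta>) * (real n + 1) powr (1 / \<theta>) \<ge> 0"
    using x0 th by (intro mult_nonneg_nonneg Gamma_real_nonneg) auto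
  ultimately show "opt M n X \<le> x0 * Gamma (1 - 1 / \<theta>) * (real n + 1) powr (1 / \<theta>)"
    by (simp add: opt_def Z_def)
qed

section \<open>The expected reward of the policy\<close>

text \<open>The stopping time when \<open>k + 1\<close> observations remain and \<open>B j\<close> says that observation
  \<open>n - Suc j\<close>, which leaves \<open>j + 1\<close> observations, is accepted.\<close>

primrec stop_from :: "nat \<Rightarrow> (nat \<Rightarrow> bool) \<Rightarrow> nat \<Rightarrow> nat" where
  "stop_from n B 0 = n"
| "stop_from n B (Suc k) = (if B k then n - Suc k else stop_from n B k)"

lemma stop_from_cong:
  assumes "\<And>j. j < k \<Longrightarrow> B j = B' j"
  shows "stop_from n B k = stop_from n B' k"
  using assms by (induction k) auto

lemma stop_from_range:
  assumes "k < n"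
  shows "stop_from n B k \<in> {n - k..n}"
  using assms by (induction k) auto

text \<open>Reconciles two indexings: the recursion counts remaining observations, the algorithm
  counts forward, and \<open>t\<close> corresponds to \<open>N - Suc t\<close>. Passing to
  \<open>Suc k\<close> puts one earlier index in front, which is the minimum if accepted.\<close>

lemma stop_from_eq_Min:
  assumes "k < N" "N \<le> n"
  shows "stop_from n B k = (let A = {t \<in> {N - k..N - 1}. B (N - Suc t)} in
    if A = {} then n else (n - N) + Min A)"
  using assms
proof (induction k)
  case (Suc k)
  define A where "A k = {t \<in> {N - k..N - 1}. B (N - Suc t)}" for k
  have "N - k = Suc (N - Suc k)" "N - Suc k \<le> N - 1" using Suc.prems by linarith+
  hence split: "{N - Suc k..N - 1} = insert (N - Suc k) {N - k..N - 1}"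
    by (simp only: atLeastAtMost_insertL)
  have fin: "finite (A k)" by (simp add: A_def)
  have ge: "N - Suc k \<le> t" if "t \<in> A k" for t using that by (simp add: A_def) linarith
  have idx: "N - Suc (N - Suc k) = k" using Suc.prems by simp
  show ?case
  proof (cases "B k")
    case True
    hence "A (Suc k) = insert (N - Suc k) (A k)" unfolding A_def split using idx by auto
    moreover have "Min (insert (N - Suc k) (A k)) = N - Suc k"
      using fin ge by (intro Min_eqI) auto
    ultimately show ?thesis using True Suc.prems unfolding A_def[symmetric] Let_def by simp
  next
    case False
    hence "A (Suc k) = A k" unfolding A_def split using idx by auto
    moreover have "stop_from n B k = (if A k = {} then n else (n - N) + Min (A k))"
      using Suc unfolding A_def[symmetric] Let_def by simp
    ultimately show ?thesis using False unfolding A_def[symmetric] Let_def by simp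
  qed
qed (auto simp: Let_def)

text \<open>In this form, once \<open>theta_U\<close> is held fixed, each acceptance test looks at
  its own observation only, as the stage by stage integration needs.\<close>

lemma cdp_ol_eq_stop_from:
  assumes "m < n"
  shows "cdp_ol n m \<delta> x0 x =
    stop_from n (\<lambda>k. V_hat (theta_U m \<delta> x0 x) x0 (n - m) (n - m - k) \<le> ereal (x (n - Suc k))) (n - m - 1)"
proof -
  define N where "N = n - m"
  have idx: "(V_hat (theta_U m \<delta> x0 x) x0 N (N - (N - Suc t)) \<le> ereal (x (n - Suc (N - Suc t)))) \<longleftrightarrow>
      V_hat (theta_U m \<delta> x0 x) x0 N (t + 1) \<le> ereal (x (m + t))" if "t \<in> {1..N - 1}" for t
  proof -
    have "N - (N - Suc t) = t + 1" "n - Suc (N - Suc t) = m + t" using that assms by (auto simp: N_def)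
    thus ?thesis by simp
  qed
  have "n - N = m" "N - (N - 1) = 1" "N - 1 < N" "N \<le> n" using assms by (auto simp: N_def)
  hence "stop_from n (\<lambda>k. V_hat (theta_U m \<delta> x0 x) x0 N (N - k) \<le> ereal (x (n - Suc k))) (N - 1) =
     (let A = {t \<in> {1..N - 1}. V_hat (theta_U m \<delta> x0 x) x0 N (N - (N - Suc t)) \<le> ereal (x (n - Suc (N - Suc t)))}
      in if A = {} then n else m + Min A)"
    by (simp only: stop_from_eq_Min)
  also have "{t \<in> {1..N - 1}. V_hat (theta_U m \<delta> x0 x) x0 N (N - (N - Suc t)) \<le> ereal (x (n - Suc (N - Suc t)))} =
     {t \<in> {1..N - 1}. V_hat (theta_U m \<delta> x0 x) x0 N (t + 1) \<le> ereal (x (m + t))}"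
    using idx by blast
  finally show ?thesis unfolding cdp_ol_def N_def[symmetric] by (simp only: Let_def)
qed

text \<open>Backward induction by Fubini: the earliest remaining observation is integrated last, and
  given its value the reward is either that value or that of the shorter problem. The threshold step
  then reproduces the recursion of \<open>policy_value\<close>.\<close>

lemma nn_integral_stop_from:
  assumes th: "\<theta> > 1" "\<theta>' > 1" and x0: "x0 > 0" and k: "k < n"
  defines "B \<equiv> \<lambda>(x :: nat \<Rightarrow> real) j. x0 * dp_value \<theta>' 1 j \<le> x (n - Suc j)"
  shows "(\<integral>\<^sup>+x. ennreal (x (stop_from n (B x) k)) \<partial>(\<Pi>\<^sub>M i\<in>{n - k..n}. pareto \<theta> x0)) =
    ennreal (x0 * policy_value \<theta> \<theta>' k)"
  using k
proof (induction k)
  case 0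
  interpret P: product_prob_space "\<lambda>_::nat. pareto \<theta> x0" UNIV
    by (rule product_prob_spaceI) (rule prob_space_pareto)
  have "(\<integral>\<^sup>+x. ennreal (x n) \<partial>(\<Pi>\<^sub>M i\<in>{n}. pareto \<theta> x0)) = (\<integral>\<^sup>+x. ennreal x \<partial>pareto \<theta> x0)"
    by (subst P.product_nn_integral_singleton) auto
  thus ?case using x0 th by (simp add: pareto_mean mult.commute)
next
  case (Suc k)
  interpret P: product_prob_space "\<lambda>_::nat. pareto \<theta> x0" UNIV
    by (rule product_prob_spaceI) (rule prob_space_pareto)
  define i where "i = n - Suc k"
  define J where "J = {n - k..n}"
  interpret J: prob_space "\<Pi>\<^sub>M i\<in>J. pareto \<theta> x0"
    by (intro prob_space_PiM prob_space_pareto)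
  have J: "finite J" "i \<notin> J" "insert i J = {n - Suc k..n}"
  proof -
    have "Suc (n - Suc k) = n - k" "n - Suc k \<le> n" using Suc.prems by linarith+
    thus "insert i J = {n - Suc k..n}" unfolding i_def J_def by (metis atLeastAtMost_insertL)
  qed (use Suc.prems in \<open>simp_all add: J_def i_def\<close>)
  \<comment> \<open>A coordinate at a random index is not measurable by composition alone; unfolding
    \<open>stop_from\<close> turns it into nested conditionals on fixed coordinates.\<close>
  have meas: "(\<lambda>x. ennreal (x (stop_from n (B x) j))) \<in> borel_measurable (\<Pi>\<^sub>M i\<in>{n - Suc k..n}. pareto \<theta> x0)"
    if "j \<le> Suc k" for j
    using that
  proof (induction j)
    case (Suc j)
    have "n - Suc j \<in> {n - Suc k..n}" using Suc.prems by auto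
    hence [measurable]: "(\<lambda>x. x (n - Suc j)) \<in> borel_measurable (\<Pi>\<^sub>M i\<in>{n - Suc k..n}. pareto \<theta> x0)"
      by measurable
    have [measurable]: "(\<lambda>x. ennreal (x (stop_from n (B x) j))) \<in> borel_measurable (\<Pi>\<^sub>M i\<in>{n - Suc k..n}. pareto \<theta> x0)"
      using Suc by simp
    have "(\<lambda>x. if x0 * dp_value \<theta>' 1 j \<le> x (n - Suc j) then ennreal (x (n - Suc j))
        else ennreal (x (stop_from n (B x) j))) \<in> borel_measurable (\<Pi>\<^sub>M i\<in>{n - Suc k..n}. pareto \<theta> x0)"
      by measurable
    also have "(\<lambda>x. if x0 * dp_value \<theta>' 1 j \<le> x (n - Suc j) then ennreal (x (n - Suc j))
        else ennreal (x (stop_from n (B x) j))) = (\<lambda>x. ennreal (x (stop_from n (B x) (Suc j))))"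
      by (auto simp: fun_eq_iff B_def)
    finally show ?case .
  qed simp
  have "(\<integral>\<^sup>+x. ennreal (x (stop_from n (B x) (Suc k))) \<partial>(\<Pi>\<^sub>M i\<in>insert i J. pareto \<theta> x0)) =
     (\<integral>\<^sup>+y. \<integral>\<^sup>+x. ennreal ((x(i := y)) (stop_from n (B (x(i := y))) (Suc k))) \<partial>(\<Pi>\<^sub>M i\<in>J. pareto \<theta> x0) \<partial>pareto \<theta> x0)"
    by (rule P.product_nn_integral_insert_rev[OF J(1,2)]) (use meas[of "Suc k"] in \<open>simp only: J(3) order_refl\<close>)
  also have "\<dots> = (\<integral>\<^sup>+y. (if x0 * dp_value \<theta>' 1 k \<le> y then ennreal y else ennreal (x0 * policy_value \<theta> \<theta>' k)) \<partial>pareto \<theta> x0)"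
  proof (rule nn_integral_cong)
    fix y :: real
    \<comment> \<open>Changing coordinate \<open>i\<close> affects neither the later tests nor the
      later reward, since the shorter problem never stops at \<open>i\<close>.\<close>
    have "(x(i := y)) (stop_from n (B (x(i := y))) (Suc k)) =
        (if x0 * dp_value \<theta>' 1 k \<le> y then y else x (stop_from n (B x) k))" for x :: "nat \<Rightarrow> real"
    proof -
      have "stop_from n (B (x(i := y))) k = stop_from n (B x) k"
        by (rule stop_from_cong) (use Suc.prems in \<open>auto simp: B_def i_def\<close>)
      moreover have "stop_from n (B x) k \<noteq> i"
        using stop_from_range[of k n "B x"] Suc.prems by (auto simp: i_def)
      ultimately show ?thesis by (simp add: B_def i_def)
    qed
    hence "(\<integral>\<^sup>+x. ennreal ((x(i := y)) (stop_from n (B (x(i := y))) (Suc k))) \<partial>(\<Pi>\<^sub>M i\<in>J. pareto \<theta> x0)) =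
       (\<integral>\<^sup>+x. ennreal (if x0 * dp_value \<theta>' 1 k \<le> y then y else x (stop_from n (B x) k)) \<partial>(\<Pi>\<^sub>M i\<in>J. pareto \<theta> x0))"
      by simp
    also have "\<dots> = (if x0 * dp_value \<theta>' 1 k \<le> y then ennreal y else ennreal (x0 * policy_value \<theta> \<theta>' k))"
      using Suc by (cases "x0 * dp_value \<theta>' 1 k \<le> y") (auto simp: J_def[symmetric] J.emeasure_space_1)
    finally show "(\<integral>\<^sup>+x. ennreal ((x(i := y)) (stop_from n (B (x(i := y))) (Suc k))) \<partial>(\<Pi>\<^sub>M i\<in>J. pareto \<theta> x0)) = \<dots>" .
  qed
  also have "\<dots> = ennreal (x0 * policy_value \<theta> \<theta>' (Suc k))"
    using pareto_threshold_step[of x0 \<theta> "dp_value \<theta>' 1 k" "policy_value \<theta> \<theta>' k"]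
      x0 th dp_value_ge_1[of \<theta>' k] policy_value_nonneg[of \<theta> \<theta>' k] by simp
  finally show ?case by (simp only: J)
qed

section \<open>Measurability and conditioning on the exploration phase\<close>

lemma borel_measurable_dp_value [measurable]:
  "(\<lambda>\<theta>. dp_value \<theta> x0 k) \<in> borel_measurable borel"
  by (induction k) simp_all

lemma borel_measurable_V_hat [measurable]:
  "(\<lambda>\<theta>. V_hat \<theta> x0 N i) \<in> borel_measurable borel"
  unfolding V_hat_def by measurable

lemma theta_U_cong:
  assumes "\<And>i. i \<in> {1..m} \<Longrightarrow> x i = y i"
  shows "theta_U m \<delta> x0 x = theta_U m \<delta> x0 y"
proof -
  have "(\<Sum>i=1..m. ln (x i / x0)) = (\<Sum>i=1..m. ln (y i / x0))" using assms by (intro sum.cong) auto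
  thus ?thesis by (simp add: theta_U_def theta_hat_def)
qed

lemma theta_U_measurable:
  assumes "m \<le> n"
  shows "theta_U m \<delta> x0 \<in> borel_measurable (\<Pi>\<^sub>M i\<in>{1..n}. borel)"
proof -
  have [measurable]: "(\<lambda>x. x i) \<in> borel_measurable (\<Pi>\<^sub>M i\<in>{1..n}. borel :: real measure)" if "i \<in> {1..m}" for i
    using that assms by (intro measurable_component_singleton) auto
  show ?thesis unfolding theta_U_def theta_hat_def by measurable
qed

lemma cdp_ol_measurable:
  assumes "m < n"
  shows "cdp_ol n m \<delta> x0 \<in> (\<Pi>\<^sub>M i\<in>{1..n}. borel) \<rightarrow>\<^sub>M count_space UNIV"
proof -
  have U: "theta_U m \<delta> x0 \<in> borel_measurable (\<Pi>\<^sub>M i\<in>{1..n}. borel)"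
    using assms by (intro theta_U_measurable) auto
  note V = measurable_compose[OF U borel_measurable_V_hat]
  define B where "B = (\<lambda>x k. V_hat (theta_U m \<delta> x0 x) x0 (n - m) (n - m - k) \<le> ereal (x (n - Suc k)))"
  have "(\<lambda>x. stop_from n (B x) k) \<in> (\<Pi>\<^sub>M i\<in>{1..n}. borel) \<rightarrow>\<^sub>M count_space UNIV" if "k < n" for k
    using that
  proof (induction k)
    case (Suc k)
    have "n - Suc k \<in> {1..n}" using Suc.prems by auto
    hence [measurable]: "(\<lambda>x. x (n - Suc k)) \<in> borel_measurable (\<Pi>\<^sub>M i\<in>{1..n}. borel :: real measure)"
      by (rule measurable_component_singleton)
    have [measurable]: "Measurable.pred (\<Pi>\<^sub>M i\<in>{1..n}. borel) (\<lambda>x. B x k)"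
      unfolding B_def pred_def by (intro borel_measurable_le V) measurable
    have [measurable]: "(\<lambda>x. stop_from n (B x) k) \<in> (\<Pi>\<^sub>M i\<in>{1..n}. borel) \<rightarrow>\<^sub>M count_space UNIV"
      using Suc by simp
    show ?case unfolding stop_from.simps by measurable
  qed simp
  hence "(\<lambda>x. stop_from n (B x) (n - m - 1)) \<in> (\<Pi>\<^sub>M i\<in>{1..n}. borel) \<rightarrow>\<^sub>M count_space UNIV"
    using assms by simp
  thus ?thesis using assms unfolding B_def
    by (simp add: cdp_ol_eq_stop_from[OF assms, abs_def])
qed

lemma cdp_ol_range:
  assumes "m < n"
  shows "cdp_ol n m \<delta> x0 x \<in> {1..n}"
proof -
  have "n - m - 1 < n" "1 \<le> n - (n - m - 1)" using assms by linarith+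
  hence "stop_from n B (n - m - 1) \<in> {1..n}" for B
    using stop_from_range[of "n - m - 1" n B] by auto
  thus ?thesis unfolding cdp_ol_eq_stop_from[OF assms] by blast
qed

lemma cdp_ol_cong:
  assumes "m < n" "\<And>i. i \<in> {1..n} \<Longrightarrow> x i = y i"
  shows "cdp_ol n m \<delta> x0 x = cdp_ol n m \<delta> x0 y"
proof -
  define s where "s = cdp_ol n m \<delta> x0 x"
  have "s \<le> n" using cdp_ol_range[OF assms(1), of \<delta> x0 x] by (simp add: s_def)
  hence "cdp_ol n m \<delta> x0 y = s"
    using assms by (intro cdp_ol_nonanticipating[of m n s x y]) (auto simp: s_def)
  thus ?thesis by (simp add: s_def)
qed

lemma cdp_ol_reward_measurable:
  assumes "m < n"
  shows "(\<lambda>x. x (cdp_ol n m \<delta> x0 x)) \<in> borel_measurable (\<Pi>\<^sub>M i\<in>{1..n}. (borel :: real measure))"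
proof -
  note [measurable] = cdp_ol_measurable[OF assms, of \<delta> x0]
  have [measurable]: "(\<lambda>x. x i) \<in> borel_measurable (\<Pi>\<^sub>M i\<in>{1..n}. borel :: real measure)" if "i \<in> {1..n}" for i
    using that by (rule measurable_component_singleton)
  \<comment> \<open>Splitting over the finitely many values of the stopping time removes the random
    index.\<close>
  have "(\<lambda>x. \<Sum>t\<in>{1..n}. if cdp_ol n m \<delta> x0 x = t then x t else 0) \<in> borel_measurable (\<Pi>\<^sub>M i\<in>{1..n}. borel :: real measure)"
    by measurable
  also have "(\<lambda>x. \<Sum>t\<in>{1..n}. if cdp_ol n m \<delta> x0 x = t then x t else 0) = (\<lambda>x. x (cdp_ol n m \<delta> x0 x))"
    using cdp_ol_range[OF assms] by (auto simp: fun_eq_iff sum.delta)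
  finally show ?thesis .
qed

text \<open>\<open>theta_U\<close> depends on the exploration block only. Conditioning on that block
  leaves a policy with fixed thresholds on fresh observations, worth
  \<open>x0 * policy_value\<close> for the estimated shape; rewards outside \<open>G\<close> are
  bounded below by \<open>0\<close>.\<close>

lemma cdp_ol_reward_PiM_lower:
  assumes th: "\<theta> > 1" and x0: "x0 > 0" and mn: "m < n"
    and G: "G \<in> sets borel" "\<And>\<theta>'. \<theta>' \<in> G \<Longrightarrow> \<theta>' > 1"
    and w: "\<And>\<theta>'. \<theta>' \<in> G \<Longrightarrow> policy_value \<theta> \<theta>' (n - m - 1) \<ge> w"
  defines "P \<equiv> \<Pi>\<^sub>M i\<in>{1..n}. pareto \<theta> x0"
  shows "ennreal (x0 * w) * emeasure P {x \<in> space P. theta_U m \<delta> x0 x \<in> G} \<le>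
    (\<integral>\<^sup>+x. ennreal (x (cdp_ol n m \<delta> x0 x)) \<partial>P)"
proof -
  interpret P: product_prob_space "\<lambda>_::nat. pareto \<theta> x0" UNIV
    by (rule product_prob_spaceI) (rule prob_space_pareto)
  define I where "I = {1..m}"
  define J where "J = {Suc m..n}"
  define U where "U = theta_U m \<delta> x0"
  define k where "k = n - m - 1"
  have IJ: "I \<inter> J = {}" "finite I" "finite J" "I \<union> J = {1..n}" using mn by (auto simp: I_def J_def)
  interpret J: prob_space "\<Pi>\<^sub>M i\<in>J. pareto \<theta> x0"
    by (intro prob_space_PiM prob_space_pareto)
  have sets_eq: "borel_measurable P = borel_measurable (\<Pi>\<^sub>M i\<in>{1..n}. borel :: real measure)"
    unfolding P_def by (intro measurable_cong_sets sets_PiM_cong) auto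
  have [measurable]: "U \<in> borel_measurable P"
    unfolding sets_eq U_def using mn by (intro theta_U_measurable) auto
  have [measurable]: "(\<lambda>x. x (cdp_ol n m \<delta> x0 x)) \<in> borel_measurable P"
    unfolding sets_eq by (rule cdp_ol_reward_measurable[OF mn])
  note [measurable] = G(1)
  define f where "f = (\<lambda>x. indicator G (U x) * ennreal (x (cdp_ol n m \<delta> x0 x)))"
  have fold: "(\<integral>\<^sup>+x. g x \<partial>P) = (\<integral>\<^sup>+x. \<integral>\<^sup>+y. g (merge I J (x, y)) \<partial>(\<Pi>\<^sub>M i\<in>J. pareto \<theta> x0) \<partial>(\<Pi>\<^sub>M i\<in>I. pareto \<theta> x0))"
    if "g \<in> borel_measurable P" for g
    using P.product_nn_integral_fold[OF IJ(1-3), of g] that by (simp only: IJ(4) P_def)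
  have Um: "U (merge I J (x, y)) = U x" for x y
    unfolding U_def by (rule theta_U_cong) (auto simp: merge_def I_def)
  have "ennreal (x0 * w) * emeasure P {x \<in> space P. U x \<in> G} =
      (\<integral>\<^sup>+x. ennreal (x0 * w) * indicator G (U x) \<partial>P)"
  proof -
    have "(\<integral>\<^sup>+x. ennreal (x0 * w) * indicator G (U x) \<partial>P) =
        (\<integral>\<^sup>+x. ennreal (x0 * w) * indicator {x \<in> space P. U x \<in> G} x \<partial>P)"
      by (intro nn_integral_cong) (auto simp: indicator_def)
    thus ?thesis by (simp add: nn_integral_cmult)
  qed
  also have "\<dots> = (\<integral>\<^sup>+x. \<integral>\<^sup>+y. ennreal (x0 * w) * indicator G (U (merge I J (x, y))) \<partial>(\<Pi>\<^sub>M i\<in>J. pareto \<theta> x0) \<partial>(\<Pi>\<^sub>M i\<in>I. pareto \<theta> x0))"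
    by (rule fold) measurable
  also have "\<dots> = (\<integral>\<^sup>+x. ennreal (x0 * w) * indicator G (U x) \<partial>(\<Pi>\<^sub>M i\<in>I. pareto \<theta> x0))"
    by (simp add: Um J.emeasure_space_1)
  also have "\<dots> \<le> (\<integral>\<^sup>+x. \<integral>\<^sup>+y. f (merge I J (x, y)) \<partial>(\<Pi>\<^sub>M i\<in>J. pareto \<theta> x0) \<partial>(\<Pi>\<^sub>M i\<in>I. pareto \<theta> x0))"
  proof (rule nn_integral_mono)
    fix x :: "nat \<Rightarrow> real"
    show "ennreal (x0 * w) * indicator G (U x) \<le> (\<integral>\<^sup>+y. f (merge I J (x, y)) \<partial>(\<Pi>\<^sub>M i\<in>J. pareto \<theta> x0))"
    proof (cases "U x \<in> G")
      case True
      define \<theta>' where "\<theta>' = U x"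
      have th': "\<theta>' > 1" "\<theta>' \<in> G" using True G(2) by (auto simp: \<theta>'_def)
      define B where "B = (\<lambda>(x :: nat \<Rightarrow> real) j. x0 * dp_value \<theta>' 1 j \<le> x (n - Suc j))"
      have Jk: "J = {n - k..n}" using mn by (auto simp: J_def k_def)
      have "f (merge I J (x, y)) = ennreal (y (stop_from n (B y) k))" for y
      proof -
        define z where "z = merge I J (x, y)"
        have zy: "z i = y i" if "i \<in> {n - k..n}" for i
          using that IJ(1) by (auto simp: z_def merge_def Jk)
        have Uz: "theta_U m \<delta> x0 z = \<theta>'" using Um[of x y] by (simp add: z_def \<theta>'_def U_def)
        have "cdp_ol n m \<delta> x0 z = stop_from n (B z) k"
          unfolding cdp_ol_eq_stop_from[OF mn] Uz k_def[symmetric]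
        proof (rule stop_from_cong)
          fix j assume "j < k"
          hence "n - m - (n - m - j) = j" by (simp add: k_def)
          thus "(V_hat \<theta>' x0 (n - m) (n - m - j) \<le> ereal (z (n - Suc j))) = B z j"
            using th' dp_value_scale[OF x0, of \<theta>' j] by (simp add: V_hat_def B_def)
        qed
        also have "\<dots> = stop_from n (B y) k"
          by (rule stop_from_cong) (auto simp: B_def zy)
        finally have "cdp_ol n m \<delta> x0 z = stop_from n (B y) k" .
        moreover have "stop_from n (B y) k \<in> {n - k..n}" using mn by (intro stop_from_range) (simp add: k_def)
        ultimately show ?thesis using True by (simp add: f_def z_def[symmetric] zy Um)
           (simp add: z_def Um True)
      qed
      hence "(\<integral>\<^sup>+y. f (merge I J (x, y)) \<partial>(\<Pi>\<^sub>M i\<in>J. pareto \<theta> x0)) = ennreal (x0 * policy_value \<theta> \<theta>' k)"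
        using nn_integral_stop_from[OF th th'(1) x0, of k n] mn unfolding Jk B_def
        by (simp add: k_def)
      moreover have "x0 * w \<le> x0 * policy_value \<theta> \<theta>' k"
        using w[OF th'(2)] x0 by (intro mult_left_mono) (auto simp: k_def)
      ultimately show ?thesis using True by (simp add: ennreal_leI)
    qed auto
  qed
  also have "\<dots> = (\<integral>\<^sup>+x. f x \<partial>P)" unfolding f_def by (rule fold[symmetric]) measurable
  also have "\<dots> \<le> (\<integral>\<^sup>+x. ennreal (x (cdp_ol n m \<delta> x0 x)) \<partial>P)"
    by (intro nn_integral_mono) (auto simp: f_def indicator_def)
  finally show ?thesis by (simp add: U_def)
qed

text \<open>Transfers the product space bound to the given sample space. The Bochner integral calls
  for integrability of the stopped reward, which is dominated by the sum of all absolute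
  rewards.\<close>

lemma cdp_ol_expected_reward_lower:
  assumes iid: "iid_pareto M n X \<theta> x0" and th: "\<theta> > 1" and x0: "x0 > 0" and mn: "m < n"
    and G: "G \<in> sets borel" "\<And>\<theta>'. \<theta>' \<in> G \<Longrightarrow> \<theta>' > 1"
    and w0: "w \<ge> 0" and w: "\<And>\<theta>'. \<theta>' \<in> G \<Longrightarrow> policy_value \<theta> \<theta>' (n - m - 1) \<ge> w"
  shows "x0 * w * measure M {\<omega> \<in> space M. theta_U m \<delta> x0 (\<lambda>t. X t \<omega>) \<in> G} \<le>
    (\<integral>\<omega>. X (cdp_ol n m \<delta> x0 (\<lambda>t. X t \<omega>)) \<omega> \<partial>M)"
proof -
  interpret prob_space M using iid by (simp add: iid_pareto_def)
  note [measurable] = iid_pareto_measurable[OF iid]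
  have th0: "\<theta> > 0" using th by simp
  define B where "B = (\<Pi>\<^sub>M i\<in>{1..n}. borel :: real measure)"
  define P where "P = (\<Pi>\<^sub>M i\<in>{1..n}. pareto \<theta> x0)"
  define T where "T = (\<lambda>\<omega>. \<lambda>i\<in>{1..n}. X i \<omega>)"
  define R where "R = (\<lambda>x. x (cdp_ol n m \<delta> x0 x))"
  have [measurable]: "T \<in> M \<rightarrow>\<^sub>M B" unfolding T_def B_def by (intro measurable_restrict) auto
  have [measurable]: "R \<in> borel_measurable B" unfolding R_def B_def by (rule cdp_ol_reward_measurable[OF mn])
  have [measurable]: "theta_U m \<delta> x0 \<in> borel_measurable B"
    unfolding B_def using mn by (intro theta_U_measurable) auto
  note [measurable] = G(1)
  have distr: "distr M B T = P"
    unfolding B_def T_def P_def using mn by (intro iid_pareto_joint_distr[OF iid x0 th0]) auto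
  have RT: "X (cdp_ol n m \<delta> x0 (\<lambda>t. X t \<omega>)) \<omega> = R (T \<omega>)" for \<omega>
  proof -
    have "cdp_ol n m \<delta> x0 (\<lambda>t. X t \<omega>) = cdp_ol n m \<delta> x0 (T \<omega>)"
      by (rule cdp_ol_cong[OF mn]) (simp add: T_def)
    moreover have "T \<omega> s = X s \<omega>" if "s \<in> {1..n}" for s using that by (simp add: T_def)
    ultimately show ?thesis using cdp_ol_range[OF mn, of \<delta> x0 "T \<omega>"] unfolding R_def by metis
  qed
  have UT: "theta_U m \<delta> x0 (\<lambda>t. X t \<omega>) = theta_U m \<delta> x0 (T \<omega>)" for \<omega>
    by (rule theta_U_cong) (use mn in \<open>simp add: T_def\<close>)
  have "integrable M (\<lambda>\<omega>. R (T \<omega>))"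
  proof (rule Bochner_Integration.integrable_bound)
    show "integrable M (\<lambda>\<omega>. \<Sum>t\<in>{1..n}. \<bar>X t \<omega>\<bar>)"
      by (intro Bochner_Integration.integrable_sum integrable_abs iid_pareto_integrable[OF iid x0 th])
    show "AE \<omega> in M. norm (R (T \<omega>)) \<le> norm (\<Sum>t\<in>{1..n}. \<bar>X t \<omega>\<bar>)"
    proof (rule AE_I2)
      fix \<omega>
      define s where "s = cdp_ol n m \<delta> x0 (\<lambda>t. X t \<omega>)"
      have "s \<in> {1..n}" using cdp_ol_range[OF mn] by (simp add: s_def)
      hence "\<bar>X s \<omega>\<bar> \<le> (\<Sum>t\<in>{1..n}. \<bar>X t \<omega>\<bar>)" by (intro member_le_sum) auto
      thus "norm (R (T \<omega>)) \<le> norm (\<Sum>t\<in>{1..n}. \<bar>X t \<omega>\<bar>)"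
        using RT[of \<omega>] by (simp add: s_def sum_nonneg)
    qed
  qed measurable
  moreover have nonneg: "AE \<omega> in M. 0 \<le> R (T \<omega>)"
  proof -
    have "AE \<omega> in M. \<forall>t\<in>{1..n}. x0 \<le> X t \<omega>"
      by (intro AE_finite_allI iid_pareto_AE_ge[OF iid x0 th0]) auto
    thus ?thesis
    proof eventually_elim
      case (elim \<omega>)
      have "x0 \<le> X (cdp_ol n m \<delta> x0 (\<lambda>t. X t \<omega>)) \<omega>" using elim cdp_ol_range[OF mn] by blast
      thus ?case using RT[of \<omega>] x0 by simp
    qed
  qed
  ultimately have "ennreal (\<integral>\<omega>. R (T \<omega>) \<partial>M) = (\<integral>\<^sup>+\<omega>. ennreal (R (T \<omega>)) \<partial>M)"
    by (rule nn_integral_eq_integral[symmetric])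
  also have "\<dots> = (\<integral>\<^sup>+x. ennreal (R x) \<partial>distr M B T)" by (subst nn_integral_distr) auto
  also have "\<dots> \<ge> ennreal (x0 * w) * emeasure (distr M B T) {x \<in> space (distr M B T). theta_U m \<delta> x0 x \<in> G}"
    unfolding distr P_def R_def by (rule cdp_ol_reward_PiM_lower[OF th x0 mn G w])
  also have "emeasure (distr M B T) {x \<in> space (distr M B T). theta_U m \<delta> x0 x \<in> G} =
      emeasure M {\<omega> \<in> space M. theta_U m \<delta> x0 (T \<omega>) \<in> G}"
    by (subst emeasure_distr) (auto intro!: arg_cong2[where f=emeasure] dest: measurable_space[OF \<open>T \<in> M \<rightarrow>\<^sub>M B\<close>])
  also have "ennreal (x0 * w) * \<dots> = ennreal (x0 * w * measure M {\<omega> \<in> space M. theta_U m \<delta> x0 (T \<omega>) \<in> G})"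
    using x0 w0 by (simp add: emeasure_eq_measure ennreal_mult')
  finally show ?thesis
    using integral_nonneg_AE[OF nonneg] by (simp add: RT UT)
qed

section \<open>The competitive ratio\<close>

text \<open>Dividing the reward bound by the bound on \<open>opt\<close> leaves
  \<open>rho1 \<theta>\<close> times \<open>(N / (n + 1)) powr (1 / \<theta>)\<close>. The set
  \<open>G\<close> of good estimates, its probability bound \<open>p\<close> and the loss
  \<open>e\<close> are left open to serve both regimes.\<close>

lemma competitive_ratio_lower:
  assumes iid: "iid_pareto M n X \<theta> x0" and th: "\<theta> > 1" and x0: "x0 > 0" and mn: "1 \<le> m" "m < n"
    and G: "G \<in> sets borel" "\<And>\<theta>'. \<theta>' \<in> G \<Longrightarrow> \<theta>' > 1"
    and e: "e \<le> 1"
    and w: "\<And>\<theta>'. \<theta>' \<in> G \<Longrightarrow>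
      policy_value \<theta> \<theta>' (n - m - 1) \<ge> (\<theta> / (\<theta> - 1) * real (n - m)) powr (1 / \<theta>) * (1 - e)"
    and p: "0 \<le> p" "p \<le> measure M {\<omega> \<in> space M. theta_U m \<delta> x0 (\<lambda>t. X t \<omega>) \<in> G}"
  shows "competitive_ratio M n X (\<lambda>\<omega>. cdp_ol n m \<delta> x0 (\<lambda>t. X t \<omega>)) \<ge>
    rho1 \<theta> * (1 - 2 * (real m / real n)) * (1 - e) * p"
proof -
  define s where "s = 1 / \<theta>"
  define \<kappa> where "\<kappa> = \<theta> / (\<theta> - 1)"
  define N where "N = real (n - m)"
  define \<Gamma> where "\<Gamma> = Gamma (1 - s)"
  define v where "v = (\<kappa> * N) powr s * (1 - e)"
  have s: "0 < s" "s < 1" using th by (auto simp: s_def)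
  have \<kappa>: "\<kappa> \<ge> 1" using th by (simp add: \<kappa>_def)
  have N: "N \<ge> 1" "N \<le> real n" "N = real n - real m" using mn by (auto simp: N_def of_nat_diff)
  have \<Gamma>: "\<Gamma> > 0" unfolding \<Gamma>_def using s by (intro Gamma_real_pos) auto
  have v: "v \<ge> 0" using e by (simp add: v_def)
  have rho: "rho1 \<theta> = \<kappa> powr s / \<Gamma>" by (simp add: rho1_def \<kappa>_def s_def \<Gamma>_def)
  have opt: "opt M n X > 0" "opt M n X \<le> x0 * \<Gamma> * (real n + 1) powr s"
    using iid_pareto_opt_bounds[OF iid x0 th] mn by (auto simp: \<Gamma>_def s_def)
  have "x0 * v * p \<le> x0 * v * measure M {\<omega> \<in> space M. theta_U m \<delta> x0 (\<lambda>t. X t \<omega>) \<in> G}"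
    using p x0 v by (intro mult_left_mono) auto
  also have "\<dots> \<le> (\<integral>\<omega>. X (cdp_ol n m \<delta> x0 (\<lambda>t. X t \<omega>)) \<omega> \<partial>M)"
    using w v by (intro cdp_ol_expected_reward_lower[OF iid th x0 mn(2) G]) (auto simp: v_def \<kappa>_def N_def s_def)
  finally have rew: "x0 * v * p \<le> (\<integral>\<omega>. X (cdp_ol n m \<delta> x0 (\<lambda>t. X t \<omega>)) \<omega> \<partial>M)" .
  \<comment> \<open>A base at most \<open>1\<close> only grows when its exponent drops from
    \<open>1\<close> to \<open>s\<close>, and \<open>1 - N / (n + 1) = (m + 1) / (n + 1)\<close> is
    at most \<open>2 * m / n\<close>.\<close>
  have ratio: "1 - 2 * (real m / real n) \<le> (N / (real n + 1)) powr s"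
  proof -
    have "1 * real n \<le> real m * real n" using mn by (intro mult_right_mono) auto
    moreover have "(real m + 1) * real n = real m * real n + real n"
      "2 * real m * (real n + 1) = 2 * (real m * real n) + 2 * real m" by (simp_all add: algebra_simps)
    ultimately have "(real m + 1) * real n \<le> 2 * real m * (real n + 1)" by linarith
    hence "(real m + 1) / (real n + 1) \<le> 2 * real m / real n" using mn by (simp add: field_simps)
    hence "1 - 2 * (real m / real n) \<le> 1 - (real m + 1) / (real n + 1)" by simp
    also have "\<dots> = (N / (real n + 1)) powr 1" using N by (simp add: field_simps)
    also have "\<dots> \<le> (N / (real n + 1)) powr s" using N s by (intro powr_mono') auto
    finally show ?thesis .
  qed
  have "rho1 \<theta> * (1 - 2 * (real m / real n)) * (1 - e) * p \<le>
      rho1 \<theta> * (N / (real n + 1)) powr s * (1 - e) * p"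
    using ratio e p \<Gamma> by (intro mult_right_mono mult_left_mono) (auto simp: rho)
  also have "\<dots> = x0 * v * p / (x0 * \<Gamma> * (real n + 1) powr s)"
    using N \<kappa> x0 \<Gamma> by (simp add: rho v_def powr_mult powr_divide field_simps)
  also have "\<dots> \<le> x0 * v * p / opt M n X"
    using opt x0 v p \<Gamma> by (intro divide_left_mono) (auto intro!: mult_pos_pos)
  also have "\<dots> \<le> (\<integral>\<omega>. X (cdp_ol n m \<delta> x0 (\<lambda>t. X t \<omega>)) \<omega> \<partial>M) / opt M n X"
    using rew opt by (intro divide_right_mono) auto
  finally show ?thesis by (simp add: competitive_ratio_def)
qed

section \<open>Probability that the estimate is close to the true shape\<close>

lemma theta_U_log_sum:
  "theta_U m \<delta> x0 x = (1 + eps m \<delta>) * (real m / (\<Sum>i=1..m. ln (x i / x0)))"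
  by (simp add: theta_U_def theta_hat_def)

text \<open>\<open>eps\<close> is calibrated so that the two-sided Chernoff bound equals
  \<open>\<delta>\<close>. On the good event \<open>theta_U\<close> is
  \<open>\<theta> * (1 + c) / r\<close> with \<open>r\<close> within \<open>c\<close> of
  \<open>1\<close>; hence it is at least \<open>\<theta>\<close>, and \<open>c \<le> 1 / 2\<close>
  gives the factor \<open>1 + 4 * c\<close>.\<close>

lemma theta_U_confidence:
  assumes iid: "iid_pareto M n X \<theta> x0" and th: "\<theta> > 0" and x0: "x0 > 0" and m: "1 \<le> m" "m \<le> n"
    and \<delta>: "0 < \<delta>" "\<delta> < 1" and eps: "eps m \<delta> \<le> 1 / 2"
  shows "measure M {\<omega> \<in> space M. theta_U m \<delta> x0 (\<lambda>t. X t \<omega>) \<in> {\<theta>..\<theta> * (1 + 4 * eps m \<delta>)}} \<ge> 1 - \<delta>"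
proof -
  interpret prob_space M using iid by (simp add: iid_pareto_def)
  define S where "S = (\<lambda>\<omega>. \<Sum>i=1..m. ln (X i \<omega> / x0))"
  define c where "c = eps m \<delta>"
  have D: "distributed M lborel S (erlang_density (m - 1) \<theta>)"
    unfolding S_def by (rule iid_pareto_log_sum[OF iid x0 th m])
  have [measurable]: "S \<in> borel_measurable M" using distributed_measurable[OF D] by simp
  have ln: "ln (2 / \<delta>) > 0" using \<delta> by simp
  have c: "0 < c" "c \<le> 1 / 2" using eps ln m by (auto simp: c_def eps_def)
  have "c\<^sup>2 = 4 * ln (2 / \<delta>) / real m" using ln m by (simp add: c_def eps_def)
  hence "- real m * c\<^sup>2 / 4 = - ln (2 / \<delta>)" using m by simp
  hence "exp (- real m * c\<^sup>2 / 4) = \<delta> / 2" using \<delta> by (simp add: exp_minus)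
  hence "1 - \<delta> \<le> prob {\<omega> \<in> space M. \<bar>\<theta> * S \<omega> / real m - 1\<bar> \<le> c}"
    using erlang_concentration[OF D m(1) th, of c] c by simp
  also have "\<dots> \<le> prob {\<omega> \<in> space M. theta_U m \<delta> x0 (\<lambda>t. X t \<omega>) \<in> {\<theta>..\<theta> * (1 + 4 * c)}}"
  proof (rule finite_measure_mono)
    show "{\<omega> \<in> space M. \<bar>\<theta> * S \<omega> / real m - 1\<bar> \<le> c} \<subseteq>
      {\<omega> \<in> space M. theta_U m \<delta> x0 (\<lambda>t. X t \<omega>) \<in> {\<theta>..\<theta> * (1 + 4 * c)}}"
    proof safe
      fix \<omega> assume \<omega>: "\<omega> \<in> space M" "\<bar>\<theta> * S \<omega> / real m - 1\<bar> \<le> c"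
      define r where "r = \<theta> * S \<omega> / real m"
      have "r - 1 \<le> c" "- (r - 1) \<le> c" using \<omega>(2) unfolding r_def abs_le_iff by auto
      hence r: "r \<le> 1 + c" "1 - c \<le> r" "r > 0" using c by auto
      have U: "theta_U m \<delta> x0 (\<lambda>t. X t \<omega>) = \<theta> * ((1 + c) / r)"
        using th m by (simp add: theta_U_log_sum r_def S_def c_def)
      have "1 \<le> (1 + c) / r" using r by simp
      hence lo: "\<theta> * 1 \<le> \<theta> * ((1 + c) / r)" using th by (intro mult_left_mono) auto
      have "c * (4 * c) \<le> c * 2" using c by (intro mult_left_mono) auto
      hence "1 + c \<le> (1 + 4 * c) * (1 - c)" by (simp add: algebra_simps)
      also have "\<dots> \<le> (1 + 4 * c) * r" using r c by (intro mult_left_mono) auto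
      finally have "(1 + c) / r \<le> 1 + 4 * c" using r by (simp add: field_simps)
      hence "\<theta> * ((1 + c) / r) \<le> \<theta> * (1 + 4 * c)" using th by (intro mult_left_mono) auto
      with lo show "theta_U m \<delta> x0 (\<lambda>t. X t \<omega>) \<in> {\<theta>..\<theta> * (1 + 4 * c)}" by (simp add: U)
    qed
    have "{\<omega> \<in> space M. theta_U m \<delta> x0 (\<lambda>t. X t \<omega>) \<in> {\<theta>..\<theta> * (1 + 4 * c)}} =
        {\<omega> \<in> space M. (1 + eps m \<delta>) * (real m / S \<omega>) \<in> {\<theta>..\<theta> * (1 + 4 * c)}}"
      by (simp add: theta_U_log_sum S_def)
    also have "\<dots> \<in> events" by measurable
    finally show "{\<omega> \<in> space M. theta_U m \<delta> x0 (\<lambda>t. X t \<omega>) \<in> {\<theta>..\<theta> * (1 + 4 * c)}} \<in> events" .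
  qed
  finally show ?thesis by (simp add: c_def)
qed

text \<open>Here \<open>theta_U = \<theta> * (m + t * r) / (\<theta> * S \<omega>)\<close> with
  \<open>t\<close> between \<open>1\<close> and \<open>2\<close>, so a good estimate means that
  \<open>\<theta> * S \<omega>\<close> lies just below \<open>m + t * r\<close>. That window is
  within two standard deviations above the mean, where the density bound applies.\<close>

lemma theta_U_near_theta:
  assumes iid: "iid_pareto M n X \<theta> x0" and th: "\<theta> > 0" and x0: "x0 > 0" and m: "1 \<le> m" "m \<le> n"
    and \<delta>: "0 < \<delta>" "\<delta> < 1" "ln (2 / \<delta>) \<le> 1" and \<zeta>: "0 < \<zeta>" "\<zeta> \<le> 1"
  shows "measure M {\<omega> \<in> space M. theta_U m \<delta> x0 (\<lambda>t. X t \<omega>) \<in> {\<theta>..\<theta> * (1 + \<zeta>)}} \<ge>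
    min 1 (sqrt (real m) * \<zeta>) / (6 * exp 3)"
proof -
  interpret prob_space M using iid by (simp add: iid_pareto_def)
  define S where "S = (\<lambda>\<omega>. \<Sum>i=1..m. ln (X i \<omega> / x0))"
  define r where "r = sqrt (real m)"
  define t where "t = 2 * sqrt (ln (2 / \<delta>))"
  \<comment> \<open>The window length for \<open>\<theta> * S \<omega>\<close>: the first cap keeps
    the estimate below \<open>\<theta> * (1 + \<zeta>)\<close>, the second keeps the window above
    the mean.\<close>
  define l where "l = min (real m * \<zeta> / 2) r"
  define b where "b = (real m + t * r) / \<theta>"
  define a where "a = b - l / \<theta>"
  have D: "distributed M lborel S (erlang_density (m - 1) \<theta>)"
    unfolding S_def by (rule iid_pareto_log_sum[OF iid x0 th m])
  have [measurable]: "S \<in> borel_measurable M" using distributed_measurable[OF D] by simp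
  have r: "r \<ge> 1" "r * r = real m" using m by (auto simp: r_def)
  have e: "eps m \<delta> * real m = t * r"
  proof -
    have "sqrt (4 * ln (2 / \<delta>)) = t" by (simp add: t_def real_sqrt_mult)
    hence "eps m \<delta> = t / r" unfolding eps_def real_sqrt_divide r_def by simp
    thus ?thesis using r by (simp flip: r(2))
  qed
  have "1 / 2 \<le> ln (2::real)" using ln_1_plus_ge_quadratic[of 1] by simp
  also have "ln 2 \<le> ln (2 / \<delta>)" using \<delta> by (subst ln_le_cancel_iff) (auto simp: field_simps)
  finally have "1 / 4 \<le> ln (2 / \<delta>)" by simp
  hence "sqrt (1 / 4) \<le> sqrt (ln (2 / \<delta>))" by (rule real_sqrt_le_mono)
  hence t: "1 \<le> t" "t \<le> 2" using \<delta>(3) by (auto simp: t_def real_sqrt_divide)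
  have l: "0 \<le> l" "l \<le> r" "l \<le> real m * \<zeta> / 2" using r \<zeta> by (auto simp: l_def)
  have tr: "r \<le> t * r" "t * r \<le> 2 * r" using t r by auto
  have \<theta>b: "\<theta> * b = real m + t * r" and \<theta>a: "\<theta> * a = real m + t * r - l"
    using th by (auto simp: a_def b_def field_simps)
  have "min 1 (r * \<zeta>) / (6 * exp 3) \<le> l / (3 * exp 3 * r)"
  proof -
    have "r * (min 1 (r * \<zeta>) / 2) \<le> l"
      using r \<zeta> mult_left_mono[of "min 1 (r * \<zeta>)" "r * \<zeta>" r] mult_left_mono[of "min 1 (r * \<zeta>)" 1 r]
      by (simp add: l_def mult.assoc flip: r(2))
    thus ?thesis using r by (simp add: field_simps)
  qed
  also have "l = \<theta> * (b - a)" using th by (simp add: a_def)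
  also have "\<theta> * (b - a) / (3 * exp 3 * r) \<le> prob {\<omega> \<in> space M. S \<omega> \<in> {a..b}}"
    unfolding r_def
  proof (rule erlang_window_lower[OF D m(1) th])
    show "a \<le> b" using l th by (simp add: a_def)
    show "real m \<le> \<theta> * a" using l tr unfolding \<theta>a by linarith
    show "\<theta> * b \<le> real m + 2 * sqrt (real m)" using tr unfolding \<theta>b r_def by linarith
  qed
  also have "\<dots> \<le> prob {\<omega> \<in> space M. theta_U m \<delta> x0 (\<lambda>t. X t \<omega>) \<in> {\<theta>..\<theta> * (1 + \<zeta>)}}"
  proof (rule finite_measure_mono)
    show "{\<omega> \<in> space M. S \<omega> \<in> {a..b}} \<subseteq>
      {\<omega> \<in> space M. theta_U m \<delta> x0 (\<lambda>t. X t \<omega>) \<in> {\<theta>..\<theta> * (1 + \<zeta>)}}"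
    proof safe
      fix \<omega> assume \<omega>: "\<omega> \<in> space M" "S \<omega> \<in> {a..b}"
      define y where "y = \<theta> * S \<omega>"
      have "\<theta> * a \<le> y" "y \<le> \<theta> * b" using \<omega>(2) th by (auto simp: y_def)
      hence y: "real m + t * r - l \<le> y" "y \<le> real m + t * r" unfolding \<theta>a \<theta>b by auto
      have y0: "y > 0" using y l tr m by linarith
      have U: "theta_U m \<delta> x0 (\<lambda>t. X t \<omega>) = \<theta> * ((real m + t * r) / y)"
        using th by (simp add: theta_U_log_sum y_def S_def distrib_right e[symmetric])
      have "1 \<le> (real m + t * r) / y" using y y0 by simp
      hence lo: "\<theta> * 1 \<le> \<theta> * ((real m + t * r) / y)" using th by (intro mult_left_mono) auto
      have "real m + t * r \<le> (1 + \<zeta>) * y"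
      proof -
        have "l * (1 + \<zeta>) \<le> (real m * \<zeta> / 2) * 2" using l \<zeta> by (intro mult_mono) auto
        also have "\<dots> \<le> \<zeta> * (real m + t * r)" using \<zeta> tr r by (simp add: algebra_simps)
        finally have "real m + t * r \<le> (1 + \<zeta>) * (real m + t * r - l)" by (simp add: algebra_simps)
        also have "\<dots> \<le> (1 + \<zeta>) * y" using y \<zeta> by (intro mult_left_mono) auto
        finally show ?thesis .
      qed
      hence "(real m + t * r) / y \<le> 1 + \<zeta>" using y0 by (simp add: field_simps)
      hence "\<theta> * ((real m + t * r) / y) \<le> \<theta> * (1 + \<zeta>)" using th by (intro mult_left_mono) auto
      with lo show "theta_U m \<delta> x0 (\<lambda>t. X t \<omega>) \<in> {\<theta>..\<theta> * (1 + \<zeta>)}" by (simp add: U)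
    qed
    have "{\<omega> \<in> space M. theta_U m \<delta> x0 (\<lambda>t. X t \<omega>) \<in> {\<theta>..\<theta> * (1 + \<zeta>)}} =
        {\<omega> \<in> space M. (1 + eps m \<delta>) * (real m / S \<omega>) \<in> {\<theta>..\<theta> * (1 + \<zeta>)}}"
      by (simp add: theta_U_log_sum S_def)
    also have "\<dots> \<in> events" by measurable
    finally show "{\<omega> \<in> space M. theta_U m \<delta> x0 (\<lambda>t. X t \<omega>) \<in> {\<theta>..\<theta> * (1 + \<zeta>)}} \<in> events" .
  qed
  finally show ?thesis by (simp add: r_def)
qed

section \<open>The two regimes of the confidence level\<close>

text \<open>As \<open>ln (1 / \<delta>)\<close> is at least \<open>L0 > 0\<close>, it dominates
  \<open>ln (2 / \<delta>)\<close> up to the factor \<open>\<Lambda>\<close>. The squared deviation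
  of a good estimate is then of the order of the rate \<open>q\<close>, and the quadratic loss bound
  gives the claim.\<close>

lemma competitive_ratio_confidence_regime:
  fixes \<theta> x0 \<delta>0 :: real
  assumes th: "\<theta> > 1" and x0: "x0 > 0" and \<delta>0: "0 < \<delta>0" "\<delta>0 < 1"
  obtains K c n0 where "K \<ge> 0" "c > 0"
    and "\<And>(M :: 'a measure) X n m \<delta>. iid_pareto M n X \<theta> x0 \<Longrightarrow> n \<ge> n0 \<Longrightarrow> 1 \<le> m \<Longrightarrow> 4 * m \<le> n \<Longrightarrow>
      0 < \<delta> \<Longrightarrow> \<delta> \<le> \<delta>0 \<Longrightarrow> ln (1 / \<delta>) * (ln (real n))\<^sup>2 \<le> c * real m \<Longrightarrow>
      competitive_ratio M n X (\<lambda>\<omega>. cdp_ol n m \<delta> x0 (\<lambda>t. X t \<omega>)) \<ge>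
        (1 - \<delta>) * rho1 \<theta> * (1 - K * (real m / real n + ln (1 / \<delta>) * (ln (real n))\<^sup>2 / real m))"
proof -
  obtain B E r where BEr: "B \<ge> 0" "E \<ge> 0" "r > 0"
    and gt1: "\<And>\<theta>' n k. n > 0 \<Longrightarrow> \<bar>\<theta>' - \<theta>\<bar> * (1 + ln (real n)) \<le> r \<Longrightarrow> \<theta>' > 1"
    and pv: "\<And>\<theta>' n k. k < n \<Longrightarrow> \<bar>\<theta>' - \<theta>\<bar> * (1 + ln (real n)) \<le> r \<Longrightarrow>
      policy_value \<theta> \<theta>' k \<ge> (\<theta> / (\<theta> - 1) * real (Suc k)) powr (1 / \<theta>) *
        (1 - B * (\<bar>\<theta>' - \<theta>\<bar> * (1 + ln (real n)))\<^sup>2 - E / sqrt (real (Suc k)))"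
    using policy_value_lower[OF th] by metis
  define L0 where "L0 = ln (1 / \<delta>0)"
  have L0: "L0 > 0" using \<delta>0 by (simp add: L0_def)
  define \<Lambda> where "\<Lambda> = 1 + ln 2 / L0"
  have \<Lambda>: "\<Lambda> > 0" using L0 by (simp add: \<Lambda>_def add_pos_pos)
  \<comment> \<open>The square of \<open>4 * \<theta> * e1\<close> contributes \<open>16\<close>;
    the estimate \<open>1 + ln n \<le> 2 * ln n\<close> and the \<open>4\<close> inside
    \<open>eps\<close> contribute another \<open>16\<close>.\<close>
  define Q where "Q = 256 * \<theta>\<^sup>2 * \<Lambda>"
  have Q: "Q > 0" using th \<Lambda> by (simp add: Q_def)
  \<comment> \<open>The three bounds give, in turn, \<open>eps \<le> 1 / 2\<close>, a deviation at
    most \<open>r\<close>, and a threshold loss at most \<open>1 / 2\<close>.\<close>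
  define c where "c = min (1 / (64 * \<Lambda>)) (min (r\<^sup>2 / Q) (1 / (2 * (B * Q + 1))))"
  have BQ: "B * Q \<ge> 0" using BEr Q by simp
  have c: "c \<le> 1 / (64 * \<Lambda>)" "c \<le> r\<^sup>2 / Q" "c \<le> 1 / (2 * (B * Q + 1))"
    unfolding c_def by linarith+
  have "0 < 1 / (64 * \<Lambda>)" "0 < r\<^sup>2 / Q" using \<Lambda> Q BEr by auto
  moreover have "0 < 1 / (2 * (B * Q + 1))"
  proof (rule divide_pos_pos)
    have "0 \<le> x \<Longrightarrow> 0 < 2 * (x + 1)" for x :: real by simp
    thus "0 < 2 * (B * Q + 1)" using BQ by blast
  qed simp
  ultimately have c_pos: "c > 0" unfolding c_def by linarith
  \<comment> \<open>The summands account for the factor \<open>1 - 2 * a\<close> from the shortened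
    horizon, the squared threshold error, and the term \<open>E / sqrt N\<close>.\<close>
  define K where "K = 2 + B * Q + E / sqrt L0"
  have E0: "E / sqrt L0 \<ge> 0" using BEr L0 by simp
  have K: "K \<ge> 0" using BQ E0 by (simp add: K_def)
  define n0 where "n0 = nat \<lceil>16 * E\<^sup>2\<rceil> + 3"
  show thesis
  proof
    show "K \<ge> 0" "c > 0" using K c_pos .
    fix M :: "'a measure" and X n m and \<delta> :: real
    assume iid: "iid_pareto M n X \<theta> x0" and n: "n \<ge> n0" and m: "1 \<le> m" "4 * m \<le> n"
      and \<delta>: "0 < \<delta>" "\<delta> \<le> \<delta>0" and small: "ln (1 / \<delta>) * (ln (real n))\<^sup>2 \<le> c * real m"
    define L where "L = ln (1 / \<delta>)"
    define q where "q = L * (ln (real n))\<^sup>2 / real m"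
    define a where "a = real m / real n"
    have n3: "real n \<ge> 3" using n by (simp add: n0_def)
    have "16 * E\<^sup>2 \<le> real (nat \<lceil>16 * E\<^sup>2\<rceil>)" by (rule real_nat_ceiling_ge)
    also have "\<dots> \<le> real n" using n by (simp add: n0_def)
    finally have nE: "16 * E\<^sup>2 \<le> real n" .
    have "exp 1 \<le> (3::real)" using exp_le by simp
    hence "ln (exp 1) \<le> ln (real n)" using n3 by (subst ln_le_cancel_iff) auto
    hence ln1: "ln (real n) \<ge> 1" by simp
    have mn: "m < n" "0 < n" using m by auto
    have \<delta>1: "\<delta> < 1" using \<delta> \<delta>0 by simp
    have LL: "L0 \<le> L" unfolding L_def L0_def using \<delta> \<delta>0 by (subst ln_le_cancel_iff) (auto simp: field_simps)
    have q0: "q \<ge> 0" using LL L0 by (simp add: q_def)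
    have qc: "q \<le> c" using small m by (simp add: q_def L_def field_simps)
    define e1 where "e1 = eps m \<delta>"
    have ln2: "ln (2 / \<delta>) \<le> \<Lambda> * L"
    proof -
      have "ln (2 / \<delta>) = ln 2 + L" using \<delta> by (simp add: L_def ln_div)
      also have "ln 2 = (ln 2 / L0) * L0" using L0 by simp
      also have "\<dots> \<le> (ln 2 / L0) * L" using LL L0 by (intro mult_left_mono) auto
      finally show ?thesis by (simp add: \<Lambda>_def algebra_simps)
    qed
    have lnpos: "ln (2 / \<delta>) > 0" using \<delta> \<delta>1 by simp
    have e1: "e1 \<ge> 0" "e1\<^sup>2 = 4 * ln (2 / \<delta>) / real m" using lnpos m by (auto simp: e1_def eps_def)
    have sq: "(e1 * (1 + ln (real n)))\<^sup>2 \<le> 16 * \<Lambda> * q"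
    proof -
      have "(e1 * (1 + ln (real n)))\<^sup>2 \<le> (e1 * (2 * ln (real n)))\<^sup>2"
        using e1 ln1 by (intro power_mono mult_left_mono mult_nonneg_nonneg) auto
      also have "\<dots> = 4 * (ln (real n))\<^sup>2 * (4 * ln (2 / \<delta>) / real m)"
        by (simp add: power_mult_distrib e1(2))
      also have "\<dots> \<le> 4 * (ln (real n))\<^sup>2 * (4 * (\<Lambda> * L) / real m)"
        using ln2 m by (intro mult_left_mono divide_right_mono) auto
      also have "\<dots> = 16 * \<Lambda> * q" by (simp add: q_def field_simps)
      finally show ?thesis .
    qed
    have e1half: "e1 \<le> 1 / 2"
    proof -
      have "e1 * 1 \<le> e1 * (1 + ln (real n))" using e1 ln1 by (intro mult_left_mono) auto
      hence "e1\<^sup>2 \<le> (e1 * (1 + ln (real n)))\<^sup>2" using e1 by (intro power_mono) auto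
      also note sq
      also have "16 * \<Lambda> * q \<le> 16 * \<Lambda> * (1 / (64 * \<Lambda>))" using qc c \<Lambda> by (intro mult_left_mono) auto
      also have "\<dots> = (1 / 2)\<^sup>2" using \<Lambda> by (simp add: power2_eq_square)
      finally show ?thesis by (rule power2_le_imp_le) simp
    qed
    define G where "G = {\<theta>..\<theta> * (1 + 4 * e1)}"
    have dev2: "(\<bar>\<theta>' - \<theta>\<bar> * (1 + ln (real n)))\<^sup>2 \<le> Q * q" if "\<theta>' \<in> G" for \<theta>'
    proof -
      have "\<bar>\<theta>' - \<theta>\<bar> \<le> 4 * \<theta> * e1" using that th by (simp add: G_def algebra_simps)
      hence "\<bar>\<theta>' - \<theta>\<bar> * (1 + ln (real n)) \<le> 4 * \<theta> * e1 * (1 + ln (real n))"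
        using ln1 by (intro mult_right_mono) auto
      hence "(\<bar>\<theta>' - \<theta>\<bar> * (1 + ln (real n)))\<^sup>2 \<le> (4 * \<theta> * e1 * (1 + ln (real n)))\<^sup>2"
        using ln1 by (intro power_mono) auto
      also have "\<dots> = ((4 * \<theta>) * (e1 * (1 + ln (real n))))\<^sup>2" by (simp only: mult.assoc)
      also have "\<dots> = 16 * \<theta>\<^sup>2 * (e1 * (1 + ln (real n)))\<^sup>2" by (simp add: power_mult_distrib)
      also have "\<dots> \<le> 16 * \<theta>\<^sup>2 * (16 * \<Lambda> * q)" using sq by (intro mult_left_mono) auto
      finally show ?thesis by (simp add: Q_def)
    qed
    have dev: "\<bar>\<theta>' - \<theta>\<bar> * (1 + ln (real n)) \<le> r" if "\<theta>' \<in> G" for \<theta>'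
    proof -
      have "(\<bar>\<theta>' - \<theta>\<bar> * (1 + ln (real n)))\<^sup>2 \<le> Q * q" by (rule dev2[OF that])
      also have "\<dots> \<le> Q * (r\<^sup>2 / Q)" using qc c Q by (intro mult_left_mono) auto
      also have "\<dots> = r\<^sup>2" using Q by simp
      finally show ?thesis by (rule power2_le_imp_le) (use BEr in simp)
    qed
    define N where "N = real (n - m)"
    have N: "N \<ge> real n / 4" "N > 0" using m n3 by (auto simp: N_def of_nat_diff)
    have SN: "real (Suc (n - m - 1)) = N" using mn by (simp add: N_def)
    define e where "e = B * (Q * q) + E / sqrt N"
    have EN: "E / sqrt N \<le> 2 * E / sqrt (real n)"
    proof -
      have "sqrt (real n / 4) \<le> sqrt N" using N by (intro real_sqrt_le_mono) auto
      hence "sqrt (real n) / 2 \<le> sqrt N" by (simp add: real_sqrt_divide)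
      hence "E / sqrt N \<le> E / (sqrt (real n) / 2)" using BEr n3 by (intro divide_left_mono) (auto simp: N)
      thus ?thesis by (simp add: mult.commute)
    qed
    have EN2: "2 * E / sqrt (real n) \<le> 1 / 2"
    proof -
      have "sqrt (16 * E\<^sup>2) \<le> sqrt (real n)" using nE by (rule real_sqrt_le_mono)
      hence "4 * E \<le> sqrt (real n)" using BEr by (simp add: real_sqrt_mult)
      thus ?thesis using n3 by (simp add: field_simps)
    qed
    have "B * (Q * q) \<le> 1 / 2"
    proof -
      have "(B * Q) * q \<le> (B * Q + 1) * (1 / (2 * (B * Q + 1)))"
        using BQ qc c q0 by (intro mult_mono) auto
      also have "\<dots> = 1 / 2" using BQ by simp
      finally show ?thesis by (simp add: mult.assoc)
    qed
    hence e: "e \<le> 1" using EN EN2 by (simp add: e_def)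
    have e0: "e \<ge> 0" unfolding e_def using BQ q0 BEr N by (intro add_nonneg_nonneg) (auto simp: mult.assoc[symmetric])
    have "rho1 \<theta> * (1 - 2 * (real m / real n)) * (1 - e) * (1 - \<delta>) \<le>
        competitive_ratio M n X (\<lambda>\<omega>. cdp_ol n m \<delta> x0 (\<lambda>t. X t \<omega>))"
    proof (rule competitive_ratio_lower[OF iid th x0 m(1) mn(1), of G])
      show "\<theta>' > 1" if "\<theta>' \<in> G" for \<theta>' using gt1[OF mn(2) dev[OF that]] .
      show "policy_value \<theta> \<theta>' (n - m - 1) \<ge> (\<theta> / (\<theta> - 1) * real (n - m)) powr (1 / \<theta>) * (1 - e)"
        if "\<theta>' \<in> G" for \<theta>'
      proof -
        have "B * (\<bar>\<theta>' - \<theta>\<bar> * (1 + ln (real n)))\<^sup>2 \<le> B * (Q * q)"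
          using dev2[OF that] BEr by (intro mult_left_mono) auto
        hence "1 - e \<le> 1 - B * (\<bar>\<theta>' - \<theta>\<bar> * (1 + ln (real n)))\<^sup>2 - E / sqrt N" by (simp add: e_def)
        hence "(\<theta> / (\<theta> - 1) * N) powr (1 / \<theta>) * (1 - e) \<le> (\<theta> / (\<theta> - 1) * N) powr (1 / \<theta>) *
            (1 - B * (\<bar>\<theta>' - \<theta>\<bar> * (1 + ln (real n)))\<^sup>2 - E / sqrt N)"
          by (intro mult_left_mono) auto
        also have "\<dots> \<le> policy_value \<theta> \<theta>' (n - m - 1)"
          using pv[of "n - m - 1" n \<theta>'] dev[OF that] mn unfolding SN by simp
        finally show ?thesis by (simp add: N_def)
      qed
      show "1 - \<delta> \<le> measure M {\<omega> \<in> space M. theta_U m \<delta> x0 (\<lambda>t. X t \<omega>) \<in> G}"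
        unfolding G_def e1_def using e1half m \<delta> \<delta>1 th
        by (intro theta_U_confidence[OF iid _ x0]) (auto simp: e1_def)
    qed (use e \<delta>1 in \<open>auto simp: G_def\<close>)
    moreover have "(1 - \<delta>) * rho1 \<theta> * (1 - K * (a + q)) \<le> (1 - \<delta>) * rho1 \<theta> * ((1 - 2 * a) * (1 - e))"
    proof (rule mult_left_mono)
      \<comment> \<open>By AM-GM the rate \<open>a + q\<close> is at least of order \<open>1 / sqrt n\<close>.\<close>
      have "2 * E / sqrt (real n) \<le> (E / sqrt L0) * (a + q)"
      proof -
        have "L0 * 1 \<le> L * (ln (real n))\<^sup>2"
          using LL L0 ln1 by (intro mult_mono) auto
        hence "L0 / real n \<le> L * (ln (real n))\<^sup>2 / real n" using n3 by (intro divide_right_mono) auto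
        also have "\<dots> = a * q" using m by (simp add: a_def q_def)
        finally have "L0 / real n \<le> a * q" .
        hence "4 * (L0 / real n) \<le> 4 * (a * q)" by simp
        also have "\<dots> \<le> (a + q)\<^sup>2"
          using zero_le_power2[of "a - q"] by (simp add: power2_eq_square algebra_simps)
        finally have "sqrt (4 * (L0 / real n)) \<le> sqrt ((a + q)\<^sup>2)" by (rule real_sqrt_le_mono)
        moreover have "a + q \<ge> 0" using q0 by (simp add: a_def)
        ultimately have "2 * (sqrt L0 / sqrt (real n)) \<le> a + q" by (simp add: real_sqrt_mult real_sqrt_divide)
        hence "(E / sqrt L0) * (2 * (sqrt L0 / sqrt (real n))) \<le> (E / sqrt L0) * (a + q)"
          using E0 by (intro mult_left_mono) auto
        moreover have "(E / sqrt L0) * (2 * (sqrt L0 / sqrt (real n))) = 2 * E / sqrt (real n)"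
          using L0 by simp
        ultimately show ?thesis by (simp only:)
      qed
      hence "e \<le> B * Q * q + (E / sqrt L0) * (a + q)" using EN unfolding e_def by simp
      moreover have "K * (a + q) = 2 * a + 2 * q + B * Q * a + B * Q * q + (E / sqrt L0) * (a + q)"
        by (simp add: K_def algebra_simps)
      moreover have "B * Q * a \<ge> 0" using BQ by (simp add: a_def)
      ultimately have "2 * a + e \<le> K * (a + q)" using q0 by linarith
      moreover have "(1 - 2 * a) * (1 - e) = 1 - 2 * a - e + 2 * a * e" by (simp add: algebra_simps)
      moreover have "2 * a * e \<ge> 0" using e0 by (simp add: a_def)
      ultimately show "1 - K * (a + q) \<le> (1 - 2 * a) * (1 - e)" by linarith
      have "Gamma (1 - 1 / \<theta>) \<ge> 0" using th by (intro Gamma_real_nonneg) simp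
      thus "(1 - \<delta>) * rho1 \<theta> \<ge> 0" using \<delta>1 by (simp add: rho1_def)
    qed
    ultimately show "competitive_ratio M n X (\<lambda>\<omega>. cdp_ol n m \<delta> x0 (\<lambda>t. X t \<omega>)) \<ge>
        (1 - \<delta>) * rho1 \<theta> * (1 - K * (real m / real n + ln (1 / \<delta>) * (ln (real n))\<^sup>2 / real m))"
      by (simp add: a_def q_def L_def mult_ac)
  qed
qed

text \<open>Only the small factor \<open>1 - \<delta>\<close> has to be beaten, so constant losses
  are affordable: the horizon and the thresholds cost at most one half each, and good estimates have
  probability at least \<open>4 * (1 - \<delta>)\<close>.\<close>

lemma competitive_ratio_low_confidence_regime:
  fixes \<theta> x0 :: real
  assumes th: "\<theta> > 1" and x0: "x0 > 0"
  obtains \<delta>0 c n0 where "0 < \<delta>0" "\<delta>0 < 1" "c > 0"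
    and "\<And>(M :: 'a measure) X n m \<delta>. iid_pareto M n X \<theta> x0 \<Longrightarrow> n \<ge> n0 \<Longrightarrow> 1 \<le> m \<Longrightarrow> 4 * m \<le> n \<Longrightarrow>
      \<delta>0 \<le> \<delta> \<Longrightarrow> \<delta> < 1 \<Longrightarrow> ln (1 / \<delta>) * (ln (real n))\<^sup>2 \<le> c * real m \<Longrightarrow>
      competitive_ratio M n X (\<lambda>\<omega>. cdp_ol n m \<delta> x0 (\<lambda>t. X t \<omega>)) \<ge> (1 - \<delta>) * rho1 \<theta>"
proof -
  obtain B E r where BEr: "B \<ge> 0" "E \<ge> 0" "r > 0"
    and gt1: "\<And>\<theta>' n k. n > 0 \<Longrightarrow> \<bar>\<theta>' - \<theta>\<bar> * (1 + ln (real n)) \<le> r \<Longrightarrow> \<theta>' > 1"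
    and pv: "\<And>\<theta>' n k. k < n \<Longrightarrow> \<bar>\<theta>' - \<theta>\<bar> * (1 + ln (real n)) \<le> r \<Longrightarrow>
      policy_value \<theta> \<theta>' k \<ge> (\<theta> / (\<theta> - 1) * real (Suc k)) powr (1 / \<theta>) *
        (1 - B * (\<bar>\<theta>' - \<theta>\<bar> * (1 + ln (real n)))\<^sup>2 - E / sqrt (real (Suc k)))"
    using policy_value_lower[OF th] by metis
  \<comment> \<open>Gives \<open>B * r2 * r2 \<le> 1 / 4\<close>, so that together with
    \<open>E / sqrt N \<le> 1 / 4\<close> at most half of the value is lost.\<close>
  define r2 where "r2 = min (min r 1) (1 / (4 * (B + 1)))"
  have r2: "0 < r2" "r2 \<le> r" "r2 \<le> 1" "r2 \<le> 1 / (4 * (B + 1))" using BEr by (auto simp: r2_def)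
  have Br2: "B * r2\<^sup>2 \<le> 1 / 4"
  proof -
    have "r2 * r2 \<le> 1 / (4 * (B + 1)) * 1" using r2 BEr by (intro mult_mono) auto
    hence "B * (r2 * r2) \<le> (B + 1) * (1 / (4 * (B + 1)))" using BEr r2 by (intro mult_mono) auto
    also have "\<dots> = 1 / 4" using BEr by simp
    finally show ?thesis by (simp add: power2_eq_square)
  qed
  define r' where "r' = r2 / \<theta>"
  have r': "0 < r'" "r' \<le> 1" using r2 th by (auto simp: r'_def)
  define c0 :: real where "c0 = 1 / (6 * exp 3)"
  have "4 \<le> exp (3::real)" using exp_ge_add_one_self[of 3] by simp
  hence c0: "c0 > 0" "c0 \<le> 1 / 24" by (auto simp: c0_def field_simps)
  \<comment> \<open>Makes \<open>4 * (1 - \<delta>) \<le> c0\<close>, and keeps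
    \<open>\<delta>\<close> above \<open>4 / 5\<close>, whence
    \<open>ln (2 / \<delta>) \<le> 1\<close>.\<close>
  define \<delta>0 where "\<delta>0 = 1 - c0 / 4"
  have \<delta>0: "0 < \<delta>0" "\<delta>0 < 1" "\<delta>0 \<ge> 4 / 5" using c0 by (auto simp: \<delta>0_def)
  define c where "c = (c0 * r' / 8)\<^sup>2"
  have c: "c > 0" using c0 r' by (simp add: c_def)
  define n0 where "n0 = nat \<lceil>64 * E\<^sup>2\<rceil> + 3"
  show thesis
  proof
    show "0 < \<delta>0" "\<delta>0 < 1" "c > 0" by fact+
    fix M :: "'a measure" and X n m and \<delta> :: real
    assume iid: "iid_pareto M n X \<theta> x0" and n: "n \<ge> n0" and m: "1 \<le> m" "4 * m \<le> n"
      and \<delta>: "\<delta>0 \<le> \<delta>" "\<delta> < 1" and small: "ln (1 / \<delta>) * (ln (real n))\<^sup>2 \<le> c * real m"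
    define \<eta> where "\<eta> = 1 - \<delta>"
    have \<eta>: "0 < \<eta>" "\<eta> \<le> 1" "\<eta> \<le> c0 / 4" using \<delta> \<delta>0 by (auto simp: \<eta>_def \<delta>0_def)
    have n3: "real n \<ge> 3" using n by (simp add: n0_def)
    have "64 * E\<^sup>2 \<le> real (nat \<lceil>64 * E\<^sup>2\<rceil>)" by (rule real_nat_ceiling_ge)
    also have "\<dots> \<le> real n" using n by (simp add: n0_def)
    finally have nE: "64 * E\<^sup>2 \<le> real n" .
    have "exp 1 \<le> (3::real)" using exp_le by simp
    hence "ln (exp 1) \<le> ln (real n)" using n3 by (subst ln_le_cancel_iff) auto
    hence ln1: "ln (real n) \<ge> 1" by simp
    have mn: "m < n" "0 < n" using m by auto
    have ln2: "ln (2 / \<delta>) \<le> 1"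
    proof -
      have "2 / \<delta> \<le> 2 / (4 / 5)" using \<delta> \<delta>0 by (intro divide_left_mono) auto
      also have "\<dots> \<le> exp 1" using exp_lower_Taylor_quadratic[of 1] by simp
      finally have "ln (2 / \<delta>) \<le> ln (exp 1)" using \<delta> \<delta>0 by (subst ln_le_cancel_iff) auto
      thus ?thesis by simp
    qed
    define \<zeta> where "\<zeta> = r' / (1 + ln (real n))"
    have \<zeta>: "0 < \<zeta>" "\<zeta> \<le> 1" using r' ln1 by (auto simp: \<zeta>_def)
    have \<zeta>2: "\<zeta> \<ge> r' / (2 * ln (real n))"
      unfolding \<zeta>_def using r' ln1 by (intro divide_left_mono) auto
    define G where "G = {\<theta>..\<theta> * (1 + \<zeta>)}"
    have dev: "\<bar>\<theta>' - \<theta>\<bar> * (1 + ln (real n)) \<le> r2" if "\<theta>' \<in> G" for \<theta>'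
    proof -
      have "\<bar>\<theta>' - \<theta>\<bar> \<le> \<theta> * \<zeta>" using that th by (simp add: G_def algebra_simps)
      hence "\<bar>\<theta>' - \<theta>\<bar> * (1 + ln (real n)) \<le> \<theta> * \<zeta> * (1 + ln (real n))"
        using ln1 by (intro mult_right_mono) auto
      also have "\<dots> = r2" using ln1 th by (simp add: \<zeta>_def r'_def)
      finally show ?thesis .
    qed
    hence devr: "\<bar>\<theta>' - \<theta>\<bar> * (1 + ln (real n)) \<le> r" if "\<theta>' \<in> G" for \<theta>' using that r2 by fastforce
    define N where "N = real (n - m)"
    have N: "N \<ge> real n / 4" "N > 0" using m n3 by (auto simp: N_def of_nat_diff)
    have SN: "real (Suc (n - m - 1)) = N" using mn by (simp add: N_def)
    have EN: "E / sqrt N \<le> 1 / 4"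
    proof -
      have "sqrt (16 * E\<^sup>2) \<le> sqrt N" using N nE by (intro real_sqrt_le_mono) auto
      hence "4 * E \<le> sqrt N" using BEr by (simp add: real_sqrt_mult)
      thus ?thesis using N by (simp add: field_simps)
    qed
    define p where "p = c0 * min 1 (sqrt (real m) * \<zeta>)"
    have p0: "p \<ge> 0" using c0 \<zeta> by (auto simp: p_def)
    have "rho1 \<theta> * (1 - 2 * (real m / real n)) * (1 - 1 / 2) * p \<le>
        competitive_ratio M n X (\<lambda>\<omega>. cdp_ol n m \<delta> x0 (\<lambda>t. X t \<omega>))"
    proof (rule competitive_ratio_lower[OF iid th x0 m(1) mn(1), of G])
      show "\<theta>' > 1" if "\<theta>' \<in> G" for \<theta>' using gt1[OF mn(2) devr[OF that]] .
      show "policy_value \<theta> \<theta>' (n - m - 1) \<ge> (\<theta> / (\<theta> - 1) * real (n - m)) powr (1 / \<theta>) * (1 - 1 / 2)"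
        if "\<theta>' \<in> G" for \<theta>'
      proof -
        have "(\<bar>\<theta>' - \<theta>\<bar> * (1 + ln (real n)))\<^sup>2 \<le> r2\<^sup>2"
          using dev[OF that] ln1 by (intro power_mono) auto
        hence "B * (\<bar>\<theta>' - \<theta>\<bar> * (1 + ln (real n)))\<^sup>2 \<le> B * r2\<^sup>2"
          using BEr by (intro mult_left_mono) auto
        hence "1 - 1 / 2 \<le> 1 - B * (\<bar>\<theta>' - \<theta>\<bar> * (1 + ln (real n)))\<^sup>2 - E / sqrt N"
          using Br2 EN by linarith
        hence "(\<theta> / (\<theta> - 1) * N) powr (1 / \<theta>) * (1 - 1 / 2) \<le> (\<theta> / (\<theta> - 1) * N) powr (1 / \<theta>) *
            (1 - B * (\<bar>\<theta>' - \<theta>\<bar> * (1 + ln (real n)))\<^sup>2 - E / sqrt N)"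
          by (intro mult_left_mono) auto
        also have "\<dots> \<le> policy_value \<theta> \<theta>' (n - m - 1)"
          using pv[of "n - m - 1" n \<theta>'] devr[OF that] mn unfolding SN by simp
        finally show ?thesis by (simp add: N_def)
      qed
      show "p \<le> measure M {\<omega> \<in> space M. theta_U m \<delta> x0 (\<lambda>t. X t \<omega>) \<in> G}"
        using theta_U_near_theta[OF iid _ x0 m(1) _ _ \<delta>(2) ln2 \<zeta>] th m \<delta> \<delta>0
        by (simp add: G_def p_def c0_def)
    qed (use p0 in \<open>auto simp: G_def\<close>)
    hence reward: "rho1 \<theta> * ((1 - 2 * (real m / real n)) * (1 - 1 / 2) * p) \<le>
        competitive_ratio M n X (\<lambda>\<omega>. cdp_ol n m \<delta> x0 (\<lambda>t. X t \<omega>))"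
      by (simp only: mult.assoc)
    \<comment> \<open>If the minimum in \<open>p\<close> is \<open>1\<close>, the choice of
      \<open>\<delta>0\<close> decides. Otherwise \<open>\<eta> \<le> ln (1 / \<delta>)\<close> and
      the bound by \<open>c * m\<close> yield \<open>4 * sqrt \<eta> \<le> p\<close>, with
      \<open>c\<close> chosen for this constant, and
      \<open>\<eta> \<le> sqrt \<eta>\<close>.\<close>
    have "4 * \<eta> \<le> p"
    proof (cases "sqrt (real m) * \<zeta> \<ge> 1")
      case True
      thus ?thesis using \<eta> by (simp add: p_def)
    next
      case False
      have "\<eta> \<le> ln (1 / \<delta>)" using ln_le_minus_one[of \<delta>] \<delta> \<delta>0 by (simp add: \<eta>_def ln_div)
      hence "\<eta> * (ln (real n))\<^sup>2 \<le> c * real m"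
        using small mult_right_mono[of \<eta> "ln (1 / \<delta>)" "(ln (real n))\<^sup>2"] by simp
      hence "sqrt (\<eta> * (ln (real n))\<^sup>2) \<le> sqrt (c * real m)" by (rule real_sqrt_le_mono)
      hence "sqrt \<eta> * ln (real n) \<le> c0 * r' / 8 * sqrt (real m)"
        using ln1 c0 r' by (simp add: real_sqrt_mult c_def)
      hence sm: "4 * sqrt \<eta> \<le> c0 * (sqrt (real m) * (r' / (2 * ln (real n))))"
        using ln1 by (simp add: field_simps)
      have "sqrt \<eta> * sqrt \<eta> \<le> sqrt \<eta> * 1" using \<eta> by (intro mult_left_mono) auto
      hence "\<eta> \<le> sqrt \<eta>" using \<eta> by simp
      hence "4 * \<eta> \<le> c0 * (sqrt (real m) * (r' / (2 * ln (real n))))" using sm by linarith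
      also have "\<dots> \<le> c0 * (sqrt (real m) * \<zeta>)" using c0 \<zeta>2 by (intro mult_left_mono) auto
      also have "\<dots> = p" using False by (simp add: p_def)
      finally show ?thesis .
    qed
    have "rho1 \<theta> \<ge> 0"
    proof -
      have "Gamma (1 - 1 / \<theta>) \<ge> 0" using th by (intro Gamma_real_nonneg) simp
      thus ?thesis by (simp add: rho1_def)
    qed
    have "(1 - \<delta>) * rho1 \<theta> = rho1 \<theta> * \<eta>" by (simp add: \<eta>_def)
    also have "\<dots> \<le> rho1 \<theta> * (1 / 4 * p)"
      using \<open>4 * \<eta> \<le> p\<close> \<open>rho1 \<theta> \<ge> 0\<close> by (intro mult_left_mono) auto
    also have "\<dots> \<le> rho1 \<theta> * ((1 - 2 * (real m / real n)) * (1 - 1 / 2) * p)"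
    proof (intro mult_left_mono mult_right_mono)
      have "real (4 * m) \<le> real n" using m by (simp only: of_nat_le_iff)
      hence "real m / real n \<le> 1 / 4" using n3 by (simp add: field_simps)
      moreover have "1 / 4 \<le> (1 - 2 * a) * (1 - 1 / 2)" if "a \<le> 1 / 4" for a :: real using that by simp
      ultimately show "1 / 4 \<le> (1 - 2 * (real m / real n)) * (1 - 1 / 2)" by blast
    qed (use p0 \<open>rho1 \<theta> \<ge> 0\<close> in auto)
    also note reward
    finally show "competitive_ratio M n X (\<lambda>\<omega>. cdp_ol n m \<delta> x0 (\<lambda>t. X t \<omega>)) \<ge> (1 - \<delta>) * rho1 \<theta>" .
  qed
qed

text \<open>The sample space, \<open>\<delta>\<close> and \<open>m\<close> may all vary with the
  horizon, so the constants of both regimes have to be uniform in them; \<open>g\<close> is a fixed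
  multiple of the rate.\<close>

theorem theorem14:
  fixes M :: "nat \<Rightarrow> 'a measure" and X :: "nat \<Rightarrow> nat \<Rightarrow> 'a \<Rightarrow> real"
    and \<theta> x0 :: real and \<delta> :: "nat \<Rightarrow> real" and m :: "nat \<Rightarrow> nat"
  assumes "\<theta> > 1" and "x0 > 0"
    and "\<And>n. iid_pareto (M n) n (X n) \<theta> x0"
    and "\<And>n. 0 < \<delta> n \<and> \<delta> n < 1"
    and "(\<lambda>n. real (m n)) \<in> o(\<lambda>n. real n)"
    and "(\<lambda>n. real (m n)) \<in> \<omega>(\<lambda>n. ln (1 / \<delta> n) * (ln (real n))\<^sup>2)"
  shows "\<exists>g \<in> O(\<lambda>n. real (m n) / real n + ln (1 / \<delta> n) * (ln (real n))\<^sup>2 / real (m n)).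
           \<forall>\<^sub>F n in sequentially.
             competitive_ratio (M n) n (X n) (\<lambda>\<omega>. cdp_ol n (m n) (\<delta> n) x0 (\<lambda>t. X n t \<omega>))
               \<ge> (1 - \<delta> n) * rho1 \<theta> * (1 - g n)"
proof -
  obtain \<delta>0 c2 n2 where \<delta>0: "0 < \<delta>0" "\<delta>0 < 1" and c2: "c2 > 0" and low:
    "\<And>(M :: 'a measure) X n m \<delta>. iid_pareto M n X \<theta> x0 \<Longrightarrow> n \<ge> n2 \<Longrightarrow> 1 \<le> m \<Longrightarrow> 4 * m \<le> n \<Longrightarrow>
      \<delta>0 \<le> \<delta> \<Longrightarrow> \<delta> < 1 \<Longrightarrow> ln (1 / \<delta>) * (ln (real n))\<^sup>2 \<le> c2 * real m \<Longrightarrow>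
      competitive_ratio M n X (\<lambda>\<omega>. cdp_ol n m \<delta> x0 (\<lambda>t. X t \<omega>)) \<ge> (1 - \<delta>) * rho1 \<theta>"
    using competitive_ratio_low_confidence_regime[OF assms(1,2), where 'a = 'a] by blast
  obtain K c1 n1 where K: "K \<ge> 0" and c1: "c1 > 0" and conf:
    "\<And>(M :: 'a measure) X n m \<delta>. iid_pareto M n X \<theta> x0 \<Longrightarrow> n \<ge> n1 \<Longrightarrow> 1 \<le> m \<Longrightarrow> 4 * m \<le> n \<Longrightarrow>
      0 < \<delta> \<Longrightarrow> \<delta> \<le> \<delta>0 \<Longrightarrow> ln (1 / \<delta>) * (ln (real n))\<^sup>2 \<le> c1 * real m \<Longrightarrow>
      competitive_ratio M n X (\<lambda>\<omega>. cdp_ol n m \<delta> x0 (\<lambda>t. X t \<omega>)) \<ge>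
        (1 - \<delta>) * rho1 \<theta> * (1 - K * (real m / real n + ln (1 / \<delta>) * (ln (real n))\<^sup>2 / real m))"
    using competitive_ratio_confidence_regime[OF assms(1,2) \<delta>0, where 'a = 'a] by blast
  define h where "h = (\<lambda>n. real (m n) / real n + ln (1 / \<delta> n) * (ln (real n))\<^sup>2 / real (m n))"
  have L: "ln (1 / \<delta> n) > 0" for n using assms(4)[of n] by simp
  have rho: "rho1 \<theta> \<ge> 0"
  proof -
    have "Gamma (1 - 1 / \<theta>) \<ge> 0" using assms(1) by (intro Gamma_real_nonneg) simp
    thus ?thesis by (simp add: rho1_def)
  qed
  have small_m: "\<forall>\<^sub>F n in sequentially. norm (real (m n)) \<le> 1 / 4 * norm (real n)"
    by (rule landau_o.smallD[OF assms(5)]) simp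
  have large_m: "\<forall>\<^sub>F n in sequentially. norm (real (m n)) \<ge> C * norm (ln (1 / \<delta> n) * (ln (real n))\<^sup>2)"
    if "C > 0" for C
    by (rule landau_omega.smallD[OF assms(6) that])
  have "\<forall>\<^sub>F n in sequentially. (1 - \<delta> n) * rho1 \<theta> * (1 - K * h n) \<le>
      competitive_ratio (M n) n (X n) (\<lambda>\<omega>. cdp_ol n (m n) (\<delta> n) x0 (\<lambda>t. X n t \<omega>))"
    using small_m large_m[OF divide_pos_pos[OF zero_less_one c1]] large_m[OF divide_pos_pos[OF zero_less_one c2]]
      eventually_ge_at_top[of "max (max n1 n2) 2"]
  proof eventually_elim
    case (elim n)
    have n: "n \<ge> n1" "n \<ge> n2" "n \<ge> 2" using elim by auto
    have lnsq: "ln (1 / \<delta> n) * (ln (real n))\<^sup>2 > 0" using L[of n] n by (intro mult_pos_pos) auto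
    have sm: "ln (1 / \<delta> n) * (ln (real n))\<^sup>2 \<le> c1 * real (m n)" "ln (1 / \<delta> n) * (ln (real n))\<^sup>2 \<le> c2 * real (m n)"
      using elim c1 c2 lnsq by (auto simp: field_simps)
    \<comment> \<open>That exploration is nonempty follows from the growth condition, as its lower
      bound is strictly positive for \<open>n \<ge> 2\<close>.\<close>
    have "0 < c1 * real (m n)" using sm lnsq by linarith
    hence m1: "1 \<le> m n" using c1 by (cases "m n") auto
    have m4: "4 * m n \<le> n" using elim by simp
    show ?case
    proof (cases "\<delta> n \<le> \<delta>0")
      case True
      thus ?thesis unfolding h_def using n m1 m4 sm assms(4)[of n] by (intro conf[OF assms(3)]) auto
    next
      case False
      \<comment> \<open>For confidence levels above \<open>\<delta>0\<close> the bound holds without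
        any error term, so subtracting a nonnegative error only weakens it.\<close>
      have "h n \<ge> 0" using lnsq by (simp add: h_def)
      hence "1 - K * h n \<le> 1" using K by simp
      hence "(1 - \<delta> n) * rho1 \<theta> * (1 - K * h n) \<le> (1 - \<delta> n) * rho1 \<theta> * 1"
        using rho assms(4)[of n] by (intro mult_left_mono) auto
      also have "\<dots> \<le> competitive_ratio (M n) n (X n) (\<lambda>\<omega>. cdp_ol n (m n) (\<delta> n) x0 (\<lambda>t. X n t \<omega>))"
        using False n m1 m4 sm assms(4)[of n] low[OF assms(3), of n "m n" "\<delta> n"] by simp
      finally show ?thesis .
    qed
  qed
  moreover have "(\<lambda>n. K * h n) \<in> O(h)" by simp
  ultimately show ?thesis unfolding h_def by (intro bexI[of _ "\<lambda>n. K * h n"]) (auto simp: h_def)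
qed

end
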